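(* (a) There exists a finite set $\mathcal{F}$ of pathographs such that the following problem is undecidable: given a pathograph $\mathfrak{H}$, is there an $\mathcal{F}$-free realization of $\mathfrak{H}$? (b) There exists a pathograph $\mathfrak{H}$ such that the following problem is undecidable: given a finite set $\mathcal{F}$ of pathographs, is there an $\mathcal{F}$-free realization of $\mathfrak{H}$?
   Context: All graphs are finite and simple. A pathograph is a tuple $\mathfrak{G}=(V,U,E,S,R,\pi)$ where $V$ (vertices) and $U$ (urpaths) are finite disjoint sets, $E\subseteq\binom{V}{2}$ (edges), $S\subseteq V\times U$ (spokes), $R\subseteq\binom{U}{2}$ (rungs), and $\pi:U\to\binom{V}{2}$ assigns to each urpath its two distinct endpoints, with $\pi(U)\cap E=\emptyset$. A realization of $\mathfrak{G}$ is a graph obtained as follows: start from the graph $(V,E)$; for each urpath $u$ with endpoints $a,b$ add new vertices $x_u^{(1)},\dots,x_u^{(m_u)}$ ($m_u\ge1$, the internal vertices of $u$) and the edges of the path $a x_u^{(1)}\cdots x_u^{(m_u)} b$; the only further edges added are: for each spoke $(v,u)$, a nonempty set of edges between $v$ and internal vertices of $u$; for each rung $\{u,u'\}$, a nonempty set of edges between internal vertices of $u$ and of $u'$. A graph $G$ contains a pathograph $\mathfrak{F}$ if some induced subgraph of $G$ is isomorphic to a realization of $\mathfrak{F}$; $G$ is $\mathcal{F}$-free if it contains no member of $\mathcal{F}$. *)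

theory Defs
  imports Main "HOL-Library.Nat_Bijection"
begin

text \<open>total_rec n f : f, restricted to argument lists of length n, is a total
  (general) recursive function of n arguments.  This is Kleene's class of
  general recursive functions: the closure of zero, successor and projections
  under composition, primitive recursion and regular minimisation.\<close>

inductive total_rec :: "nat \<Rightarrow> (nat list \<Rightarrow> nat) \<Rightarrow> bool" where
  zero: "total_rec n (\<lambda>_. 0)"
| succ: "total_rec 1 (\<lambda>xs. Suc (hd xs))"
| proj: "i < n \<Longrightarrow> total_rec n (\<lambda>xs. xs ! i)"
| comp: "total_rec m f \<Longrightarrow> length gs = m \<Longrightarrow> (\<forall>g\<in>set gs. total_rec n g)
          \<Longrightarrow> total_rec n (\<lambda>xs. f (map (\<lambda>g. g xs) gs))"
| prim: "total_rec n f \<Longrightarrow> total_rec (Suc (Suc n)) g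
          \<Longrightarrow> total_rec (Suc n)
                (\<lambda>ys. rec_nat (f (tl ys)) (\<lambda>y r. g (y # r # tl ys)) (hd ys))"
| mu: "total_rec (Suc n) g \<Longrightarrow> (\<forall>xs. length xs = n \<longrightarrow> (\<exists>y. g (y # xs) = 0))
          \<Longrightarrow> total_rec n (\<lambda>xs. LEAST y. g (y # xs) = 0)"
| ext: "total_rec n f \<Longrightarrow> (\<forall>xs. length xs = n \<longrightarrow> g xs = f xs) \<Longrightarrow> total_rec n g"

text \<open>Vertices and urpaths are natural numbers (disjoint finite sets);
  pi u is the 2-element set of endpoints of urpath u.\<close>

record pathograph =
  pV :: "nat set"
  pU :: "nat set"
  pE :: "nat set set"
  pS :: "(nat \<times> nat) set"
  pR :: "nat set set"
  ppi :: "nat \<Rightarrow> nat set"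

definition wf_pathograph :: "pathograph \<Rightarrow> bool" where
  "wf_pathograph H \<longleftrightarrow>
     finite (pV H) \<and> finite (pU H) \<and> pV H \<inter> pU H = {} \<and>
     pE H \<subseteq> {e. e \<subseteq> pV H \<and> card e = 2} \<and>
     pS H \<subseteq> pV H \<times> pU H \<and>
     pR H \<subseteq> {r. r \<subseteq> pU H \<and> card r = 2} \<and>
     (\<forall>u\<in>pU H. ppi H u \<subseteq> pV H \<and> card (ppi H u) = 2 \<and> ppi H u \<notin> pE H)"

definition path_edges :: "'a list \<Rightarrow> 'a set set" where
  "path_edges xs = {{xs ! i, xs ! Suc i} | i. Suc i < length xs}"

text \<open>A graph (W, EG) on natural-number vertices is a realization of H if it is
  (isomorphic to) a graph obtained by the construction: phi embeds V, each urpath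
  u becomes the path  phi a, P u, phi b  with ends (a,b) = en u, {a,b} = pi u,
  P u nonempty, and the only other edges are spoke/rung edges, at least one for
  every spoke and every rung.\<close>
definition realization :: "pathograph \<Rightarrow> nat set \<Rightarrow> nat set set \<Rightarrow> bool" where
  "realization H W EG \<longleftrightarrow>
     finite W \<and> EG \<subseteq> {e. e \<subseteq> W \<and> card e = 2} \<and>
     (\<exists>(\<phi>::nat \<Rightarrow> nat) (P::nat \<Rightarrow> nat list) (en::nat \<Rightarrow> nat \<times> nat).
        inj_on \<phi> (pV H) \<and>
        (\<forall>u\<in>pU H. {fst (en u), snd (en u)} = ppi H u) \<and>
        (\<forall>u\<in>pU H. P u \<noteq> [] \<and> distinct (P u) \<and> set (P u) \<inter> \<phi> ` pV H = {}) \<and>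
        (\<forall>u\<in>pU H. \<forall>u'\<in>pU H. u \<noteq> u' \<longrightarrow> set (P u) \<inter> set (P u') = {}) \<and>
        W = \<phi> ` pV H \<union> (\<Union>u\<in>pU H. set (P u)) \<and>
        (\<forall>e\<in>pE H. \<phi> ` e \<in> EG) \<and>
        (\<forall>u\<in>pU H. path_edges (\<phi> (fst (en u)) # P u @ [\<phi> (snd (en u))]) \<subseteq> EG) \<and>
        (\<forall>(v,u)\<in>pS H. \<exists>x\<in>set (P u). {\<phi> v, x} \<in> EG) \<and>
        (\<forall>u u'. {u,u'} \<in> pR H \<longrightarrow> (\<exists>x\<in>set (P u). \<exists>y\<in>set (P u'). {x,y} \<in> EG)) \<and>
        (\<forall>e\<in>EG.
           (\<exists>e'\<in>pE H. e = \<phi> ` e') \<or>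
           (\<exists>u\<in>pU H. e \<in> path_edges (\<phi> (fst (en u)) # P u @ [\<phi> (snd (en u))])) \<or>
           (\<exists>(v,u)\<in>pS H. \<exists>x\<in>set (P u). e = {\<phi> v, x}) \<or>
           (\<exists>u u'. {u,u'} \<in> pR H \<and> (\<exists>x\<in>set (P u). \<exists>y\<in>set (P u'). e = {x,y}))))"

definition contains_pg :: "nat set \<Rightarrow> nat set set \<Rightarrow> pathograph \<Rightarrow> bool" where
  "contains_pg W EG F \<longleftrightarrow> (\<exists>W'\<subseteq>W. realization F W' {e\<in>EG. e \<subseteq> W'})"

definition pg_free :: "pathograph set \<Rightarrow> nat set \<Rightarrow> nat set set \<Rightarrow> bool" where
  "pg_free \<F> W EG \<longleftrightarrow> (\<forall>F\<in>\<F>. \<not> contains_pg W EG F)"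

definition has_free_realization :: "pathograph set \<Rightarrow> pathograph \<Rightarrow> bool" where
  "has_free_realization \<F> H \<longleftrightarrow> (\<exists>W EG. realization H W EG \<and> pg_free \<F> W EG)"

definition pg_code :: "pathograph \<Rightarrow> nat" where
  "pg_code H = list_encode
     [set_encode (pV H), set_encode (pU H), set_encode (set_encode ` pE H),
      set_encode (prod_encode ` pS H), set_encode (set_encode ` pR H),
      set_encode ((\<lambda>u. prod_encode (u, set_encode (ppi H u))) ` pU H)]"

definition family_code :: "pathograph set \<Rightarrow> nat" where
  "family_code \<F> = set_encode (pg_code ` \<F>)"

end

theory Submission
  imports Defs
begin

text \<open>Every total recursive function is computed by a program over counters, and a diagonal argument
  yields one counter machine whose set of accepted inputs is undecidable.  A run of the machine is drawn
  as a graph: one long path is the time line, one further path per counter is the line of its values, and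
  each time is joined to the current values and to vertices labelling its state.  Labels and path ends are
  adjacent to a rigid threshold graph, so that an induced copy of a pattern containing that graph cannot
  be displaced.  Forbidding all pathographs of bounded size that occur in no graph of a run forces every
  realization to be locally, hence globally, a run.  The input is put either into the pathograph to be
  realized, or into finitely many further forbidden patterns fixing the initial value of the first
  counter.\<close>

subsection \<open>Closure properties of total recursive functions\<close>

text \<open>A realization is free in the lengths of its urpaths and in the choice of spoke and rung
  edges, and containment forgets all names. Small patterns can enforce a condition only if names and
  directions are visible in the adjacency: hence the rigid roots, and hence position labels modulo
  3, which tell successor from predecessor on a path. A step involves two times and at most
  \<open>2 * k\<close> values, and with the roots this fits the size bound of
  \<open>forbidden\<close>. That family is described by a property and not listed, since only its
  finiteness matters: its code enters the reductions as a constant. One condition is not local,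
  namely that a time has a value at all; it is enforced by a pattern whose urpath must run through
  an entire value line. Spokes and rungs are obligations as well as permissions, so a run is
  prolonged after halting by a tail, marked by \<open>junk\<close>, in which all states and enough
  values occur. In (b) the fixed pathograph has an explicit value 0 not joined to the initial time;
  inputs are therefore shifted to \<open>Suc n\<close>, and the added patterns exclude initial
  values up to \<open>n\<close> and above \<open>Suc n\<close>.\<close>

lemma total_rec_const: "total_rec n (\<lambda>_. c)"
proof (induction c)
  case 0
  show ?case by (rule total_rec.zero)
next
  case (Suc c)
  have "total_rec n (\<lambda>xs. (\<lambda>xs. Suc (hd xs)) (map (\<lambda>g. g xs) [\<lambda>_. c]))"
    by (rule total_rec.comp[OF total_rec.succ]) (use Suc in auto)
  then show ?case by simp
qed

lemma total_rec_Suc: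
  assumes "total_rec n f" shows "total_rec n (\<lambda>xs. Suc (f xs))"
proof -
  have "total_rec n (\<lambda>xs. (\<lambda>xs. Suc (hd xs)) (map (\<lambda>g. g xs) [f]))"
    by (rule total_rec.comp[OF total_rec.succ]) (use assms in auto)
  then show ?thesis by simp
qed

lemma total_rec_comp1:
  assumes "total_rec 1 (\<lambda>xs. h (xs ! 0))" "total_rec n f"
  shows "total_rec n (\<lambda>xs. h (f xs))"
proof -
  have "total_rec n (\<lambda>xs. (\<lambda>xs. h (xs ! 0)) (map (\<lambda>g. g xs) [f]))"
    by (rule total_rec.comp[OF assms(1)]) (use assms in auto)
  then show ?thesis by simp
qed

lemma total_rec_nth_tl: "Suc i < n \<Longrightarrow> total_rec n (\<lambda>xs. tl xs ! i)"
  by (rule total_rec.ext[OF total_rec.proj[of "Suc i"]]) (auto simp: nth_tl)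

lemma total_rec_tl:
  assumes "total_rec n f"
  shows "total_rec (Suc n) (\<lambda>xs. f (tl xs))"
proof -
  let ?gs = "map (\<lambda>i xs. xs ! Suc i) [0..<n]"
  have "total_rec (Suc n) (\<lambda>xs. f (map (\<lambda>g. g xs) ?gs))"
    by (rule total_rec.comp[OF assms]) (auto intro: total_rec.proj)
  then show ?thesis
  proof (rule total_rec.ext, intro allI impI)
    fix xs :: "nat list" assume "length xs = Suc n"
    then have "tl xs = map (\<lambda>i. xs ! Suc i) [0..<n]"
      by (intro nth_equalityI) (auto simp: nth_tl)
    then show "f (tl xs) = f (map (\<lambda>g. g xs) ?gs)"
      by (simp add: comp_def)
  qed
qed

text \<open>The constructor recurses on the head of the argument list. Composition with
  \<open>b\<close> and the projections turns this into recursion up to a computed bound, with the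
  whole list kept as parameter.\<close>

lemma total_rec_prim:
  assumes "total_rec n b" "total_rec n f" "total_rec (Suc (Suc n)) (\<lambda>ys. g (ys ! 0) (ys ! 1) (tl (tl ys)))"
  shows "total_rec n (\<lambda>xs. rec_nat (f xs) (\<lambda>y r. g y r xs) (b xs))"
proof -
  let ?h = "\<lambda>ys. rec_nat (f (tl ys)) (\<lambda>y r. g y r (tl ys)) (hd ys)"
  have 1: "total_rec (Suc n) ?h"
    using total_rec.prim[OF assms(2,3)] by simp
  let ?gs = "b # map (\<lambda>i xs. xs ! i) [0..<n]"
  have "total_rec n (\<lambda>xs. ?h (map (\<lambda>g. g xs) ?gs))"
    by (rule total_rec.comp[OF 1]) (use assms(1) in \<open>auto intro: total_rec.proj\<close>)
  then show ?thesis
  proof (rule total_rec.ext, intro allI impI)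
    fix xs :: "nat list" assume "length xs = n"
    then have "xs = map (\<lambda>i. xs ! i) [0..<n]"
      by (metis map_nth)
    then show "rec_nat (f xs) (\<lambda>y r. g y r xs) (b xs) = ?h (map (\<lambda>g. g xs) ?gs)"
      by (simp add: comp_def)
  qed
qed

lemma total_rec_add:
  assumes "total_rec n f" "total_rec n g" shows "total_rec n (\<lambda>xs. f xs + g xs)"
proof -
  have "total_rec n (\<lambda>xs. rec_nat (f xs) (\<lambda>y r. Suc r) (g xs))"
    by (rule total_rec_prim[OF assms(2,1)]) (auto intro!: total_rec_Suc total_rec.proj)
  moreover have "rec_nat a (\<lambda>y r. Suc r) b = a + b" for a b by (induction b) auto
  ultimately show ?thesis by simp
qed

lemma total_rec_mult:
  assumes "total_rec n f" "total_rec n g" shows "total_rec n (\<lambda>xs. f xs * g xs)"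
proof -
  have "total_rec n (\<lambda>xs. rec_nat 0 (\<lambda>y r. r + f xs) (g xs))"
    by (rule total_rec_prim[OF assms(2) total_rec.zero, where g = "\<lambda>y r xs. r + f xs"])
      (intro total_rec_add total_rec.proj total_rec_tl assms, simp)
  moreover have "rec_nat 0 (\<lambda>y r. r + a) b = a * b" for a b :: nat by (induction b) auto
  ultimately show ?thesis by simp
qed

lemma total_rec_power:
  assumes "total_rec n f" "total_rec n g" shows "total_rec n (\<lambda>xs. f xs ^ g xs)"
proof -
  have "total_rec n (\<lambda>xs. rec_nat 1 (\<lambda>y r. f xs * r) (g xs))"
    by (rule total_rec_prim[OF assms(2) total_rec_const, where g = "\<lambda>y r xs. f xs * r"])
      (intro total_rec_mult total_rec.proj total_rec_tl assms, simp)
  moreover have "rec_nat 1 (\<lambda>y r. a * r) b = a ^ b" for a b :: nat by (induction b) auto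
  ultimately show ?thesis by simp
qed

lemma total_rec_diff:
  assumes "total_rec n f" "total_rec n g" shows "total_rec n (\<lambda>xs. f xs - g xs)"
proof -
  have pred: "total_rec m (\<lambda>xs. h xs - 1)" if "total_rec m h" for m h
  proof -
    have "total_rec m (\<lambda>xs. rec_nat 0 (\<lambda>y r. y) (h xs))"
      by (rule total_rec_prim[OF that total_rec.zero]) (auto intro!: total_rec.proj)
    moreover have "rec_nat 0 (\<lambda>y r. y) b = b - 1" for b :: nat by (cases b) auto
    ultimately show ?thesis by simp
  qed
  have "total_rec n (\<lambda>xs. rec_nat (f xs) (\<lambda>y r. r - 1) (g xs))"
    by (rule total_rec_prim[OF assms(2,1)]) (intro pred total_rec.proj, simp)
  moreover have "rec_nat a (\<lambda>y r. r - 1) b = a - b" for a b :: nat by (induction b) auto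
  ultimately show ?thesis by simp
qed

text \<open>Bounded sums carry most of what follows: bounded quantifiers, division and codes of sets
  are all expressed by them.\<close>

lemma total_rec_sum:
  assumes "total_rec n b" "total_rec (Suc n) (\<lambda>ys. g (ys ! 0) (tl ys))"
  shows "total_rec n (\<lambda>xs. \<Sum>y<b xs. g y xs)"
proof -
  \<comment> \<open>The projections skip index 1, the accumulator of the recursion, which the
    summand must not see.\<close>
  let ?gs = "(\<lambda>xs. xs ! 0) # map (\<lambda>i xs. xs ! Suc (Suc i)) [0..<n]"
  have "total_rec (Suc (Suc n)) (\<lambda>xs. (\<lambda>ys. g (ys ! 0) (tl ys)) (map (\<lambda>g. g xs) ?gs))"
    by (rule total_rec.comp[OF assms(2)]) (auto intro: total_rec.proj)
  then have *: "total_rec (Suc (Suc n)) (\<lambda>ys. g (ys ! 0) (tl (tl ys)))"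
  proof (rule total_rec.ext, intro allI impI)
    fix xs :: "nat list" assume "length xs = Suc (Suc n)"
    then have "tl (tl xs) = map (\<lambda>i. xs ! Suc (Suc i)) [0..<n]"
      by (intro nth_equalityI) (auto simp: nth_tl)
    then show "g (xs ! 0) (tl (tl xs)) = (\<lambda>ys. g (ys ! 0) (tl ys)) (map (\<lambda>g. g xs) ?gs)"
      by (simp add: comp_def)
  qed
  have "total_rec n (\<lambda>xs. rec_nat 0 (\<lambda>y r. r + g y xs) (b xs))"
    by (rule total_rec_prim[OF assms(1) total_rec.zero, where g = "\<lambda>y r xs. r + g y xs"])
      (intro total_rec_add total_rec.proj *, simp)
  moreover have "rec_nat 0 (\<lambda>y r. r + h y) b = (\<Sum>y<b. h y)" for h :: "nat \<Rightarrow> nat" and b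
    by (induction b) auto
  ultimately show ?thesis by simp
qed

definition decidable_pred :: "nat \<Rightarrow> (nat list \<Rightarrow> bool) \<Rightarrow> bool" where
  "decidable_pred n P \<longleftrightarrow> total_rec n (\<lambda>xs. of_bool (P xs))"

lemma total_rec_of_bool: "decidable_pred n P \<Longrightarrow> total_rec n (\<lambda>xs. of_bool (P xs))"
  by (simp add: decidable_pred_def)

lemma decidable_pred_not: "decidable_pred n P \<Longrightarrow> decidable_pred n (\<lambda>xs. \<not> P xs)"
  unfolding decidable_pred_def of_bool_not_iff
  using total_rec_diff[OF total_rec_const[of n 1]]
  by (rule total_rec.ext) (auto simp: of_bool_def)

lemma decidable_pred_conj:
  "decidable_pred n P \<Longrightarrow> decidable_pred n Q \<Longrightarrow> decidable_pred n (\<lambda>xs. P xs \<and> Q xs)"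
  unfolding decidable_pred_def of_bool_conj by (rule total_rec_mult)

lemma decidable_pred_disj:
  "decidable_pred n P \<Longrightarrow> decidable_pred n Q \<Longrightarrow> decidable_pred n (\<lambda>xs. P xs \<or> Q xs)"
  using decidable_pred_not[OF decidable_pred_conj[OF decidable_pred_not decidable_pred_not]]
  by simp

lemma decidable_pred_imp:
  "decidable_pred n P \<Longrightarrow> decidable_pred n Q \<Longrightarrow> decidable_pred n (\<lambda>xs. P xs \<longrightarrow> Q xs)"
  unfolding imp_conv_disj by (intro decidable_pred_disj decidable_pred_not)

lemma decidable_pred_le:
  assumes "total_rec n f" "total_rec n g" shows "decidable_pred n (\<lambda>xs. f xs \<le> g xs)"
proof -
  have "total_rec n (\<lambda>xs. 1 - (f xs - g xs))"
    by (intro total_rec_diff total_rec_const assms)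
  then show ?thesis
    unfolding decidable_pred_def by (rule total_rec.ext) (auto simp: of_bool_def)
qed

lemma decidable_pred_less:
  assumes "total_rec n f" "total_rec n g" shows "decidable_pred n (\<lambda>xs. f xs < g xs)"
  using decidable_pred_le[OF total_rec_Suc[OF assms(1)] assms(2)] by (simp add: Suc_le_eq)

lemma decidable_pred_eq:
  assumes "total_rec n f" "total_rec n g" shows "decidable_pred n (\<lambda>xs. f xs = g xs)"
  unfolding eq_iff by (intro decidable_pred_conj decidable_pred_le assms)

lemma decidable_pred_ex:
  assumes "total_rec n b" "decidable_pred (Suc n) (\<lambda>ys. P (ys ! 0) (tl ys))"
  shows "decidable_pred n (\<lambda>xs. \<exists>y<b xs. P y xs)"
proof -
  have "decidable_pred n (\<lambda>xs. 0 < (\<Sum>y<b xs. of_bool (P y xs) :: nat))"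
    by (intro decidable_pred_less total_rec_const total_rec_sum total_rec_of_bool assms)
  moreover have "0 < (\<Sum>y<c. of_bool (Q y) :: nat) \<longleftrightarrow> (\<exists>y<c. Q y)" for c :: nat and Q
    by (auto simp: zero_less_iff_neq_zero)
  ultimately show ?thesis by simp
qed

lemma decidable_pred_all:
  assumes "total_rec n b" "decidable_pred (Suc n) (\<lambda>ys. P (ys ! 0) (tl ys))"
  shows "decidable_pred n (\<lambda>xs. \<forall>y<b xs. P y xs)"
  using decidable_pred_not[OF decidable_pred_ex[OF assms(1) decidable_pred_not[OF assms(2)]]]
  by simp

lemma decidable_pred_const: "decidable_pred n (\<lambda>_. P)"
  unfolding decidable_pred_def by (rule total_rec_const)

lemma total_rec_if:
  assumes "decidable_pred n P" "total_rec n f" "total_rec n g"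
  shows "total_rec n (\<lambda>xs. if P xs then f xs else g xs)"
proof -
  have "total_rec n (\<lambda>xs. of_bool (P xs) * f xs + of_bool (\<not> P xs) * g xs)"
    by (intro total_rec_add total_rec_mult total_rec_of_bool decidable_pred_not assms)
  then show ?thesis by (rule total_rec.ext) auto
qed

lemma total_rec_div:
  assumes "total_rec n f" "total_rec n g" shows "total_rec n (\<lambda>xs. f xs div g xs)"
proof -
  \<comment> \<open>The quotient counts the \<open>q\<close> with \<open>Suc q * b \<le> a\<close>;
    the guard \<open>0 < b\<close> yields the value 0 of a division by zero.\<close>
  have eq: "a div b = (\<Sum>q<a. of_bool (0 < b \<and> Suc q * b \<le> a))" for a b :: nat
  proof (cases "b = 0")
    case False
    then have "Suc q * b \<le> a \<longleftrightarrow> q < a div b" for q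
      using less_eq_div_iff_mult_less_eq[of b "Suc q" a] by (simp add: Suc_le_eq)
    then have "{q. q < a \<and> Suc q * b \<le> a} = {..<a div b}"
      by (auto intro: less_le_trans[OF _ div_le_dividend] simp del: mult_Suc)
    then show ?thesis using False
      by (simp add: sum_of_bool_eq lessThan_def Int_def del: mult_Suc)
  qed simp
  show ?thesis unfolding eq
    by (intro total_rec_sum total_rec_of_bool decidable_pred_conj decidable_pred_less
        decidable_pred_le total_rec_const total_rec_mult total_rec_Suc total_rec.proj
        total_rec_tl assms) simp_all
qed

lemma total_rec_mod:
  assumes "total_rec n f" "total_rec n g" shows "total_rec n (\<lambda>xs. f xs mod g xs)"
  unfolding modulo_nat_def by (intro total_rec_diff total_rec_div total_rec_mult assms)

lemma total_rec_prod_encode: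
  assumes "total_rec n f" "total_rec n g" shows "total_rec n (\<lambda>xs. prod_encode (f xs, g xs))"
  unfolding prod_encode_def triangle_def prod.case
  by (intro total_rec_add total_rec_div total_rec_mult total_rec_Suc total_rec_const assms)

lemma decidable_pred_set_decode:
  assumes "total_rec n f" "total_rec n g" shows "decidable_pred n (\<lambda>xs. f xs \<in> set_decode (g xs))"
  unfolding set_decode_def mem_Collect_eq odd_iff_mod_2_eq_one
  by (intro decidable_pred_eq total_rec_mod total_rec_div total_rec_power total_rec_const assms)

text \<open>Each bounded quantifier or sum pushes its variable in front of the argument list, so
  parameters appear behind iterated \<open>tl\<close>. Eight levels are reached in
  \<open>decidable_justified\<close>, where the clause for primitive recursion lies under eight
  bound variables.\<close>

lemma total_rec_nth_tl_tl: "Suc (Suc i) < n \<Longrightarrow> total_rec n (\<lambda>xs. tl (tl xs) ! i)"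
  by (rule total_rec.ext[OF total_rec.proj[of "Suc (Suc i)"]]) (auto simp: nth_tl)

lemma total_rec_nth_tl3: "i + 3 < n \<Longrightarrow> total_rec n (\<lambda>xs. tl (tl (tl xs)) ! i)"
  by (rule total_rec.ext[OF total_rec.proj[of "i + 3"]]) (auto simp: nth_tl numeral_3_eq_3)

lemma total_rec_nth_tl4: "i + 4 < n \<Longrightarrow> total_rec n (\<lambda>xs. tl (tl (tl (tl xs))) ! i)"
  by (rule total_rec.ext[OF total_rec.proj[of "i + 4"]]) (auto simp: nth_tl eval_nat_numeral)

lemma total_rec_nth_tl5: "i + 5 < n \<Longrightarrow> total_rec n (\<lambda>xs. tl (tl (tl (tl (tl xs)))) ! i)"
  by (rule total_rec.ext[OF total_rec.proj[of "i + 5"]]) (auto simp: nth_tl eval_nat_numeral)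

lemma total_rec_nth_tl6: "i + 6 < n \<Longrightarrow> total_rec n (\<lambda>xs. tl (tl (tl (tl (tl (tl xs))))) ! i)"
  by (rule total_rec.ext[OF total_rec.proj[of "i + 6"]]) (auto simp: nth_tl eval_nat_numeral)

lemma total_rec_nth_tl7: "i + 7 < n \<Longrightarrow> total_rec n (\<lambda>xs. tl (tl (tl (tl (tl (tl (tl xs)))))) ! i)"
  by (rule total_rec.ext[OF total_rec.proj[of "i + 7"]]) (auto simp: nth_tl eval_nat_numeral)

lemma total_rec_nth_tl8: "i + 8 < n \<Longrightarrow> total_rec n (\<lambda>xs. tl (tl (tl (tl (tl (tl (tl (tl xs))))))) ! i)"
  by (rule total_rec.ext[OF total_rec.proj[of "i + 8"]]) (auto simp: nth_tl eval_nat_numeral)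

lemmas total_rec_intros =
  total_rec_const total_rec.proj total_rec_nth_tl total_rec_nth_tl_tl total_rec_nth_tl3
  total_rec_nth_tl4 total_rec_nth_tl5 total_rec_nth_tl6 total_rec_nth_tl7 total_rec_nth_tl8
  total_rec_Suc total_rec_add total_rec_diff total_rec_mult total_rec_power total_rec_div
  total_rec_mod total_rec_prod_encode total_rec_sum total_rec_of_bool total_rec_if
  decidable_pred_const decidable_pred_not decidable_pred_conj decidable_pred_disj
  decidable_pred_imp decidable_pred_le decidable_pred_less decidable_pred_eq
  decidable_pred_ex decidable_pred_all decidable_pred_set_decode

subsection \<open>An undecidable recursively enumerable set\<close>

text \<open>Agrees with \<open>list_encode\<close> on a nonempty list, so codes of argument lists
  are taken apart and built by pairing alone.\<close>

abbreviation cons_code :: "nat \<Rightarrow> nat \<Rightarrow> nat" where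
  "cons_code x r \<equiv> Suc (prod_encode (x, r))"

text \<open>A triple \<open>(c, a, v)\<close> reads: the program coded by \<open>c\<close> yields
  \<open>v\<close> on the list coded by \<open>a\<close>. The tags 0 to 6 stand for zero, successor,
  projection, composition, a list of programs run side by side, primitive recursion and
  minimisation. Each clause asks that \<open>X\<close> contain the facts from which the triple
  follows in one evaluation step.\<close>

definition justified_by :: "(nat \<times> nat \<times> nat) set \<Rightarrow> nat \<Rightarrow> nat \<Rightarrow> nat \<Rightarrow> bool" where
  "justified_by X c a v \<longleftrightarrow>
     (c = prod_encode (0, 0) \<and> v = 0) \<or>
     (c = prod_encode (1, 0) \<and> (\<exists>x r. a = cons_code x r \<and> v = Suc x)) \<or>
     (c = prod_encode (2, 0) \<and> (\<exists>r. a = cons_code v r)) \<or>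
     (\<exists>i. c = prod_encode (2, Suc i) \<and> (\<exists>x r. a = cons_code x r \<and> (prod_encode (2, i), r, v) \<in> X)) \<or>
     (\<exists>f g. c = prod_encode (3, prod_encode (f, g)) \<and>
        (\<exists>w. (prod_encode (4, g), a, w) \<in> X \<and> (f, w, v) \<in> X)) \<or>
     (c = prod_encode (4, 0) \<and> v = 0) \<or>
     (\<exists>g h. c = prod_encode (4, cons_code g h) \<and>
        (\<exists>u w. v = cons_code u w \<and> (g, a, u) \<in> X \<and> (prod_encode (4, h), a, w) \<in> X)) \<or>
     (\<exists>f g. c = prod_encode (5, prod_encode (f, g)) \<and>
        ((\<exists>r. a = cons_code 0 r \<and> (f, r, v) \<in> X) \<or>
         (\<exists>u r w. a = cons_code (Suc u) r \<and> (c, cons_code u r, w) \<in> X \<and>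
            (g, cons_code u (cons_code w r), v) \<in> X))) \<or>
     (\<exists>g. c = prod_encode (6, g) \<and> (g, cons_code v a, 0) \<in> X \<and>
        (\<forall>z<v. \<exists>w. (g, cons_code z a, Suc w) \<in> X))"

text \<open>A finite set of this kind is a certificate for each of its evaluations: it can be coded
  by a number and checked, which makes evaluation enumerable without an interpreter.\<close>

definition justified :: "(nat \<times> nat \<times> nat) set \<Rightarrow> bool" where
  "justified X \<longleftrightarrow> (\<forall>(c, a, v) \<in> X. justified_by X c a v)"

lemma justified_by_mono: "justified_by X c a v \<Longrightarrow> X \<subseteq> Y \<Longrightarrow> justified_by Y c a v"
  unfolding justified_by_def by (elim disjE exE conjE) (simp; blast)+

lemma justified_Un: "justified X \<Longrightarrow> justified Y \<Longrightarrow> justified (X \<union> Y)"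
  unfolding justified_def using justified_by_mono[of X _ _ _ "X \<union> Y"] justified_by_mono[of Y _ _ _ "X \<union> Y"]
  by blast

lemma justified_UN: "(\<And>i. i \<in> I \<Longrightarrow> justified (X i)) \<Longrightarrow> justified (\<Union>i\<in>I. X i)"
  unfolding justified_def using justified_by_mono[of "X _" _ _ _ "\<Union>i\<in>I. X i"]
  by blast

lemma justified_insert: "justified X \<Longrightarrow> justified_by X c a v \<Longrightarrow> justified (insert (c, a, v) X)"
  unfolding justified_def using justified_by_mono[of X _ _ _ "insert (c, a, v) X"]
  by blast

definition derivable :: "nat \<Rightarrow> nat \<Rightarrow> nat \<Rightarrow> bool" where
  "derivable c a v \<longleftrightarrow> (\<exists>X. finite X \<and> justified X \<and> (c, a, v) \<in> X)"

lemma derivableI: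
  assumes "finite X" "justified X" "justified_by X c a v"
  shows "derivable c a v"
  unfolding derivable_def using assms justified_insert[OF assms(2,3)] by blast

lemma derivable2:
  assumes "derivable c a v" "derivable c' a' v'"
  obtains X where "finite X" "justified X" "(c, a, v) \<in> X" "(c', a', v') \<in> X"
  using assms justified_Un unfolding derivable_def by (metis UnCI finite_UnI)

text \<open>The first conjunct makes every certificate trustworthy, the second makes one exist. The
  diagonal argument needs both, since it infers \<open>f [c]\<close> from whatever certificate a
  search may find.\<close>

definition represents :: "nat \<Rightarrow> nat \<Rightarrow> (nat list \<Rightarrow> nat) \<Rightarrow> bool" where
  "represents c n f \<longleftrightarrow>
     (\<forall>X xs v. justified X \<longrightarrow> length xs = n \<longrightarrow> (c, list_encode xs, v) \<in> X \<longrightarrow> v = f xs) \<and>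
     (\<forall>xs. length xs = n \<longrightarrow> derivable c (list_encode xs) (f xs))"

lemma justifiedD: "justified X \<Longrightarrow> (c, a, v) \<in> X \<Longrightarrow> justified_by X c a v"
  unfolding justified_def by blast

lemma derivable_self: "(\<And>X. justified_by X c a v) \<Longrightarrow> derivable c a v"
  by (rule derivableI[of "{}"]) (auto simp: justified_def)

lemma represents_zero: "represents (prod_encode (0, 0)) n (\<lambda>_. 0)"
  unfolding represents_def
  by (auto dest!: justifiedD intro!: derivable_self simp: justified_by_def)

lemma represents_succ: "represents (prod_encode (1, 0)) 1 (\<lambda>xs. Suc (hd xs))"
  unfolding represents_def
  by (auto dest!: justifiedD intro!: derivable_self simp: justified_by_def length_Suc_conv)

lemma represents_proj: "i < n \<Longrightarrow> represents (prod_encode (2, i)) n (\<lambda>xs. xs ! i)"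
proof (induction i arbitrary: n)
  case 0
  then show ?case unfolding represents_def
    by (auto dest!: justifiedD intro!: derivable_self simp: justified_by_def gr0_conv_Suc length_Suc_conv)
next
  case (Suc i)
  then obtain m where n: "n = Suc m" "i < m" by (cases n) auto
  note IH = Suc.IH[OF n(2), unfolded represents_def]
  show ?case unfolding represents_def n(1)
  proof (intro conjI allI impI)
    fix X and xs :: "nat list" and v
    assume X: "justified X" and l: "length xs = Suc m" and f: "(prod_encode (2, Suc i), list_encode xs, v) \<in> X"
    obtain x r where "xs = x # r" using l by (cases xs) auto
    then show "v = xs ! Suc i" using justifiedD[OF X f] IH X l by (auto simp: justified_by_def)
  next
    fix xs :: "nat list" assume l: "length xs = Suc m"
    obtain x r where xs: "xs = x # r" using l by (cases xs) auto
    then have "derivable (prod_encode (2, i)) (list_encode r) (r ! i)" using IH l by auto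
    then obtain X where "finite X" "justified X" "(prod_encode (2, i), list_encode r, r ! i) \<in> X"
      unfolding derivable_def by blast
    then show "derivable (prod_encode (2, Suc i)) (list_encode xs) (xs ! Suc i)"
      by (intro derivableI[of X]) (auto simp: justified_by_def xs)
  qed
qed

text \<open>Composition has arbitrarily many inner functions. Their codes are chained under tag 4,
  and the chain evaluates to the code of the list of their values, which is then the input of the
  outer function.\<close>

lemma represents_list:
  assumes "\<And>g. g \<in> set gs \<Longrightarrow> \<exists>c. represents c n g"
  shows "\<exists>d. represents (prod_encode (4, d)) n (\<lambda>xs. list_encode (map (\<lambda>g. g xs) gs))"
  using assms
proof (induction gs)
  case Nil
  have "represents (prod_encode (4, 0)) n (\<lambda>xs. list_encode (map (\<lambda>g. g xs) []))"
    unfolding represents_def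
    by (auto dest!: justifiedD intro!: derivable_self simp: justified_by_def)
  then show ?case by blast
next
  case (Cons g gs)
  then obtain c d where c: "represents c n g"
    and d: "represents (prod_encode (4, d)) n (\<lambda>xs. list_encode (map (\<lambda>g. g xs) gs))"
    by (metis list.set_intros)
  have "represents (prod_encode (4, cons_code c d)) n (\<lambda>xs. list_encode (map (\<lambda>g. g xs) (g # gs)))"
    unfolding represents_def
  proof (intro conjI allI impI)
    fix X and xs :: "nat list" and v
    assume X: "justified X" and l: "length xs = n"
      and f: "(prod_encode (4, cons_code c d), list_encode xs, v) \<in> X"
    show "v = list_encode (map (\<lambda>g. g xs) (g # gs))"
      using justifiedD[OF X f] c d X l by (auto simp: justified_by_def represents_def)
  next
    fix xs :: "nat list" assume l: "length xs = n"
    then have "derivable c (list_encode xs) (g xs)"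
      "derivable (prod_encode (4, d)) (list_encode xs) (list_encode (map (\<lambda>g. g xs) gs))"
      using c d by (auto simp: represents_def)
    then obtain X where "finite X" "justified X" "(c, list_encode xs, g xs) \<in> X"
      "(prod_encode (4, d), list_encode xs, list_encode (map (\<lambda>g. g xs) gs)) \<in> X"
      by (rule derivable2)
    then show "derivable (prod_encode (4, cons_code c d)) (list_encode xs) (list_encode (map (\<lambda>g. g xs) (g # gs)))"
      by (intro derivableI[of X]) (auto simp: justified_by_def)
  qed
  then show ?case by blast
qed

lemma represents_comp:
  assumes c: "represents c m f" and m: "length gs = m"
    and d: "represents (prod_encode (4, d)) n (\<lambda>xs. list_encode (map (\<lambda>g. g xs) gs))"
  shows "represents (prod_encode (3, prod_encode (c, d))) n (\<lambda>xs. f (map (\<lambda>g. g xs) gs))"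
  unfolding represents_def
proof (intro conjI allI impI)
  fix X and xs :: "nat list" and v
  assume X: "justified X" and l: "length xs = n"
    and f: "(prod_encode (3, prod_encode (c, d)), list_encode xs, v) \<in> X"
  show "v = f (map (\<lambda>g. g xs) gs)"
    using justifiedD[OF X f] c d X l m by (auto simp: justified_by_def represents_def)
next
  fix xs :: "nat list" assume l: "length xs = n"
  then have "derivable (prod_encode (4, d)) (list_encode xs) (list_encode (map (\<lambda>g. g xs) gs))"
    "derivable c (list_encode (map (\<lambda>g. g xs) gs)) (f (map (\<lambda>g. g xs) gs))"
    using c d m by (auto simp: represents_def)
  then obtain X where "finite X" "justified X"
    "(prod_encode (4, d), list_encode xs, list_encode (map (\<lambda>g. g xs) gs)) \<in> X"
    "(c, list_encode (map (\<lambda>g. g xs) gs), f (map (\<lambda>g. g xs) gs)) \<in> X"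
    by (rule derivable2)
  then show "derivable (prod_encode (3, prod_encode (c, d))) (list_encode xs) (f (map (\<lambda>g. g xs) gs))"
    by (intro derivableI[of X]) (auto simp: justified_by_def)
qed

lemma represents_prim:
  assumes c: "represents c n f" and d: "represents d (Suc (Suc n)) g"
  shows "represents (prod_encode (5, prod_encode (c, d))) (Suc n)
           (\<lambda>ys. rec_nat (f (tl ys)) (\<lambda>y r. g (y # r # tl ys)) (hd ys))"
    (is "represents ?e _ ?h")
proof -
  \<comment> \<open>The recursive fact has the same code \<open>?e\<close>, so the induction runs
    over the recursion argument.\<close>
  have sound: "v = ?h (y # ys)" if X: "justified X" and l: "length ys = n"
    and f: "(?e, list_encode (y # ys), v) \<in> X" for X y ys v
    using f
  proof (induction y arbitrary: v)
    case 0
    then show ?case using justifiedD[OF X 0] c X l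
      by (auto simp: justified_by_def represents_def)
  next
    case (Suc y)
    obtain w where w: "(?e, list_encode (y # ys), w) \<in> X" "(d, list_encode (y # w # ys), v) \<in> X"
      using justifiedD[OF X Suc.prems] by (auto simp: justified_by_def)
    then show ?case using Suc.IH[OF w(1)] d X l by (auto simp: represents_def)
  qed
  have complete: "derivable ?e (list_encode (y # ys)) (?h (y # ys))" if l: "length ys = n" for y ys
  proof (induction y)
    case 0
    have "derivable c (list_encode ys) (f ys)" using c l by (auto simp: represents_def)
    then obtain X where "finite X" "justified X" "(c, list_encode ys, f ys) \<in> X"
      unfolding derivable_def by blast
    then show ?case
      by (intro derivableI[of X]) (auto simp: justified_by_def)
  next
    case (Suc y)
    let ?w = "?h (y # ys)"
    have "derivable d (list_encode (y # ?w # ys)) (g (y # ?w # ys))"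
      using d l unfolding represents_def by (metis length_Cons)
    then obtain X where "finite X" "justified X" "(d, list_encode (y # ?w # ys), g (y # ?w # ys)) \<in> X"
      "(?e, list_encode (y # ys), ?w) \<in> X"
      using Suc.IH by (metis derivable2)
    then show ?case
      by (intro derivableI[of X]) (auto simp: justified_by_def)
  qed
  show ?thesis unfolding represents_def
  proof (intro conjI allI impI)
    fix X and xs :: "nat list" and v
    assume "justified X" "length xs = Suc n" "(?e, list_encode xs, v) \<in> X"
    then show "v = ?h xs" using sound[of X "tl xs" "hd xs" v] by (cases xs) auto
  next
    fix xs :: "nat list" assume "length xs = Suc n"
    then show "derivable ?e (list_encode xs) (?h xs)" using complete[of "tl xs" "hd xs"] by (cases xs) auto
  qed
qed

text \<open>A certificate contains nonzero values for all arguments below \<open>v\<close> and zero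
  at \<open>v\<close>, and this pins \<open>v\<close> down as the least zero.\<close>

lemma represents_mu:
  assumes d: "represents d (Suc n) g" and ex: "\<And>xs. length xs = n \<Longrightarrow> \<exists>y. g (y # xs) = 0"
  shows "represents (prod_encode (6, d)) n (\<lambda>xs. LEAST y. g (y # xs) = 0)"
  unfolding represents_def
proof (intro conjI allI impI)
  fix X and xs :: "nat list" and v
  assume X: "justified X" and l: "length xs = n"
    and f: "(prod_encode (6, d), list_encode xs, v) \<in> X"
  have D: "w = g (z # xs)" if "(d, cons_code z (list_encode xs), w) \<in> X" for z w
    using d X l that unfolding represents_def by (metis length_Cons list_encode.simps(2))
  have "(d, cons_code v (list_encode xs), 0) \<in> X" "\<forall>z<v. \<exists>w. (d, cons_code z (list_encode xs), Suc w) \<in> X"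
    using justifiedD[OF X f] by (auto simp: justified_by_def)
  then have "g (v # xs) = 0" "\<forall>z<v. g (z # xs) \<noteq> 0"
    using D by (metis, metis nat.distinct(1))
  then show "v = (LEAST y. g (y # xs) = 0)"
    by (metis (mono_tags, lifting) LeastI not_less_Least nat_neq_iff)
next
  fix xs :: "nat list" assume l: "length xs = n"
  let ?v = "LEAST y. g (y # xs) = 0"
  have v: "g (?v # xs) = 0" using ex[OF l] by (metis (mono_tags, lifting) LeastI)
  have "\<forall>z. \<exists>X. finite X \<and> justified X \<and> (d, list_encode (z # xs), g (z # xs)) \<in> X"
    using d l unfolding represents_def derivable_def by (metis length_Cons)
  then obtain X where X: "\<And>z. finite (X z)" "\<And>z. justified (X z)"
    "\<And>z. (d, list_encode (z # xs), g (z # xs)) \<in> X z" by metis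
  show "derivable (prod_encode (6, d)) (list_encode xs) ?v"
  proof (rule derivableI)
    \<comment> \<open>Each value up to the least zero has its own certificate; a finite union of
      justified sets is justified again.\<close>
    let ?Y = "\<Union>z\<in>{..?v}. X z"
    show "finite ?Y" using X(1) by auto
    show "justified ?Y" by (rule justified_UN[OF X(2)])
    have "\<exists>w. (d, cons_code z (list_encode xs), Suc w) \<in> ?Y" if "z < ?v" for z
    proof -
      have "g (z # xs) \<noteq> 0" using not_less_Least[OF that] by simp
      then obtain w where "g (z # xs) = Suc w" by (cases "g (z # xs)") auto
      then have "(d, cons_code z (list_encode xs), Suc w) \<in> X z" using X(3)[of z] by simp
      then show ?thesis using that by (meson UN_I atMost_iff less_imp_le)
    qed
    moreover have "(d, cons_code ?v (list_encode xs), 0) \<in> ?Y"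
      using X(3)[of ?v] v by (intro UN_I[of ?v]) auto
    ultimately show "justified_by ?Y (prod_encode (6, d)) (list_encode xs) ?v"
      unfolding justified_by_def by (intro disjI2) blast
  qed
qed

lemma total_rec_represented: "total_rec n f \<Longrightarrow> \<exists>c. represents c n f"
proof (induction rule: total_rec.induct)
  case (comp m f gs n)
  then obtain c d where "represents c m f"
    "represents (prod_encode (4, d)) n (\<lambda>xs. list_encode (map (\<lambda>g. g xs) gs))"
    using represents_list[of gs n] by blast
  then show ?case using represents_comp comp by blast
next
  case (mu n g)
  then show ?case using represents_mu by blast
next
  case (ext n f g)
  then show ?case unfolding represents_def by auto
qed (use represents_zero represents_succ represents_proj represents_prim in blast)+

definition facts_of :: "nat \<Rightarrow> (nat \<times> nat \<times> nat) set" where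
  "facts_of y = {(c, a, v). prod_encode (c, prod_encode (a, v)) \<in> set_decode y}"

lemma facts_of_set_encode:
  assumes "finite X"
  shows "facts_of (set_encode ((\<lambda>(c, a, v). prod_encode (c, prod_encode (a, v))) ` X)) = X"
  using assms by (auto simp: facts_of_def intro: rev_image_eqI)

text \<open>Membership of \<open>n\<close> in \<open>set_decode y\<close> forces
  \<open>2 ^ n \<le> y\<close>, hence \<open>n < y\<close>, and the components of a pair do not
  exceed its code. So \<open>y\<close> bounds every quantifier needed to check the
  certificate.\<close>

lemma facts_of_less:
  assumes "(c, a, v) \<in> facts_of y" shows "c < y" "a < y" "v < y"
proof -
  have "prod_encode (c, prod_encode (a, v)) \<in> set_decode y" using assms by (simp add: facts_of_def)
  then have "y div 2 ^ prod_encode (c, prod_encode (a, v)) \<noteq> 0"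
    unfolding set_decode_def by (metis even_zero mem_Collect_eq)
  then have "2 ^ prod_encode (c, prod_encode (a, v)) \<le> y" by (simp add: div_eq_0_iff)
  then have "prod_encode (c, prod_encode (a, v)) < y" using less_exp order_less_le_trans by blast
  then show "c < y" "a < y" "v < y"
    by (meson le_prod_encode_1 le_prod_encode_2 le_trans order_le_less_trans)+
qed

lemma prod_encode_less:
  assumes "prod_encode (a, b) < y" shows "a < y" "b < y"
  using assms by (meson le_prod_encode_1 le_prod_encode_2 order_le_less_trans)+

lemma cons_code_less:
  assumes "cons_code a b < y" shows "a < y" "b < y"
  using prod_encode_less[of a b y] assms by auto

abbreviation fact_in :: "nat \<Rightarrow> nat \<Rightarrow> nat \<Rightarrow> nat \<Rightarrow> bool" where
  "fact_in y c a v \<equiv> prod_encode (c, prod_encode (a, v)) \<in> set_decode y"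

text \<open>Restates \<open>justified_by\<close> for the set coded by \<open>y\<close> with every
  quantifier bounded, so that bounded search decides it.\<close>

definition justified_below :: "nat \<Rightarrow> nat \<Rightarrow> nat \<Rightarrow> nat \<Rightarrow> bool" where
  "justified_below y c a v \<longleftrightarrow>
     (c = prod_encode (0, 0) \<and> v = 0) \<or>
     (c = prod_encode (1, 0) \<and> (\<exists>x<y. \<exists>r<y. a = cons_code x r \<and> v = Suc x)) \<or>
     (c = prod_encode (2, 0) \<and> (\<exists>r<y. a = cons_code v r)) \<or>
     (\<exists>i<y. c = prod_encode (2, Suc i) \<and>
        (\<exists>x<y. \<exists>r<y. a = cons_code x r \<and> fact_in y (prod_encode (2, i)) r v)) \<or>
     (\<exists>f<y. \<exists>g<y. c = prod_encode (3, prod_encode (f, g)) \<and>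
        (\<exists>w<y. fact_in y (prod_encode (4, g)) a w \<and> fact_in y f w v)) \<or>
     (c = prod_encode (4, 0) \<and> v = 0) \<or>
     (\<exists>g<y. \<exists>h<y. c = prod_encode (4, cons_code g h) \<and>
        (\<exists>u<y. \<exists>w<y. v = cons_code u w \<and> fact_in y g a u \<and> fact_in y (prod_encode (4, h)) a w)) \<or>
     (\<exists>f<y. \<exists>g<y. c = prod_encode (5, prod_encode (f, g)) \<and>
        ((\<exists>r<y. a = cons_code 0 r \<and> fact_in y f r v) \<or>
         (\<exists>u<y. \<exists>r<y. \<exists>w<y. a = cons_code (Suc u) r \<and> fact_in y c (cons_code u r) w \<and>
            fact_in y g (cons_code u (cons_code w r)) v))) \<or>
     (\<exists>g<y. c = prod_encode (6, g) \<and> fact_in y g (cons_code v a) 0 \<and>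
        (\<forall>z<v. \<exists>w<y. fact_in y g (cons_code z a) (Suc w)))"

lemma justified_by_facts_of:
  assumes "(c, a, v) \<in> facts_of y"
  shows "justified_by (facts_of y) c a v \<longleftrightarrow> justified_below y c a v" (is "?L \<longleftrightarrow> ?R")
proof
  assume ?R
  then show ?L
    unfolding justified_by_def justified_below_def
    by (elim disjE exE conjE) (auto simp: facts_of_def)
next
  have bd: "c < y" "a < y" "v < y" using facts_of_less[OF assms] .
  have F: "(c', a', v') \<in> facts_of y \<Longrightarrow> c' < y \<and> a' < y \<and> v' < y \<and> fact_in y c' a' v'" for c' a' v'
    using facts_of_less[of c' a' v' y] by (simp add: facts_of_def)
  have S: "Suc x < y \<Longrightarrow> x < y" for x by simp
  assume ?L
  then show ?R
    unfolding justified_by_def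
  proof (elim disjE exE conjE, goal_cases)
    case (2 x r)
    then have "x < y" "r < y" using bd cons_code_less[of x r y] by simp_all
    with 2 show ?case by (simp add: justified_below_def)
  next
    case (3 r)
    then have "r < y" using bd cons_code_less[of v r y] by simp
    with 3 show ?case by (auto simp add: justified_below_def)
  next
    case (4 i x r)
    then have "x < y" "r < y" "i < y"
      using bd cons_code_less[of x r y] prod_encode_less[of 2 "Suc i" y] by simp_all
    with 4 F[OF 4(3)] show ?case by (simp add: justified_below_def)
  next
    case (5 f g w)
    then have "f < y" "g < y" "w < y"
      using bd prod_encode_less[of 3 "prod_encode (f, g)" y] prod_encode_less[of f g y] F[OF 5(2)] by simp_all
    with 5(1) F[OF 5(2)] F[OF 5(3)] show ?case by (simp add: justified_below_def) blast
  next
    case (7 g h u w)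
    then have "g < y" "h < y" "u < y" "w < y"
      using bd prod_encode_less[of 4 "cons_code g h" y] cons_code_less[of g h y]
        cons_code_less[of u w y] by simp_all
    with 7(1,2) F[OF 7(3)] F[OF 7(4)] show ?case by (simp add: justified_below_def)
  next
    case (8 f g r)
    then have "f < y" "g < y" "r < y"
      using bd prod_encode_less[of 5 "prod_encode (f, g)" y] prod_encode_less[of f g y]
        cons_code_less[of 0 r y] by simp_all
    with 8(1,2) F[OF 8(3)] show ?case by (simp add: justified_below_def)
  next
    case (9 f g u r w)
    then have "f < y" "g < y" "r < y" "u < y" "w < y"
      using bd prod_encode_less[of 5 "prod_encode (f, g)" y] prod_encode_less[of f g y]
        cons_code_less[of "Suc u" r y] F[OF 9(3)] by simp_all
    with 9(1,2) F[OF 9(3)] F[OF 9(4)] show ?case by (simp add: justified_below_def) blast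
  next
    case (10 g)
    have "\<exists>w<y. fact_in y g (cons_code z a) (Suc w)" if "z < v" for z
      using 10(3)[rule_format, OF that] F S by blast
    moreover have "g < y" using 10(1) bd prod_encode_less[of 6 g y] by simp
    ultimately show ?case using 10(1) F[OF 10(2)] by (simp add: justified_below_def)
  qed (simp_all add: justified_below_def)
qed

lemma decidable_justified:
  "decidable_pred 2 (\<lambda>xs. justified (facts_of (xs ! 1)) \<and> (xs ! 0, list_encode [xs ! 0], 0) \<in> facts_of (xs ! 1))"
proof -
  have "justified (facts_of y) \<longleftrightarrow>
      (\<forall>c<y. \<forall>a<y. \<forall>v<y. fact_in y c a v \<longrightarrow> justified_below y c a v)" for y
    using justified_by_facts_of[of _ _ _ y] facts_of_less[of _ _ _ y]
    unfolding justified_def by (auto simp: facts_of_def)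
  then show ?thesis
    unfolding justified_below_def facts_of_def mem_Collect_eq prod.case list_encode.simps
    by simp (intro total_rec_intros; simp)
qed

text \<open>Diagonalisation: \<open>V [n, y]\<close> vanishes when \<open>y\<close> certifies that
  program \<open>n\<close> returns 0 on input \<open>n\<close>. For a total \<open>f\<close> with
  code \<open>c\<close> such a certificate for \<open>c\<close> exists exactly if
  \<open>f [c] = 0\<close>, so \<open>f\<close> errs at \<open>c\<close>.\<close>

theorem undecidable_enumerable_set:
  obtains V where "total_rec 2 V"
    and "\<And>f. total_rec 1 f \<Longrightarrow> \<not> (\<forall>n. f [n] \<noteq> 0 \<longleftrightarrow> (\<exists>y. V [n, y] = 0))"
proof
  let ?P = "\<lambda>xs. justified (facts_of (xs ! 1)) \<and> (xs ! 0, list_encode [xs ! 0], 0) \<in> facts_of (xs ! 1)"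
  let ?V = "\<lambda>xs. of_bool (\<not> ?P xs) :: nat"
  show "total_rec 2 ?V"
    by (intro total_rec_of_bool decidable_pred_not decidable_justified)
  fix f assume f: "total_rec 1 f"
  then obtain c where c: "represents c 1 f" using total_rec_represented by blast
  show "\<not> (\<forall>n. f [n] \<noteq> 0 \<longleftrightarrow> (\<exists>y. ?V [n, y] = 0))"
  proof
    assume *: "\<forall>n. f [n] \<noteq> 0 \<longleftrightarrow> (\<exists>y. ?V [n, y] = 0)"
    have "f [c] = 0 \<longleftrightarrow> (\<exists>y. ?P [c, y])"
    proof
      assume "f [c] = 0"
      then have "derivable c (list_encode [c]) 0"
        using c unfolding represents_def by (metis One_nat_def length_Cons list.size(3))
      then obtain X where X: "finite X" "justified X" "(c, list_encode [c], 0) \<in> X"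
        unfolding derivable_def by blast
      then show "\<exists>y. ?P [c, y]"
        by (intro exI[of _ "set_encode ((\<lambda>(c, a, v). prod_encode (c, prod_encode (a, v))) ` X)"])
          (simp only: facts_of_set_encode[OF X(1)] nth_Cons_0 nth_Cons_Suc One_nat_def)
    next
      assume "\<exists>y. ?P [c, y]"
      then show "f [c] = 0" using c unfolding represents_def
        by (metis One_nat_def length_Cons list.size(3) nth_Cons_0)
    qed
    moreover have "f [c] \<noteq> 0 \<longleftrightarrow> (\<exists>y. ?P [c, y])" using * by simp
    ultimately show False by blast
  qed
qed

subsection \<open>While programs over counters\<close>

datatype com = Skip | Inc nat | Dec nat | Seq com com | While nat com

inductive big :: "com \<Rightarrow> (nat \<Rightarrow> nat) \<Rightarrow> (nat \<Rightarrow> nat) \<Rightarrow> bool" where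
  Skip: "big Skip s s"
| Inc: "big (Inc i) s (s(i := Suc (s i)))"
| Dec: "big (Dec i) s (s(i := s i - 1))"
| Seq: "big a s t \<Longrightarrow> big b t u \<Longrightarrow> big (Seq a b) s u"
| While_False: "s i = 0 \<Longrightarrow> big (While i c) s s"
| While_True: "s i \<noteq> 0 \<Longrightarrow> big c s t \<Longrightarrow> big (While i c) t u \<Longrightarrow> big (While i c) s u"

inductive_cases big_elims: "big Skip s t" "big (Inc i) s t" "big (Dec i) s t" "big (Seq a b) s t"
  "big (While i c) s t"

lemma big_deterministic: "big c s t \<Longrightarrow> big c s t' \<Longrightarrow> t' = t"
proof (induction arbitrary: t' rule: big.induct)
  case (Seq a s t b u)
  then show ?case by (metis big_elims(4))
next
  case (While_True s i c t u)
  then show ?case by (metis big_elims(5))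
qed (auto elim: big_elims)

lemma big_IncI: "t = s(i := Suc (s i)) \<Longrightarrow> big (Inc i) s t" by (simp add: big.Inc)

lemma big_DecI: "t = s(i := s i - 1) \<Longrightarrow> big (Dec i) s t"
  using big.Dec by simp

definition clear :: "nat \<Rightarrow> com" where "clear r = While r (Dec r)"

lemma big_clear: "big (clear r) s (s(r := 0))"
proof (induction "s r" arbitrary: s)
  case 0
  then have "s(r := 0) = s" by auto
  with 0 show ?case unfolding clear_def using big.While_False[of s r "Dec r"] by simp
next
  case (Suc x)
  then have "big (clear r) (s(r := s r - 1)) (s(r := 0))" using Suc(1)[of "s(r := s r - 1)"] by simp
  then show ?case using Suc(2) unfolding clear_def
    by (auto intro: big.While_True[OF _ big.Dec])
qed

text \<open>Reading a counter by a loop destroys it. The value is therefore moved into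
  \<open>b\<close> and \<open>t\<close> simultaneously and then moved back from
  \<open>t\<close>.\<close>

definition copy :: "nat \<Rightarrow> nat \<Rightarrow> nat \<Rightarrow> com" where
  "copy a b t = Seq (clear b) (Seq (While a (Seq (Dec a) (Seq (Inc b) (Inc t)))) (While t (Seq (Dec t) (Inc a))))"

lemma big_copy:
  assumes "a \<noteq> b" "a \<noteq> t" "b \<noteq> t" "s t = 0"
  shows "big (copy a b t) s (s(b := s a))"
proof -
  have 1: "big (While a (Seq (Dec a) (Seq (Inc b) (Inc t)))) s (s(a := 0, b := s b + s a, t := s t + s a))" for s
  proof (induction "s a" arbitrary: s)
    case 0
    then have "s(a := 0, b := s b + s a, t := s t + s a) = s" by auto
    with 0 show ?case using big.While_False[of s a] by metis
  next
    case (Suc x)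
    let ?s = "s(a := s a - 1, b := Suc (s b), t := Suc (s t))"
    have "big (Seq (Dec a) (Seq (Inc b) (Inc t))) s ?s"
      using assms by (intro big.Seq[OF big.Dec] big.Seq[OF big.Inc] big_IncI) auto
    moreover have "?s(a := 0, b := ?s b + ?s a, t := ?s t + ?s a) = s(a := 0, b := s b + s a, t := s t + s a)"
      using assms Suc(2) by auto
    moreover have "x = ?s a" using Suc(2) assms by auto
    note Suc(1)[of ?s, OF this]
    ultimately show ?case using big.While_True[of s a] Suc(2) by (metis nat.distinct(1))
  qed
  have 2: "big (While t (Seq (Dec t) (Inc a))) s (s(t := 0, a := s a + s t))" for s
  proof (induction "s t" arbitrary: s)
    case 0
    then have "s(t := 0, a := s a + s t) = s" by auto
    with 0 show ?case using big.While_False[of s t] by metis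
  next
    case (Suc x)
    let ?s = "s(t := s t - 1, a := Suc (s a))"
    have "big (Seq (Dec t) (Inc a)) s ?s"
      using assms by (intro big.Seq[OF big.Dec] big_IncI) auto
    moreover have "?s(t := 0, a := ?s a + ?s t) = s(t := 0, a := s a + s t)"
      using assms Suc(2) by auto
    moreover have "x = ?s t" using Suc(2) assms by auto
    note Suc(1)[of ?s, OF this]
    ultimately show ?case using big.While_True[of s t] Suc(2) by (metis nat.distinct(1))
  qed
  let ?s1 = "s(b := 0)"
  let ?s2 = "?s1(a := 0, b := ?s1 b + ?s1 a, t := ?s1 t + ?s1 a)"
  have "?s2(t := 0, a := ?s2 a + ?s2 t) = s(b := s a)" using assms by auto
  then show ?thesis unfolding copy_def
    using big.Seq[OF big_clear[of b s] big.Seq[OF 1[of ?s1] 2[of ?s2]]] by metis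
qed

text \<open>Registers from \<open>b\<close> on are scratch space: zero before and after.\<close>

definition computes :: "com \<Rightarrow> (nat list \<Rightarrow> nat) \<Rightarrow> nat list \<Rightarrow> nat \<Rightarrow> nat \<Rightarrow> bool" where
  "computes c f ins out b \<longleftrightarrow> (\<forall>s. (\<forall>r\<ge>b. s r = 0) \<longrightarrow> big c s (s(out := f (map s ins))))"

text \<open>The registers are quantified so that programs for inner functions can be placed
  anywhere, with the scratch bound \<open>b\<close> keeping them away from registers in use.\<close>

definition computable :: "nat \<Rightarrow> (nat list \<Rightarrow> nat) \<Rightarrow> bool" where
  "computable n f \<longleftrightarrow> (\<forall>ins out b. length ins = n \<longrightarrow> set ins \<subseteq> {..<b} \<longrightarrow> out < b \<longrightarrow> out \<notin> set ins \<longrightarrow>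
     (\<exists>c. computes c f ins out b))"

lemma computableD:
  assumes "computable n f" "length ins = n" "set ins \<subseteq> {..<b}" "out < b" "out \<notin> set ins"
  shows "\<exists>c. computes c f ins out b"
  using assms unfolding computable_def by blast

lemma computesD: "computes c f ins out b \<Longrightarrow> \<forall>r\<ge>b. s r = 0 \<Longrightarrow> t = s(out := f (map s ins)) \<Longrightarrow> big c s t"
  unfolding computes_def by blast

lemma computable_proj: assumes "i < n" shows "computable n (\<lambda>xs. xs ! i)"
  unfolding computable_def computes_def
proof (intro allI impI)
  fix ins :: "nat list" and out b assume *: "length ins = n" "set ins \<subseteq> {..<b}" "out < b" "out \<notin> set ins"
  then have "ins ! i \<in> set ins" using assms by auto
  then have "ins ! i < b" "ins ! i \<noteq> out" using * by auto
  then have "big (copy (ins ! i) out b) s (s(out := map s ins ! i))" if "\<forall>r\<ge>b. s r = 0" for s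
    using big_copy[of "ins ! i" out b s] * that assms by auto
  then show "\<exists>c. \<forall>s. (\<forall>r\<ge>b. s r = 0) \<longrightarrow> big c s (s(out := map s ins ! i))" by blast
qed

lemma computable_succ: "computable 1 (\<lambda>xs. Suc (hd xs))"
  unfolding computable_def computes_def
proof (intro allI impI)
  fix ins :: "nat list" and out b assume *: "length ins = 1" "set ins \<subseteq> {..<b}" "out < b" "out \<notin> set ins"
  then obtain i where i: "ins = [i]" by (cases ins) auto
  then have "big (Seq (copy i out b) (Inc out)) s (s(out := Suc (hd (map s ins))))" if "\<forall>r\<ge>b. s r = 0" for s
    using big.Seq[OF big_copy[of i out b s] big.Inc[of out]] * that i by auto
  then show "\<exists>c. \<forall>s. (\<forall>r\<ge>b. s r = 0) \<longrightarrow> big c s (s(out := Suc (hd (map s ins))))" by blast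
qed

lemma clear_range: "\<exists>c. \<forall>s. big c s (\<lambda>r. if b \<le> r \<and> r < b + m then 0 else s r)"
proof (induction m)
  case 0
  have "big Skip s (\<lambda>r. if b \<le> r \<and> r < b + 0 then 0 else s r)" for s
  proof -
    have "(\<lambda>r. if b \<le> r \<and> r < b + 0 then 0 else s r) = s" by auto
    then show ?thesis using big.Skip by simp
  qed
  then show ?case by blast
next
  case (Suc m)
  then obtain c where c: "\<And>s. big c s (\<lambda>r. if b \<le> r \<and> r < b + m then 0 else s r)" by blast
  have "big (Seq (clear (b + m)) c) s (\<lambda>r. if b \<le> r \<and> r < b + Suc m then 0 else s r)" for s
  proof -
    have "(\<lambda>r. if b \<le> r \<and> r < b + m then 0 else (s(b + m := 0)) r) = (\<lambda>r. if b \<le> r \<and> r < b + Suc m then 0 else s r)"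
      by (auto simp: fun_eq_iff)
    then show ?thesis using big.Seq[OF big_clear c, of "b + m" s] by metis
  qed
  then show ?case by blast
qed

lemma computable_list:
  assumes "\<And>g. g \<in> set gs \<Longrightarrow> computable n g" "length ins = n" "set ins \<subseteq> {..<b}"
  shows "\<exists>c. \<forall>s. (\<forall>r\<ge>b. s r = 0) \<longrightarrow>
     big c s (\<lambda>r. if b \<le> r \<and> r < b + length gs then (gs ! (r - b)) (map s ins) else s r)"
  using assms(1)
proof (induction gs rule: rev_induct)
  case Nil
  have "big Skip s (\<lambda>r. if b \<le> r \<and> r < b + length [] then ([] ! (r - b)) (map s ins) else s r)" for s
  proof -
    have "(\<lambda>r. if b \<le> r \<and> r < b + length [] then ([] ! (r - b)) (map s ins) else s r) = s" by auto
    then show ?thesis using big.Skip by simp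
  qed
  then show ?case by blast
next
  case (snoc g gs)
  then obtain c where c: "\<And>s. (\<forall>r\<ge>b. s r = 0) \<Longrightarrow>
     big c s (\<lambda>r. if b \<le> r \<and> r < b + length gs then (gs ! (r - b)) (map s ins) else s r)"
    by auto
  have "set ins \<subseteq> {..<b + length gs + 1}" "b + length gs \<notin> set ins" using assms(3) by auto
  then obtain d where "computes d g ins (b + length gs) (b + length gs + 1)"
    using computableD[of n g ins "b + length gs + 1" "b + length gs"] snoc.prems assms(2) by auto
  note d = computesD[OF this]
  have "big (Seq c d) s (\<lambda>r. if b \<le> r \<and> r < b + length (gs @ [g]) then ((gs @ [g]) ! (r - b)) (map s ins) else s r)"
    if z: "\<forall>r\<ge>b. s r = 0" for s
  proof -
    let ?t = "\<lambda>r. if b \<le> r \<and> r < b + length gs then (gs ! (r - b)) (map s ins) else s r"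
    have eq: "map ?t ins = map s ins" using assms(3) by auto
    have "big d ?t (\<lambda>r. if b \<le> r \<and> r < b + length (gs @ [g]) then ((gs @ [g]) ! (r - b)) (map s ins) else s r)"
    proof (rule d)
      show "\<forall>r\<ge>b + length gs + 1. ?t r = 0" using z by auto
      show "(\<lambda>r. if b \<le> r \<and> r < b + length (gs @ [g]) then ((gs @ [g]) ! (r - b)) (map s ins) else s r)
        = ?t(b + length gs := g (map ?t ins))" unfolding eq by (auto simp: fun_eq_iff nth_append)
    qed
    then show ?thesis by (rule big.Seq[OF c[OF z]])
  qed
  then show ?case by blast
qed

text \<open>The intermediate values occupy the registers from \<open>b\<close> to
  \<open>b + m - 1\<close>; each inner program works above those already filled, the outer one above
  all of them, and at the end they are cleared to restore the scratch area.\<close>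

lemma computable_comp:
  assumes f: "computable m f" and m: "length gs = m" and g: "\<And>g. g \<in> set gs \<Longrightarrow> computable n g"
  shows "computable n (\<lambda>xs. f (map (\<lambda>g. g xs) gs))"
  unfolding computable_def
proof (intro allI impI)
  fix ins :: "nat list" and out b assume *: "length ins = n" "set ins \<subseteq> {..<b}" "out < b" "out \<notin> set ins"
  obtain c where c: "\<And>s. (\<forall>r\<ge>b. s r = 0) \<Longrightarrow>
     big c s (\<lambda>r. if b \<le> r \<and> r < b + m then (gs ! (r - b)) (map s ins) else s r)"
    using computable_list[of gs n ins b] g * m by blast
  have "set [b..<b + m] \<subseteq> {..<b + m}" "out \<notin> set [b..<b + m]" using * by auto
  then obtain d where "computes d f [b..<b + m] out (b + m)"
    using computableD[OF f, of "[b..<b + m]" "b + m" out] *(3) by fastforce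
  note d = computesD[OF this]
  obtain e where e: "\<And>s. big e s (\<lambda>r. if b \<le> r \<and> r < b + m then 0 else s r)"
    using clear_range by blast
  have "big (Seq c (Seq d e)) s (s(out := f (map (\<lambda>g. g (map s ins)) gs)))" if z: "\<forall>r\<ge>b. s r = 0" for s
  proof -
    let ?t = "\<lambda>r. if b \<le> r \<and> r < b + m then (gs ! (r - b)) (map s ins) else s r"
    have eq: "map ?t [b..<b + m] = map (\<lambda>g. g (map s ins)) gs"
      using m by (auto intro!: nth_equalityI)
    have 1: "big d ?t (?t(out := f (map (\<lambda>g. g (map s ins)) gs)))"
      by (rule d) (use z eq in auto)
    have 2: "(\<lambda>r. if b \<le> r \<and> r < b + m then 0 else (?t(out := f (map (\<lambda>g. g (map s ins)) gs))) r)
       = s(out := f (map (\<lambda>g. g (map s ins)) gs))"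
      using z *(3) by (auto simp: fun_eq_iff)
    have "big (Seq d e) ?t (s(out := f (map (\<lambda>g. g (map s ins)) gs)))"
      using big.Seq[OF 1 e] unfolding 2 .
    then show ?thesis by (rule big.Seq[OF c[OF z]])
  qed
  then show "\<exists>c. computes c (\<lambda>xs. f (map (\<lambda>g. g xs) gs)) ins out b" unfolding computes_def by blast
qed

lemma computable_prim:
  assumes f: "computable n f" and g: "computable (Suc (Suc n)) g"
  shows "computable (Suc n) (\<lambda>ys. rec_nat (f (tl ys)) (\<lambda>y r. g (y # r # tl ys)) (hd ys))"
  unfolding computable_def
proof (intro allI impI)
  fix ins :: "nat list" and out b
  assume *: "length ins = Suc n" "set ins \<subseteq> {..<b}" "out < b" "out \<notin> set ins"
  obtain i js where ins: "ins = i # js" using * by (cases ins) auto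
  have js: "length js = n" "set js \<subseteq> {..<b}" "i < b" using * ins by auto
  have jsb: "j < b" if "j \<in> set js" for j using js that by auto
  \<comment> \<open>\<open>?y\<close> counts up and \<open>?n\<close> counts down, \<open>?r\<close>
    holds the current value and \<open>?r'\<close> receives the next one. Two registers are used
    because the output of a program may not be among its inputs.\<close>
  let ?y = b and ?r = "b + 1" and ?r' = "b + 2" and ?n = "b + 3" and ?t = "b + 4"
  have jst: "set js \<subseteq> {..<?t}" "?r \<notin> set js" "?r' \<notin> set js" using jsb by fastforce+
  obtain c where "computes c f js ?r ?t"
    using computableD[OF f, of js ?t ?r] js(1) jst by auto
  note c = computesD[OF this]
  obtain d where "computes d g (?y # ?r # js) ?r' ?t"
    using computableD[OF g, of "?y # ?r # js" ?t ?r'] js(1) jst by auto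
  note d = computesD[OF this]
  let ?body = "Seq (Dec ?n) (Seq d (Seq (copy ?r' ?r ?t) (Seq (clear ?r') (Inc ?y))))"
  let ?prog = "Seq (copy i ?n ?t) (Seq c (Seq (While ?n ?body) (Seq (copy ?r out ?t) (Seq (clear ?r) (clear ?y)))))"
  have "computes ?prog (\<lambda>ys. rec_nat (f (tl ys)) (\<lambda>y r. g (y # r # tl ys)) (hd ys)) ins out b"
    unfolding computes_def
  proof (intro allI impI)
    fix s :: "nat \<Rightarrow> nat" assume z: "\<forall>r\<ge>b. s r = 0"
    let ?xs = "map s js"
    define h where "h = (\<lambda>j. rec_nat (f ?xs) (\<lambda>y r. g (y # r # ?xs)) j)"
    \<comment> \<open>The state after \<open>j\<close> rounds with \<open>e\<close> rounds to
      go.\<close>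
    define \<sigma> where "\<sigma> = (\<lambda>j e. s(?y := j, ?r := h j, ?n := e))"
    have body: "big ?body (\<sigma> j (Suc e)) (\<sigma> (Suc j) e)" for j e
    proof -
      let ?s1 = "\<sigma> j e"
      have 1: "big (Dec ?n) (\<sigma> j (Suc e)) ?s1" by (rule big_DecI) (auto simp: \<sigma>_def)
      have eq: "map ?s1 (?y # ?r # js) = j # h j # ?xs" using jsb by (force simp: \<sigma>_def)
      have 2: "big d ?s1 (?s1(?r' := h (Suc j)))"
      proof (rule d)
        show "\<forall>r\<ge>?t. ?s1 r = 0" using z by (auto simp: \<sigma>_def)
        show "?s1(?r' := h (Suc j)) = ?s1(?r' := g (map ?s1 (?y # ?r # js)))"
          unfolding eq by (simp add: h_def)
      qed
      let ?s2 = "?s1(?r' := h (Suc j))"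
      have 3: "big (copy ?r' ?r ?t) ?s2 (?s2(?r := h (Suc j)))"
        using big_copy[of ?r' ?r ?t ?s2] z by (simp add: \<sigma>_def)
      let ?s3 = "?s2(?r := h (Suc j))"
      have 4: "big (clear ?r') ?s3 (?s3(?r' := 0))" by (rule big_clear)
      have 5: "big (Inc ?y) (?s3(?r' := 0)) (\<sigma> (Suc j) e)"
        by (rule big_IncI) (use z in \<open>auto simp: \<sigma>_def fun_eq_iff\<close>)
      show ?thesis by (rule big.Seq[OF 1 big.Seq[OF 2 big.Seq[OF 3 big.Seq[OF 4 5]]]])
    qed
    have loop: "big (While ?n ?body) (\<sigma> j e) (\<sigma> (j + e) 0)" for j e
    proof (induction e arbitrary: j)
      case 0
      then show ?case by (auto intro!: big.While_False simp: \<sigma>_def)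
    next
      case (Suc e)
      have "\<sigma> j (Suc e) ?n \<noteq> 0" by (simp add: \<sigma>_def)
      moreover have "big (While ?n ?body) (\<sigma> (Suc j) e) (\<sigma> (j + Suc e) 0)" using Suc[of "Suc j"] by simp
      ultimately show ?case using big.While_True[OF _ body] by blast
    qed
    have 1: "big (copy i ?n ?t) s (s(?n := s i))"
      by (rule big_copy) (use z js in auto)
    have eq: "map (s(?n := s i)) js = ?xs" using jsb by force
    have 2: "big c (s(?n := s i)) (\<sigma> 0 (s i))"
    proof (rule c)
      show "\<forall>r\<ge>?t. (s(?n := s i)) r = 0" using z by auto
      show "\<sigma> 0 (s i) = (s(?n := s i))(?r := f (map (s(?n := s i)) js))"
        unfolding eq using z by (auto simp: \<sigma>_def h_def fun_eq_iff)
    qed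
    have 3: "big (copy ?r out ?t) (\<sigma> (s i) 0) ((\<sigma> (s i) 0)(out := h (s i)))"
      using big_copy[of ?r out ?t "\<sigma> (s i) 0"] z *(3) by (simp add: \<sigma>_def)
    have eq': "((\<sigma> (s i) 0)(out := h (s i)))(?r := 0, ?y := 0) = s(out := h (s i))"
      using z *(3) by (auto simp: \<sigma>_def fun_eq_iff)
    have 4: "big (Seq (clear ?r) (clear ?y)) ((\<sigma> (s i) 0)(out := h (s i))) (s(out := h (s i)))"
      unfolding eq'[symmetric] by (rule big.Seq[OF big_clear big_clear])
    have "big (While ?n ?body) (\<sigma> 0 (s i)) (\<sigma> (s i) 0)" using loop[of 0 "s i"] by simp
    then have "big ?prog s (s(out := h (s i)))"
      using big.Seq[OF 1 big.Seq[OF 2 big.Seq[OF _ big.Seq[OF 3 4]]]] by blast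
    then show "big ?prog s (s(out := rec_nat (f (tl (map s ins))) (\<lambda>y r. g (y # r # tl (map s ins))) (hd (map s ins))))"
      by (simp add: ins h_def)
  qed
  then show "\<exists>c. computes c (\<lambda>ys. rec_nat (f (tl ys)) (\<lambda>y r. g (y # r # tl ys)) (hd ys)) ins out b" by blast
qed

lemma computable_mu:
  assumes g: "computable (Suc n) g" and ex: "\<And>xs. length xs = n \<Longrightarrow> \<exists>y. g (y # xs) = 0"
  shows "computable n (\<lambda>xs. LEAST y. g (y # xs) = 0)"
  unfolding computable_def
proof (intro allI impI)
  fix ins :: "nat list" and out b
  assume *: "length ins = n" "set ins \<subseteq> {..<b}" "out < b" "out \<notin> set ins"
  have insb: "j < b" if "j \<in> set ins" for j using * that by auto
  let ?y = b and ?v = "b + 1" and ?t = "b + 2"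
  have inst: "set ins \<subseteq> {..<?t}" "?v \<notin> set ins" using insb by fastforce+
  obtain d where "computes d g (?y # ins) ?v ?t"
    using computableD[OF g, of "?y # ins" ?t ?v] *(1) inst by auto
  note d = computesD[OF this]
  let ?body = "Seq (Inc ?y) d"
  let ?prog = "Seq d (Seq (While ?v ?body) (Seq (copy ?y out ?t) (clear ?y)))"
  have "computes ?prog (\<lambda>xs. LEAST y. g (y # xs) = 0) ins out b"
    unfolding computes_def
  proof (intro allI impI)
    fix s :: "nat \<Rightarrow> nat" assume z: "\<forall>r\<ge>b. s r = 0"
    let ?xs = "map s ins"
    define l where "l = (LEAST y. g (y # ?xs) = 0)"
    have l0: "g (l # ?xs) = 0" unfolding l_def using ex[of ?xs] *(1) by (metis (mono_tags, lifting) LeastI length_map)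
    have ln: "g (j # ?xs) \<noteq> 0" if "j < l" for j using that not_less_Least unfolding l_def by blast
    define \<sigma> where "\<sigma> = (\<lambda>j. s(?y := j, ?v := g (j # ?xs)))"
    have dd: "big d (s(?y := j, ?v := e)) (\<sigma> j)" for j e
    proof (rule d)
      show "\<forall>r\<ge>?t. (s(?y := j, ?v := e)) r = 0" using z by auto
      have eq: "map (s(?y := j, ?v := e)) (?y # ins) = j # ?xs" using insb by force
      show "\<sigma> j = (s(?y := j, ?v := e))(?v := g (map (s(?y := j, ?v := e)) (?y # ins)))"
        unfolding eq by (simp add: \<sigma>_def)
    qed
    have body: "big ?body (\<sigma> j) (\<sigma> (Suc j))" for j
      by (rule big.Seq[OF big.Inc]) (use dd[of "Suc j" "g (j # ?xs)"] in \<open>simp add: \<sigma>_def fun_upd_twist\<close>)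
    have loop: "big (While ?v ?body) (\<sigma> j) (\<sigma> l)" if "j + e = l" for j e
      using that
    proof (induction e arbitrary: j)
      case 0
      then show ?case using l0 by (auto intro!: big.While_False simp: \<sigma>_def)
    next
      case (Suc e)
      have "\<sigma> j ?v \<noteq> 0" using ln[of j] Suc.prems by (simp add: \<sigma>_def)
      moreover have "big (While ?v ?body) (\<sigma> (Suc j)) (\<sigma> l)" using Suc.IH[of "Suc j"] Suc.prems by simp
      ultimately show ?case using big.While_True[OF _ body] by blast
    qed
    have "s(?y := 0, ?v := 0) = s" using z by (auto simp: fun_eq_iff)
    then have 1: "big d s (\<sigma> 0)" using dd[of 0 0] by simp
    have 3: "big (copy ?y out ?t) (\<sigma> l) ((\<sigma> l)(out := l))"
      using big_copy[of ?y out ?t "\<sigma> l"] z *(3) by (simp add: \<sigma>_def)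
    have eq': "((\<sigma> l)(out := l))(?y := 0) = s(out := l)"
      using z *(3) l0 by (auto simp: \<sigma>_def fun_eq_iff)
    have 4: "big (clear ?y) ((\<sigma> l)(out := l)) (s(out := l))"
      unfolding eq'[symmetric] by (rule big_clear)
    have "big (While ?v ?body) (\<sigma> 0) (\<sigma> l)" by (rule loop) simp
    then have "big ?prog s (s(out := l))"
      using big.Seq[OF 1 big.Seq[OF _ big.Seq[OF 3 4]]] by blast
    then show "big ?prog s (s(out := LEAST y. g (y # map s ins) = 0))"
      by (simp add: l_def)
  qed
  then show "\<exists>c. computes c (\<lambda>xs. LEAST y. g (y # xs) = 0) ins out b" by blast
qed

lemma total_rec_computable: "total_rec n f \<Longrightarrow> computable n f"
proof (induction rule: total_rec.induct)
  case (zero n)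
  have "computes (clear out) (\<lambda>_. 0) ins out b" for ins out b
    unfolding computes_def by (simp add: big_clear)
  then show ?case unfolding computable_def by blast
next
  case succ
  show ?case by (rule computable_succ)
next
  case (proj i n)
  then show ?case by (rule computable_proj)
next
  case (comp m f gs n)
  then show ?case by (intro computable_comp) auto
next
  case (prim n f g)
  then show ?case by (intro computable_prim)
next
  case (mu n g)
  then show ?case by (intro computable_mu) auto
next
  case (ext n f g)
  have "computes c g ins out b" if "length ins = n" "computes c f ins out b" for c ins out b
    using that ext.hyps(2) by (simp add: computes_def)
  with ext.IH show ?case unfolding computable_def by blast
qed

text \<open>Unbounded search: register 0 keeps the input, register 1 the candidate \<open>y\<close>
  and register 2 the value \<open>V [v, y]\<close>, so the loop on register 2 ends precisely at a
  zero.\<close>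

lemma search_program:
  assumes "total_rec 2 V"
  obtains c where "\<And>v. (\<exists>t. big c (\<lambda>i. if i = 0 then v else 0) t) \<longleftrightarrow> (\<exists>y. V [v, y] = 0)"
proof -
  obtain d where "computes d V [0, 1] 2 3"
    using computableD[OF total_rec_computable[OF assms], of "[0, 1]" 3 2] by auto
  note d = computesD[OF this]
  let ?W = "While 2 (Seq (Inc 1) d)"
  have "(\<exists>t. big (Seq d ?W) (\<lambda>i. if i = 0 then v else 0) t) \<longleftrightarrow> (\<exists>y. V [v, y] = 0)" for v
  proof -
    define \<sigma> where "\<sigma> = (\<lambda>y. \<lambda>i::nat. if i = 0 then v else if i = 1 then y else if i = 2 then V [v, y] else 0)"
    have 1: "big d (\<lambda>i. if i = 0 then v else 0) (\<sigma> 0)"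
      by (rule d) (auto simp: \<sigma>_def fun_eq_iff)
    have body: "big (Seq (Inc 1) d) (\<sigma> y) (\<sigma> (Suc y))" for y
      by (rule big.Seq[OF big.Inc d]) (auto simp: \<sigma>_def fun_eq_iff)
    have step: "big ?W (\<sigma> y) t \<Longrightarrow> \<exists>y. V [v, y] = 0" for y t
    proof (induction ?W "\<sigma> y" t arbitrary: y rule: big.induct)
      case (While_False y)
      then show ?case by (auto simp: \<sigma>_def)
    next
      case (While_True y t u)
      then show ?case using big_deterministic[OF body] by blast
    qed
    have run: "\<exists>t. big ?W (\<sigma> y) t" if "V [v, y + e] = 0" for y e
      using that
    proof (induction e arbitrary: y)
      case 0
      then have "\<sigma> y 2 = 0" by (simp add: \<sigma>_def)
      then show ?case using big.While_False by blast
    next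
      case (Suc e)
      then obtain t where t: "big ?W (\<sigma> (Suc y)) t" by (metis add_Suc add_Suc_right)
      show ?case
      proof (cases "\<sigma> y 2 = 0")
        case True
        then show ?thesis using big.While_False by blast
      next
        case False
        then show ?thesis using big.While_True[OF _ body t] by blast
      qed
    qed
    show ?thesis
    proof
      assume "\<exists>t. big (Seq d ?W) (\<lambda>i. if i = 0 then v else 0) t"
      then show "\<exists>y. V [v, y] = 0" using step big_deterministic[OF 1] by (metis big_elims(4))
    next
      assume "\<exists>y. V [v, y] = 0"
      then show "\<exists>t. big (Seq d ?W) (\<lambda>i. if i = 0 then v else 0) t"
        using run[of 0] big.Seq[OF 1] by (metis add_0)
    qed
  qed
  then show thesis using that by blast
qed

subsection \<open>Counter machines\<close>

text \<open>A transition may depend on the two control states, on which counters vanish, and on the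
  differences of the counter values; all of these are visible locally in the graphs below.\<close>

locale machine =
  fixes k m s0 h :: nat and R :: "nat \<Rightarrow> nat \<Rightarrow> (nat \<Rightarrow> bool) \<Rightarrow> (nat \<Rightarrow> int) \<Rightarrow> bool"
  assumes k_pos: "0 < k" and s0_less: "s0 < m" and h_less: "h < m"
    and R_states: "R s s' z \<delta> \<Longrightarrow> s < m \<and> s' < m"
    and R_delta: "R s s' z \<delta> \<Longrightarrow> i < k \<Longrightarrow> \<delta> i \<in> {-1, 0, 1}"
    and R_cong: "R s s' z \<delta> \<Longrightarrow> (\<And>i. i < k \<Longrightarrow> z' i = z i) \<Longrightarrow> (\<And>i. i < k \<Longrightarrow> \<delta>' i = \<delta> i)
      \<Longrightarrow> R s s' z' \<delta>'"
begin

definition is_run :: "nat \<Rightarrow> (nat \<Rightarrow> nat) \<Rightarrow> (nat \<Rightarrow> nat \<Rightarrow> nat) \<Rightarrow> nat \<Rightarrow> bool" where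
  "is_run T st val v \<longleftrightarrow> st 0 = s0 \<and> st T = h \<and> (\<forall>i<k. val 0 i = (if i = 0 then v else 0)) \<and>
     (\<forall>t<T. R (st t) (st (Suc t)) (\<lambda>i. val t i = 0) (\<lambda>i. int (val (Suc t) i) - int (val t i)))"

definition accepts :: "nat \<Rightarrow> bool" where
  "accepts v \<longleftrightarrow> (\<exists>T st val. is_run T st val v)"

end

text \<open>The control state is the stack of commands still to be executed. Counter values
  influence it only through zero tests, as a machine transition requires.\<close>

fun next_cont :: "com list \<Rightarrow> (nat \<Rightarrow> bool) \<Rightarrow> com list" where
  "next_cont [] z = []"
| "next_cont (Skip # \<kappa>) z = \<kappa>"
| "next_cont (Inc r # \<kappa>) z = \<kappa>"
| "next_cont (Dec r # \<kappa>) z = \<kappa>"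
| "next_cont (Seq a b # \<kappa>) z = a # b # \<kappa>"
| "next_cont (While r c # \<kappa>) z = (if z r then \<kappa> else c # While r c # \<kappa>)"

fun counter_delta :: "com list \<Rightarrow> (nat \<Rightarrow> bool) \<Rightarrow> nat \<Rightarrow> int" where
  "counter_delta (Inc r # \<kappa>) z = (\<lambda>i. if i = r then 1 else 0)"
| "counter_delta (Dec r # \<kappa>) z = (\<lambda>i. if i = r \<and> \<not> z r then -1 else 0)"
| "counter_delta _ z = (\<lambda>i. 0)"

definition small_step :: "com list \<times> (nat \<Rightarrow> nat) \<Rightarrow> com list \<times> (nat \<Rightarrow> nat)" where
  "small_step = (\<lambda>(\<kappa>, s). (next_cont \<kappa> (\<lambda>i. s i = 0), \<lambda>i. nat (int (s i) + counter_delta \<kappa> (\<lambda>i. s i = 0) i)))"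

lemma counter_delta_ge: "0 \<le> int (s i) + counter_delta \<kappa> (\<lambda>i. s i = 0) i"
  by (cases "(\<kappa>, \<lambda>i. s i = 0)" rule: counter_delta.cases) auto

lemma counter_delta_range: "counter_delta \<kappa> z i \<in> {-1, 0, 1}"
  by (cases "(\<kappa>, z)" rule: counter_delta.cases) auto

lemma small_step_simps [simp]:
  "small_step (Skip # \<kappa>, s) = (\<kappa>, s)"
  "small_step (Inc r # \<kappa>, s) = (\<kappa>, s(r := Suc (s r)))"
  "small_step (Dec r # \<kappa>, s) = (\<kappa>, s(r := s r - 1))"
  "small_step (Seq a b # \<kappa>, s) = (a # b # \<kappa>, s)"
  "small_step (While r c # \<kappa>, s) = (if s r = 0 then (\<kappa>, s) else (c # While r c # \<kappa>, s))"
  by (auto simp: small_step_def fun_eq_iff)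

lemma big_small_steps: "big c s t \<Longrightarrow> \<exists>n. (small_step ^^ n) (c # \<kappa>, s) = (\<kappa>, t)"
proof (induction arbitrary: \<kappa> rule: big.induct)
  case (Seq a s t b u)
  obtain n n' where "(small_step ^^ n) (a # b # \<kappa>, s) = (b # \<kappa>, t)"
    "(small_step ^^ n') (b # \<kappa>, t) = (\<kappa>, u)" using Seq.IH by blast
  then have "(small_step ^^ (n' + n)) (small_step (Seq a b # \<kappa>, s)) = (\<kappa>, u)"
    by (simp only: small_step_simps funpow_add comp_apply)
  then show ?case by (metis comp_apply funpow_Suc_right)
next
  case (While_True s i c t u)
  obtain n n' where "(small_step ^^ n) (c # While i c # \<kappa>, s) = (While i c # \<kappa>, t)"
    "(small_step ^^ n') (While i c # \<kappa>, t) = (\<kappa>, u)" using While_True.IH by blast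
  then have "(small_step ^^ (n' + n)) (small_step (While i c # \<kappa>, s)) = (\<kappa>, u)"
    using While_True.hyps by (simp only: small_step_simps funpow_add comp_apply if_False)
  then show ?case by (metis comp_apply funpow_Suc_right)
next
  case (Skip s)
  show ?case by (rule exI[of _ 1]) simp
next
  case (Inc i s)
  show ?case by (rule exI[of _ 1]) (simp add: fun_eq_iff)
next
  case (Dec i s)
  show ?case by (rule exI[of _ 1]) (simp add: fun_eq_iff)
next
  case (While_False s i c)
  then show ?case by (intro exI[of _ 1]) simp
qed

text \<open>The clause \<open>n' < n\<close> drives the induction: after the body of a
  \<open>While\<close> the same \<open>While\<close> is on top again, and only the number of
  remaining steps has decreased.\<close>

lemma small_steps_big:
  "fst ((small_step ^^ n) (c # \<kappa>, s)) = [] \<Longrightarrow>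
     \<exists>t n'. big c s t \<and> n' < n \<and> fst ((small_step ^^ n') (\<kappa>, t)) = []"
proof (induction n arbitrary: c \<kappa> s rule: less_induct)
  case (less n)
  then obtain n0 where n: "n = Suc n0" by (cases n) auto
  have st: "fst ((small_step ^^ n0) (small_step (c # \<kappa>, s))) = []"
    using less.prems unfolding n funpow_Suc_right comp_apply .
  show ?case
  proof (cases c)
    case Skip
    then show ?thesis using st n big.Skip by auto
  next
    case (Inc r)
    then show ?thesis using st n big.Inc by auto
  next
    case (Dec r)
    then show ?thesis using st n big.Dec[of r s] by auto
  next
    case (Seq a b)
    then have "fst ((small_step ^^ n0) (a # b # \<kappa>, s)) = []" using st by simp
    then obtain t n1 where 1: "big a s t" "n1 < n0" "fst ((small_step ^^ n1) (b # \<kappa>, t)) = []"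
      using less.IH[of n0] n by blast
    then obtain u n2 where "big b t u" "n2 < n1" "fst ((small_step ^^ n2) (\<kappa>, u)) = []"
      using less.IH[of n1] n by fastforce
    with 1 Seq n show ?thesis using big.Seq[of a s t b u] by (intro exI[of _ u] exI[of _ n2]) auto
  next
    case (While r b)
    show ?thesis
    proof (cases "s r = 0")
      case True
      then show ?thesis using st n While big.While_False by auto
    next
      case False
      then have "fst ((small_step ^^ n0) (b # c # \<kappa>, s)) = []" using st While by simp
      then obtain t n1 where 1: "big b s t" "n1 < n0" "fst ((small_step ^^ n1) (c # \<kappa>, t)) = []"
        using less.IH[of n0] n by blast
      then obtain u n2 where "big c t u" "n2 < n1" "fst ((small_step ^^ n2) (\<kappa>, u)) = []"
        using less.IH[of n1] n by fastforce
      with 1 While n False show ?thesis using big.While_True[of s r b t u]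
        by (intro exI[of _ u] exI[of _ n2]) auto
    qed
  qed
qed

lemma halts_iff_big:
  "(\<exists>n. fst ((small_step ^^ n) ([c], s)) = []) \<longleftrightarrow> (\<exists>t. big c s t)"
  using small_steps_big[of _ c "[]" s] big_small_steps[of c s _ "[]"] by (metis fst_conv)

text \<open>Contains every stack that can occur before only \<open>\<kappa>\<close> is left. The
  body of a loop runs on top of the loop itself, which is already counted, so finitely many stacks
  suffice for unbounded executions.\<close>

fun conts :: "com \<Rightarrow> com list \<Rightarrow> com list set" where
  "conts (Seq a b) \<kappa> = insert (Seq a b # \<kappa>) (conts a (b # \<kappa>) \<union> conts b \<kappa>)"
| "conts (While r c) \<kappa> = insert (While r c # \<kappa>) (conts c (While r c # \<kappa>))"
| "conts c \<kappa> = {c # \<kappa>}"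

lemma finite_conts: "finite (conts c \<kappa>)"
  by (induction c \<kappa> rule: conts.induct) auto

lemma conts_start: "c # \<kappa> \<in> conts c \<kappa>"
  by (cases c) auto

lemma next_cont_conts: "\<kappa>' \<in> conts c \<kappa> \<Longrightarrow> next_cont \<kappa>' z \<in> insert \<kappa> (conts c \<kappa>)"
proof (induction c \<kappa> rule: conts.induct)
  case (1 a b \<kappa>)
  then show ?case using conts_start by force
next
  case (2 r c \<kappa>)
  then show ?case using conts_start[of c "While r c # \<kappa>"] by (cases "z r") auto
qed auto

fun com_regs :: "com \<Rightarrow> nat set" where
  "com_regs Skip = {}"
| "com_regs (Inc r) = {r}"
| "com_regs (Dec r) = {r}"
| "com_regs (Seq a b) = com_regs a \<union> com_regs b"
| "com_regs (While r c) = insert r (com_regs c)"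

lemma finite_com_regs: "finite (com_regs c)"
  by (induction c) auto

lemma conts_regs: "\<kappa>' \<in> conts c \<kappa> \<Longrightarrow> d \<in> set \<kappa>' \<Longrightarrow> com_regs d \<subseteq> com_regs c \<union> (\<Union>e\<in>set \<kappa>. com_regs e)"
  by (induction c \<kappa> rule: conts.induct) (auto; blast)+

lemma next_cont_cong:
  assumes "\<forall>d\<in>set \<kappa>. com_regs d \<subseteq> {..<k}" "\<And>i. i < k \<Longrightarrow> z i = z' i"
  shows "next_cont \<kappa> z = next_cont \<kappa> z'"
  using assms by (cases "(\<kappa>, z)" rule: next_cont.cases) auto

lemma counter_delta_cong:
  assumes "\<forall>d\<in>set \<kappa>. com_regs d \<subseteq> {..<k}" "\<And>i. i < k \<Longrightarrow> z i = z' i"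
  shows "counter_delta \<kappa> z = counter_delta \<kappa> z'"
  using assms by (cases "(\<kappa>, z)" rule: counter_delta.cases) auto

text \<open>The states number the stacks in \<open>K\<close>; \<open>[]\<close> is added as the
  halting state. Restricting to the \<open>k\<close> counters that occur in the program makes
  \<open>R\<close> depend on finitely many tests and differences.\<close>

lemma machine_of_program:
  obtains k m s0 h R where "machine k m s0 h R"
    "\<And>v. machine.accepts k s0 h R v \<longleftrightarrow> (\<exists>t. big c (\<lambda>i. if i = 0 then v else 0) t)"
proof -
  define K where "K = insert [] (conts c [])"
  have "finite K" by (simp add: K_def finite_conts)
  then obtain \<kappa> where \<kappa>: "bij_betw \<kappa> {0..<card K} K" using ex_bij_betw_nat_finite by blast
  define m where "m = card K"
  obtain k where k: "0 < k" "com_regs c \<subseteq> {..<k}"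
  proof
    show "0 < Suc (Max (insert 0 (com_regs c)))" by simp
    show "com_regs c \<subseteq> {..<Suc (Max (insert 0 (com_regs c)))}"
      using finite_com_regs by (auto simp: less_Suc_eq_le)
  qed
  have regs: "\<forall>d\<in>set \<kappa>'. com_regs d \<subseteq> {..<k}" if "\<kappa>' \<in> K" for \<kappa>'
    using that conts_regs[of \<kappa>' c "[]"] k by (auto simp: K_def)
  have \<kappa>K: "\<kappa> s \<in> K" if "s < m" for s using \<kappa> that by (auto simp: m_def bij_betw_def)
  have inj: "\<kappa> s = \<kappa> s' \<Longrightarrow> s < m \<Longrightarrow> s' < m \<Longrightarrow> s = s'" for s s'
    using \<kappa> by (auto simp: m_def bij_betw_def inj_on_def)
  have surj: "\<exists>s<m. \<kappa> s = \<kappa>'" if "\<kappa>' \<in> K" for \<kappa>'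
    using \<kappa> that by (force simp: m_def bij_betw_def)
  obtain s0 where s0: "s0 < m" "\<kappa> s0 = [c]" using surj[of "[c]"] conts_start[of c "[]"] by (auto simp: K_def)
  obtain h where h: "h < m" "\<kappa> h = []" using surj[of "[]"] by (auto simp: K_def)
  define R where "R = (\<lambda>s s' z (\<delta> :: nat \<Rightarrow> int). s < m \<and> s' < m \<and> \<kappa> s' = next_cont (\<kappa> s) z \<and>
     (\<forall>i<k. \<delta> i = counter_delta (\<kappa> s) z i))"
  interpret M: machine k m s0 h R
  proof
    fix s s' z \<delta> z' \<delta>' assume R: "R s s' z \<delta>" and z: "\<And>i. i < k \<Longrightarrow> z' i = z i"
      and d: "\<And>i. i < k \<Longrightarrow> \<delta>' i = (\<delta> i :: int)"
    have "s < m" using R by (simp add: R_def)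
    then have "next_cont (\<kappa> s) z' = next_cont (\<kappa> s) z" "counter_delta (\<kappa> s) z' = counter_delta (\<kappa> s) z"
      using next_cont_cong[OF regs[OF \<kappa>K]] counter_delta_cong[OF regs[OF \<kappa>K]] z by blast+
    then show "R s s' z' \<delta>'" using R d by (simp add: R_def)
  next
    fix s s' z \<delta> and i :: nat assume "R s s' z \<delta>" "i < k"
    then show "\<delta> i \<in> {-1, 0, 1}" using counter_delta_range[of "\<kappa> s" z i] by (simp add: R_def)
  qed (use k s0 h in \<open>auto simp: R_def\<close>)
  have "M.accepts v \<longleftrightarrow> (\<exists>n. fst ((small_step ^^ n) ([c], \<lambda>i. if i = 0 then v else 0)) = [])" for v
  proof -
    define run where "run = (\<lambda>n. (small_step ^^ n) ([c], \<lambda>i. if i = 0 then v else 0))"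
    have run0: "run 0 = ([c], \<lambda>i. if i = 0 then v else 0)" by (simp add: run_def)
    have runS: "run (Suc n) = small_step (run n)" for n by (simp add: run_def)
    have runK: "fst (run n) \<in> K" for n
    proof (induction n)
      case 0
      then show ?case using conts_start[of c "[]"] by (simp add: run0 K_def)
    next
      case (Suc n)
      then show ?case using next_cont_conts[of "fst (run n)" c "[]" "\<lambda>i. snd (run n) i = 0"]
        by (auto simp: runS small_step_def K_def split: prod.splits)
    qed
    show ?thesis
    proof
      assume "M.accepts v"
      then obtain T st val where r: "M.is_run T st val v" unfolding M.accepts_def by blast
      \<comment> \<open>\<open>R\<close> determines the next stack and the change of the first
        \<open>k\<close> counters, so every run follows the small steps.\<close>
      have "t \<le> T \<Longrightarrow> \<kappa> (st t) = fst (run t) \<and> (\<forall>i<k. val t i = snd (run t) i)" for t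
      proof (induction t)
        case 0
        then show ?case using r s0 by (simp add: M.is_run_def run0)
      next
        case (Suc t)
        obtain \<kappa>' s where run: "run t = (\<kappa>', s)" by fastforce
        have R: "R (st t) (st (Suc t)) (\<lambda>i. val t i = 0) (\<lambda>i. int (val (Suc t) i) - int (val t i))"
          using r Suc.prems by (simp add: M.is_run_def)
        have IH: "\<kappa> (st t) = \<kappa>'" "\<And>i. i < k \<Longrightarrow> val t i = s i" using Suc run by auto
        have "\<kappa>' \<in> K" using runK[of t] run by simp
        then have eqs: "next_cont \<kappa>' (\<lambda>i. val t i = 0) = next_cont \<kappa>' (\<lambda>i. s i = 0)"
          "counter_delta \<kappa>' (\<lambda>i. val t i = 0) = counter_delta \<kappa>' (\<lambda>i. s i = 0)"
          using next_cont_cong[OF regs, of \<kappa>' "\<lambda>i. val t i = 0" "\<lambda>i. s i = 0"]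
            counter_delta_cong[OF regs, of \<kappa>' "\<lambda>i. val t i = 0" "\<lambda>i. s i = 0"] IH(2) by simp_all
        have "int (val (Suc t) i) = int (s i) + counter_delta \<kappa>' (\<lambda>i. s i = 0) i" if "i < k" for i
          using R that IH eqs by (simp add: R_def) (smt (verit, best))
        then have "val (Suc t) i = nat (int (s i) + counter_delta \<kappa>' (\<lambda>i. s i = 0) i)" if "i < k" for i
          using that by (metis nat_int)
        then show ?case using R by (simp add: R_def runS run small_step_def IH(1) eqs)
      qed
      from this[of T] show "\<exists>n. fst ((small_step ^^ n) ([c], \<lambda>i. if i = 0 then v else 0)) = []"
        using r h by (auto simp: M.is_run_def run_def intro!: exI[of _ T])
    next
      assume "\<exists>n. fst ((small_step ^^ n) ([c], \<lambda>i. if i = 0 then v else 0)) = []"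
      then obtain T where T: "fst (run T) = []" by (auto simp: run_def)
      obtain st where st: "\<And>t. st t < m" "\<And>t. \<kappa> (st t) = fst (run t)" using surj[OF runK] by metis
      have "M.is_run T st (\<lambda>t. snd (run t)) v"
        unfolding M.is_run_def
      proof (intro conjI allI impI)
        show "st 0 = s0" using inj[of "st 0" s0] st s0 by (simp add: run0)
        show "st T = h" using inj[of "st T" h] st h T by simp
        show "snd (run 0) i = (if i = 0 then v else 0)" for i by (simp add: run0)
        fix t
        show "R (st t) (st (Suc t)) (\<lambda>i. snd (run t) i = 0) (\<lambda>i. int (snd (run (Suc t)) i) - int (snd (run t) i))"
          using st counter_delta_ge[of "snd (run t)" _ "fst (run t)"]
          by (auto simp: R_def runS small_step_def split: prod.splits)
      qed
      then show "M.accepts v" unfolding M.accepts_def by blast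
    qed
  qed
  then show thesis using that[OF M.machine_axioms] halts_iff_big by blast
qed

subsection \<open>Graphs carrying computations\<close>

datatype vert = Rt nat | Pt nat nat

context machine
begin

text \<open>The roots \<open>0, \<dots>, nD - 1\<close> form a clique whose vertices serve as labels; the remaining roots are
  independent, the \<open>j\<close>-th one being joined to the clique vertices \<open>0, \<dots>, j + 3\<close>.  Path \<open>0\<close> is the
  time line, path \<open>Suc i\<close> the line of values of counter \<open>i\<close>; path \<open>i\<close> runs from root \<open>pa i\<close> to \<open>pb i\<close>.\<close>

definition nD :: nat where "nD = 3 * k + m + 10"
text \<open>Gives \<open>nD - 5\<close> independent roots. The last one misses two clique roots, so
  none of them extends to a clique of size \<open>nD\<close>; the first one has four clique
  neighbours, one more than a path vertex of a good graph can have.\<close>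

definition nR :: nat where "nR = 2 * nD - 5"
definition lab :: "nat \<Rightarrow> nat \<Rightarrow> nat" where "lab i r = 4 + 3 * i + r"
definition stl :: "nat \<Rightarrow> nat" where "stl s = 3 * k + 7 + s"
definition junk :: nat where "junk = 3 * k + 7 + m"
definition pa :: "nat \<Rightarrow> nat" where "pa i = nD + 2 * i"
definition pb :: "nat \<Rightarrow> nat" where "pb i = nD + 2 * i + 1"

definition radj :: "nat \<Rightarrow> nat \<Rightarrow> bool" where
  "radj x y \<longleftrightarrow> x \<noteq> y \<and> (x < nD \<and> y < nD \<or> x < nD \<and> nD \<le> y \<and> x + nD \<le> y + 3 \<or>
     y < nD \<and> nD \<le> x \<and> y + nD \<le> x + 3)"

definition spk :: "nat \<Rightarrow> nat \<Rightarrow> bool" where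
  "spk x i \<longleftrightarrow> (\<exists>r<3. x = lab i r) \<or> i = 0 \<and> ((\<exists>s<m. x = stl s) \<or> x = junk)"

text \<open>Roots 0 to 3 are joined to all independent roots and the last two clique roots to none,
  so within either group they are interchangeable. All other roots are determined by adjacency, and
  only those serve as labels and path ends.\<close>

definition rigid_root :: "nat \<Rightarrow> bool" where
  "rigid_root x \<longleftrightarrow> 4 \<le> x \<and> x + 3 \<le> nD \<or> nD \<le> x \<and> x < nR"

definition VS :: "(nat \<Rightarrow> nat) \<Rightarrow> vert set" where
  "VS len = Rt ` {..<nR} \<union> {Pt i j | i j. i \<le> k \<and> j < len i}"

lemma Rt_VS [simp]: "Rt x \<in> VS len \<longleftrightarrow> x < nR"
  and Pt_VS [simp]: "Pt i j \<in> VS len \<longleftrightarrow> i \<le> k \<and> j < len i"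
  by (auto simp: VS_def)

lemma finite_VS: "finite (VS len)"
proof -
  have "{Pt i j | i j. i \<le> k \<and> j < len i} = (\<lambda>(i, j). Pt i j) ` (SIGMA i:{..k}. {..<len i})"
    by auto
  then show ?thesis by (simp add: VS_def)
qed

lemma radj_sym: "radj x y \<longleftrightarrow> radj y x"
  by (auto simp: radj_def)

lemma spk_range: "spk x i \<Longrightarrow> i \<le> k \<Longrightarrow> 4 \<le> x \<and> x + 3 \<le> nD"
  by (auto simp: spk_def lab_def stl_def junk_def nD_def)

lemma spk_inj: "spk x i \<Longrightarrow> spk x i' \<Longrightarrow> i \<le> k \<Longrightarrow> i' \<le> k \<Longrightarrow> i = i'"
  by (auto simp: spk_def lab_def stl_def junk_def)

lemma nD_nR: "nD < nR" "nR = nD + (nD - 5)" "13 \<le> nD" "nD \<le> nR"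
  using k_pos s0_less by (auto simp: nD_def nR_def)

lemma spk_less: "spk x i \<Longrightarrow> i \<le> k \<Longrightarrow> x < nD"
  using spk_range[of x i] by auto

lemma pa_less: "i \<le> k \<Longrightarrow> pa i < nR" and pb_less: "i \<le> k \<Longrightarrow> pb i < nR"
  by (auto simp: pa_def pb_def nR_def nD_def)

lemma pa_ge: "nD \<le> pa i" and pb_ge: "nD \<le> pb i"
  by (auto simp: pa_def pb_def)

lemma rigid_root_pa: "i \<le> k \<Longrightarrow> rigid_root (pa i)" and rigid_root_pb: "i \<le> k \<Longrightarrow> rigid_root (pb i)"
  using pa_less pb_less pa_ge pb_ge by (auto simp: rigid_root_def)

lemma rigid_root_spk: "spk x i \<Longrightarrow> i \<le> k \<Longrightarrow> rigid_root x"
  using spk_range by (auto simp: rigid_root_def)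

lemma spk_lab: "r < 3 \<Longrightarrow> spk (lab i r) i" and spk_stl: "s < m \<Longrightarrow> spk (stl s) 0" and spk_junk: "spk junk 0"
  by (auto simp: spk_def)

lemma rigid_root_less: "rigid_root x \<Longrightarrow> x < nR"
  using nD_nR by (auto simp: rigid_root_def)

lemma lab_inj: "lab i r = lab i' r' \<Longrightarrow> r < 3 \<Longrightarrow> r' < 3 \<Longrightarrow> i = i' \<and> r = r'"
  unfolding lab_def by presburger

end

text \<open>What the shape of the pathographs below guarantees in each of their realizations: the
  lines, their ends and the range of possible label edges. Which labels a vertex carries and which
  values belong to a time is left open here and forced later by freeness.\<close>

locale layout = machine +
  fixes len :: "nat \<Rightarrow> nat" and A :: "vert \<Rightarrow> vert \<Rightarrow> bool"
  assumes A_sym: "A u w \<Longrightarrow> A w u" and A_irrefl: "\<not> A u u"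
    and A_root: "x < nR \<Longrightarrow> y < nR \<Longrightarrow> A (Rt x) (Rt y) \<longleftrightarrow> radj x y"
    and A_path: "i \<le> k \<Longrightarrow> j < len i \<Longrightarrow> j' < len i \<Longrightarrow> A (Pt i j) (Pt i j') \<longleftrightarrow> j' = Suc j \<or> j = Suc j'"
    and A_values: "0 < i \<Longrightarrow> 0 < i' \<Longrightarrow> i \<noteq> i' \<Longrightarrow> i \<le> k \<Longrightarrow> i' \<le> k \<Longrightarrow> j < len i \<Longrightarrow> j' < len i'
      \<Longrightarrow> \<not> A (Pt i j) (Pt i' j')"
    and A_start: "i \<le> k \<Longrightarrow> A (Rt (pa i)) (Pt i 0)"
    and A_end: "i \<le> k \<Longrightarrow> A (Rt (pb i)) (Pt i (len i - 1))"
    and A_label: "x < nR \<Longrightarrow> i \<le> k \<Longrightarrow> j < len i \<Longrightarrow> A (Rt x) (Pt i j)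
      \<Longrightarrow> x = pa i \<and> j = 0 \<or> x = pb i \<and> Suc j = len i \<or> spk x i"
    and len_pos: "i \<le> k \<Longrightarrow> 0 < len i"
    and A_spoke: "i \<le> k \<Longrightarrow> r < 3 \<Longrightarrow> \<exists>j<len i. A (Rt (lab i r)) (Pt i j)"

text \<open>The intended pictures. The time line continues past the halting time \<open>T\<close>,
  the later times being marked by \<open>junk\<close>; \<open>T_len\<close> makes the last time one
  of these. \<open>val_less\<close> keeps the last vertex of a value line from being a value, which
  leaves room behind the explicit values.\<close>

locale good = layout +
  fixes T :: nat and st :: "nat \<Rightarrow> nat" and val :: "nat \<Rightarrow> nat \<Rightarrow> nat" and v :: nat
  assumes run: "is_run T st val v"
    and T_len: "Suc T < len 0"
    and st_less: "t < len 0 \<Longrightarrow> st t < m"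
    and G_lab: "i \<le> k \<Longrightarrow> j < len i \<Longrightarrow> r < 3 \<Longrightarrow> A (Rt (lab i r)) (Pt i j) \<longleftrightarrow> r = j mod 3"
    and G_st: "t < len 0 \<Longrightarrow> s < m \<Longrightarrow> A (Rt (stl s)) (Pt 0 t) \<longleftrightarrow> st t = s"
    and G_junk: "t < len 0 \<Longrightarrow> A (Rt junk) (Pt 0 t) \<longleftrightarrow> T < t"
    and G_val: "t < len 0 \<Longrightarrow> i < k \<Longrightarrow> j < len (Suc i) \<Longrightarrow> A (Pt 0 t) (Pt (Suc i) j) \<longleftrightarrow> val t i = j"
    and val_less: "t < len 0 \<Longrightarrow> i < k \<Longrightarrow> Suc (val t i) < len (Suc i)"
begin

section \<open>Rigidity of the root graph\<close>

lemma label_degree: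
  assumes "i \<le> k" "j < len i"
  shows "{x. x < nD \<and> A (Rt x) (Pt i j)} \<subseteq> {lab i (j mod 3), stl (st j), junk}"
proof
  fix x assume "x \<in> {x. x < nD \<and> A (Rt x) (Pt i j)}"
  then have x: "x < nD" "A (Rt x) (Pt i j)" by auto
  then have "spk x i" using A_label[of x i j] assms nD_nR pa_ge[of i] pb_ge[of i] by auto
  then show "x \<in> {lab i (j mod 3), stl (st j), junk}"
    unfolding spk_def using x G_lab[OF assms] G_st[of j] assms by auto
qed

text \<open>A clique has at most one independent root, at most two vertices on a line, and meets at
  most one value line; next to a path vertex it has at most three clique roots. So with a path
  vertex its size is at most 8, and with an independent root at most \<open>nD - 1\<close>.\<close>

lemma clique_unique:
  assumes C: "C \<subseteq> VS len" "card C = nD" and clique: "\<And>u w. u \<in> C \<Longrightarrow> w \<in> C \<Longrightarrow> u \<noteq> w \<Longrightarrow> A u w"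
  shows "C = Rt ` {..<nD}"
proof -
  have E1: "card {x. nD \<le> x \<and> Rt x \<in> C} \<le> 1"
  proof (rule card_le_Suc0_iff_eq[THEN iffD2, unfolded One_nat_def[symmetric]])
    show "finite {x. nD \<le> x \<and> Rt x \<in> C}"
      by (rule finite_subset[of _ "{..<nR}"]) (use C in auto)
    show "\<forall>x\<in>{x. nD \<le> x \<and> Rt x \<in> C}. \<forall>y\<in>{x. nD \<le> x \<and> Rt x \<in> C}. x = y"
    proof (intro ballI, rule ccontr)
      fix x y assume xy: "x \<in> {x. nD \<le> x \<and> Rt x \<in> C}" "y \<in> {x. nD \<le> x \<and> Rt x \<in> C}" "x \<noteq> y"
      then have "A (Rt x) (Rt y)" "x < nR" "y < nR" using clique C(1) by auto
      then show False using xy A_root[of x y] by (auto simp: radj_def)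
    qed
  qed
  have P2: "card {j. Pt i j \<in> C} \<le> 2" for i
  proof (cases "{j. Pt i j \<in> C} = {}")
    case False
    define n where "n = (LEAST j. Pt i j \<in> C)"
    obtain j0 where "Pt i j0 \<in> C" using False by auto
    then have n: "Pt i n \<in> C" unfolding n_def by (rule LeastI)
    have "{j. Pt i j \<in> C} \<subseteq> {n, Suc n}"
    proof
      fix j assume j: "j \<in> {j. Pt i j \<in> C}"
      then have le: "n \<le> j" unfolding n_def by (auto intro: Least_le)
      show "j \<in> {n, Suc n}"
      proof (cases "j = n")
        case False
        then have "A (Pt i n) (Pt i j)" using clique n j by auto
        moreover have "i \<le> k" "n < len i" "j < len i" using C(1) n j by auto
        ultimately show ?thesis using le A_path[of i n j] by auto
      qed simp
    qed
    then have "card {j. Pt i j \<in> C} \<le> card {n, Suc n}" by (intro card_mono) auto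
    then show ?thesis by simp
  qed simp
  have noPt: "Pt i j \<notin> C" for i j
  proof
    assume ij: "Pt i j \<in> C"
    then have ijk: "i \<le> k" "j < len i" using C(1) by auto
    let ?D = "{x. x < nD \<and> Rt x \<in> C}" and ?E = "{x. nD \<le> x \<and> Rt x \<in> C}"
    have "?D \<subseteq> {x. x < nD \<and> A (Rt x) (Pt i j)}" using clique ij by auto
    then have "?D \<subseteq> {lab i (j mod 3), stl (st j), junk}" using label_degree[OF ijk] by blast
    then have "card ?D \<le> card {lab i (j mod 3), stl (st j), junk}" by (intro card_mono) auto
    also have "\<dots> \<le> 3" by (simp add: card_insert_if)
    finally have D: "card ?D \<le> 3" .
    \<comment> \<open>The only value line that can meet \<open>C\<close>; 1 is a dummy in case there
      is none.\<close>
    define i1 where "i1 = (if \<exists>i j. 0 < i \<and> Pt i j \<in> C then (SOME i. 0 < i \<and> (\<exists>j. Pt i j \<in> C)) else 1)"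
    have i1: "i' = i1" if "0 < i'" "Pt i' j' \<in> C" for i' j'
    proof -
      have "0 < i1 \<and> (\<exists>j. Pt i1 j \<in> C)"
        unfolding i1_def using that by (smt (verit, ccfv_SIG) someI_ex)
      then obtain j1 where j1: "0 < i1" "Pt i1 j1 \<in> C" by blast
      show ?thesis
      proof (rule ccontr)
        assume ne: "i' \<noteq> i1"
        then have "A (Pt i' j') (Pt i1 j1)" using clique that j1 by auto
        moreover have "i' \<le> k" "i1 \<le> k" "j' < len i'" "j1 < len i1" using C(1) that j1 by auto
        ultimately show False using A_values[of i' i1 j' j1] that j1 ne by auto
      qed
    qed
    have sub: "C \<subseteq> Rt ` ?D \<union> Rt ` ?E \<union> Pt 0 ` {j. Pt 0 j \<in> C} \<union> Pt i1 ` {j. Pt i1 j \<in> C}"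
    proof
      fix u assume u: "u \<in> C"
      show "u \<in> Rt ` ?D \<union> Rt ` ?E \<union> Pt 0 ` {j. Pt 0 j \<in> C} \<union> Pt i1 ` {j. Pt i1 j \<in> C}"
      proof (cases u)
        case (Rt x)
        then show ?thesis using u by (cases "x < nD") auto
      next
        case (Pt i' j')
        then show ?thesis using u i1[of i' j'] by (cases "i' = 0") auto
      qed
    qed
    have finP: "finite {j. Pt i' j \<in> C}" for i'
      by (rule finite_subset[of _ "{..<len i'}"]) (use C(1) in auto)
    have finD: "finite ?D" by simp
    have finE: "finite ?E" by (rule finite_subset[of _ "{..<nR}"]) (use C(1) in auto)
    have "card C \<le> card (Rt ` ?D \<union> Rt ` ?E \<union> Pt 0 ` {j. Pt 0 j \<in> C} \<union> Pt i1 ` {j. Pt i1 j \<in> C})"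
      using sub finP finD finE by (intro card_mono) auto
    also have "\<dots> \<le> card (Rt ` ?D) + card (Rt ` ?E) + card (Pt 0 ` {j. Pt 0 j \<in> C}) + card (Pt i1 ` {j. Pt i1 j \<in> C})"
      by (intro order_trans[OF card_Un_le] add_mono order_refl)
    also have "\<dots> \<le> 3 + 1 + 2 + 2"
      by (intro add_mono order_trans[OF card_image_le] D E1 P2 finP finD finE)
    finally show False using C(2) nD_nR by simp
  qed
  have noE: "Rt y \<notin> C" if "nD \<le> y" for y
  proof
    assume y: "Rt y \<in> C"
    then have yR: "y < nR" using C(1) by auto
    have "C \<subseteq> insert (Rt y) (Rt ` {..nD - 3})"
    proof
      fix u assume u: "u \<in> C"
      then obtain x where x: "u = Rt x" using noPt by (cases u) auto
      show "u \<in> insert (Rt y) (Rt ` {..nD - 3})"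
      proof (cases "x = y")
        case False
        then have "A (Rt x) (Rt y)" using clique u y x by auto
        moreover have "x < nR" using C(1) u x by auto
        ultimately have "radj x y" using A_root yR by simp
        then show ?thesis using that yR nD_nR x by (auto simp: radj_def)
      qed (simp add: x)
    qed
    then have "card C \<le> card (insert (Rt y) (Rt ` {..nD - 3}))" by (intro card_mono) auto
    also have "\<dots> \<le> Suc (card (Rt ` {..nD - 3}))" by (rule card_insert_le_m1[of "Suc _", simplified]) simp
    also have "\<dots> \<le> Suc (Suc (nD - 3))" using card_image_le[of "{..nD - 3}" Rt] by simp
    finally show False using C(2) nD_nR by simp
  qed
  have "C \<subseteq> Rt ` {..<nD}"
  proof
    fix u assume u: "u \<in> C"
    then obtain x where x: "u = Rt x" using noPt by (cases u) auto
    then have "x < nD" using noE[of x] u by (meson not_less)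
    then show "u \<in> Rt ` {..<nD}" using x by simp
  qed
  then show ?thesis using C(2) by (intro card_subset_eq) (auto simp: card_image inj_on_def)
qed

text \<open>The clique is recognised by its size. An independent root is recognised by its number of
  clique neighbours, which is at least four and hence not that of a path vertex, and a clique root
  by the independent roots joined to it.\<close>

lemma rigidity:
  assumes inj: "inj_on \<psi> {..<nR}" and VS: "\<And>x. x < nR \<Longrightarrow> \<psi> x \<in> VS len"
    and adj: "\<And>x y. x < nR \<Longrightarrow> y < nR \<Longrightarrow> A (\<psi> x) (\<psi> y) \<longleftrightarrow> radj x y"
  shows "\<psi> ` {..<nR} = Rt ` {..<nR}" "\<And>x. rigid_root x \<Longrightarrow> \<psi> x = Rt x"
proof -
  have D: "\<psi> ` {..<nD} = Rt ` {..<nD}"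
  proof (rule clique_unique)
    show "\<psi> ` {..<nD} \<subseteq> VS len" using VS nD_nR by auto
    show "card (\<psi> ` {..<nD}) = nD"
      using card_image[OF inj_on_subset[OF inj, of "{..<nD}"]] nD_nR by auto
    fix u w assume "u \<in> \<psi> ` {..<nD}" "w \<in> \<psi> ` {..<nD}" "u \<noteq> w"
    then show "A u w" using adj nD_nR by (auto simp: radj_def)
  qed
  have E: "\<psi> y = Rt y" if y: "nD \<le> y" "y < nR" for y
  proof -
    have notD: "\<psi> y \<notin> Rt ` {..<nD}"
    proof
      assume "\<psi> y \<in> Rt ` {..<nD}"
      then obtain x where "x < nD" "\<psi> y = \<psi> x" unfolding D[symmetric] by auto
      then show False using inj_onD[OF inj, of y x] y nD_nR(1) by simp
    qed
    have 1: "{x. x < nD \<and> radj x y} = {..<y - nD + 4}"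
      using y nD_nR by (auto simp: radj_def)
    let ?S = "{x. x < nD \<and> A (Rt x) (\<psi> y)}"
    have "Rt ` ?S = \<psi> ` {x. x < nD \<and> radj x y}"
    proof (intro set_eqI iffI)
      fix u assume "u \<in> Rt ` ?S"
      then obtain x where x: "x < nD" "A (Rt x) (\<psi> y)" "u = Rt x" by auto
      then have "Rt x \<in> \<psi> ` {..<nD}" unfolding D by simp
      then obtain x' where x': "x' < nD" "Rt x = \<psi> x'" by auto
      then show "u \<in> \<psi> ` {x. x < nD \<and> radj x y}" using x adj[of x' y] y nD_nR by auto
    next
      fix u assume "u \<in> \<psi> ` {x. x < nD \<and> radj x y}"
      then obtain x where x: "x < nD" "radj x y" "u = \<psi> x" by auto
      then have "\<psi> x \<in> Rt ` {..<nD}" unfolding D[symmetric] by simp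
      then obtain x' where x': "x' < nD" "\<psi> x = Rt x'" by auto
      then show "u \<in> Rt ` ?S" using x adj[of x y] y nD_nR by auto
    qed
    then have "card (Rt ` ?S) = card (\<psi> ` {..<y - nD + 4})" using 1 by simp
    moreover have "inj_on \<psi> {..<y - nD + 4}" using inj by (rule inj_on_subset) (use y nD_nR in auto)
    ultimately have cS: "card ?S = y - nD + 4" by (simp add: card_image inj_on_def)
    show ?thesis
    proof (cases "\<psi> y")
      case (Pt i j)
      then have "i \<le> k" "j < len i" using VS[OF y(2)] by auto
      then have "?S \<subseteq> {lab i (j mod 3), stl (st j), junk}" using label_degree Pt by auto
      then have "card ?S \<le> card {lab i (j mod 3), stl (st j), junk}" by (intro card_mono) auto
      also have "\<dots> \<le> 3" by (simp add: card_insert_if)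
      finally show ?thesis using cS by simp
    next
      case (Rt z)
      then have z: "nD \<le> z" "z < nR" using notD VS[OF y(2)] by (auto simp: image_iff)
      have "?S = {..<z - nD + 4}" using Rt z A_root nD_nR by (auto simp: radj_def)
      then have "z = y" using cS y z by simp
      then show ?thesis using Rt by simp
    qed
  qed
  have DL: "\<psi> x = Rt x" if x: "4 \<le> x" "x + 3 \<le> nD" for x
  proof -
    have "\<psi> x \<in> Rt ` {..<nD}" using D x by auto
    then obtain x' where x': "x' < nD" "\<psi> x = Rt x'" by auto
    have eq: "radj x y \<longleftrightarrow> radj x' y" if "nD \<le> y" "y < nR" for y
      using adj[of x y] E[OF that] x'(2) A_root[of x' y] that x x'(1) nD_nR by auto
    have "x = x'"
    proof (rule ccontr)
      assume "x \<noteq> x'"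
      \<comment> \<open>The separating vertex is the first independent root joined to the smaller of
        the two, \<open>x + nD - 3\<close> or \<open>x' + nD - 3\<close>. For \<open>x' < 3\<close>
        this formula falls below the independent roots, and \<open>nD\<close> itself separates
        because \<open>4 \<le> x\<close>.\<close>
      then consider "x < x'" | "x' < x" "3 \<le> x'" | "x' < 3" by linarith
      then show False
      proof cases
        case 1
        then have *: "nD \<le> x + nD - 3" "x + nD - 3 < nR" using x x' nD_nR by linarith+
        show ?thesis using 1 eq[OF *] * x x' nD_nR(3) unfolding radj_def by linarith
      next
        case 2
        then have *: "nD \<le> x' + nD - 3" "x' + nD - 3 < nR" using x x' nD_nR by linarith+
        show ?thesis using 2 eq[OF *] * x x' nD_nR(3) unfolding radj_def by linarith
      next
        case 3
        then have *: "nD \<le> nD" "nD < nR" using x x' nD_nR by linarith+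
        show ?thesis using 3 eq[OF *] * x x' nD_nR(3) unfolding radj_def by linarith
      qed
    qed
    then show ?thesis using x' by simp
  qed
  show "\<psi> x = Rt x" if "rigid_root x" for x using that E DL by (auto simp: rigid_root_def)
  have "{..<nR} = {..<nD} \<union> {nD..<nR}" using nD_nR by auto
  then show "\<psi> ` {..<nR} = Rt ` {..<nR}" using D E by (auto simp: image_Un)
qed

end

section \<open>Good graphs and the finite forbidden family\<close>

context machine
begin

text \<open>Layouts are described on \<open>vert\<close>, where positions are explicit, whereas
  realizations have numbers as vertices; this relates the two.\<close>

definition emb :: "(vert \<Rightarrow> nat) \<Rightarrow> (nat \<Rightarrow> nat) \<Rightarrow> (vert \<Rightarrow> vert \<Rightarrow> bool) \<Rightarrow> nat set \<Rightarrow> nat set set \<Rightarrow> bool" where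
  "emb f len A W EG \<longleftrightarrow> inj_on f (VS len) \<and> W = f ` VS len \<and>
     EG = {{f u, f w} | u w. u \<in> VS len \<and> w \<in> VS len \<and> A u w}"

definition good_graph :: "nat set \<Rightarrow> nat set set \<Rightarrow> bool" where
  "good_graph W EG \<longleftrightarrow> (\<exists>f len A T st val v. emb f len A W EG \<and> good k m s0 h R len A T st val v)"

text \<open>The size bound leaves room for the roots with \<open>2 * k + 3\<close> path vertices,
  and for the roots with one time and one urpath. Fixing \<open>ppi\<close> outside
  \<open>pU F\<close> removes the irrelevant freedom that would make the set infinite.\<close>

definition forbidden :: "pathograph set" where
  "forbidden = {F. wf_pathograph F \<and> pV F \<subseteq> {..<nR + 2 * k + 10} \<and> pU F \<subseteq> {..<nR + 2 * k + 10} \<and>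
     (\<forall>u. u \<notin> pU F \<longrightarrow> ppi F u = {}) \<and> (\<forall>W EG. good_graph W EG \<longrightarrow> \<not> contains_pg W EG F)}"

lemma finite_forbidden: "finite forbidden"
proof -
  let ?N = "nR + 2 * k + 10"
  let ?t = "\<lambda>F :: pathograph. (pV F, pU F, pE F, pS F, pR F, ppi F)"
  let ?P = "Pow {..<?N}"
  have "inj_on ?t forbidden"
    by (rule inj_onI) (auto intro: pathograph.equality)
  moreover have "?t ` forbidden \<subseteq> ?P \<times> ?P \<times> Pow ?P \<times> Pow ({..<?N} \<times> {..<?N}) \<times> Pow ?P \<times>
      {p. \<forall>u. (u \<in> {..<?N} \<longrightarrow> p u \<in> ?P) \<and> (u \<notin> {..<?N} \<longrightarrow> p u = {})}"
  proof (rule image_subsetI)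
    fix F assume "F \<in> forbidden"
    then have wf: "wf_pathograph F" and V: "pV F \<subseteq> {..<?N}" and U: "pU F \<subseteq> {..<?N}"
      and p: "\<And>u. u \<notin> pU F \<Longrightarrow> ppi F u = {}" by (auto simp: forbidden_def)
    have E: "pE F \<subseteq> Pow (pV F)" "pS F \<subseteq> pV F \<times> pU F" "pR F \<subseteq> Pow (pU F)"
      "\<And>u. u \<in> pU F \<Longrightarrow> ppi F u \<subseteq> pV F" using wf by (auto simp: wf_pathograph_def)
    have "ppi F u \<subseteq> {..<?N}" "u \<notin> {..<?N} \<Longrightarrow> ppi F u = {}" for u
      using p[of u] E(4)[of u] V U by blast+
    then show "?t F \<in> ?P \<times> ?P \<times> Pow ?P \<times> Pow ({..<?N} \<times> {..<?N}) \<times> Pow ?P \<times>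
        {p. \<forall>u. (u \<in> {..<?N} \<longrightarrow> p u \<in> ?P) \<and> (u \<notin> {..<?N} \<longrightarrow> p u = {})}"
      using E(1-3) V U by auto blast+
  qed
  moreover have "finite (?P \<times> ?P \<times> Pow ?P \<times> Pow ({..<?N} \<times> {..<?N}) \<times> Pow ?P \<times>
      {p. \<forall>u. (u \<in> {..<?N} \<longrightarrow> p u \<in> ?P) \<and> (u \<notin> {..<?N} \<longrightarrow> p u = {})})"
    by (intro finite_cartesian_product finite_Pow_iff[THEN iffD2] finite_set_of_finite_funs finite_lessThan)
  ultimately show ?thesis using finite_imageD finite_subset by blast
qed

end

context layout
begin

lemma emb_edge_iff:
  assumes "emb f len A W EG" "u \<in> VS len" "w \<in> VS len"
  shows "{f u, f w} \<in> EG \<longleftrightarrow> A u w"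
proof
  assume "{f u, f w} \<in> EG"
  then obtain u' w' where eq: "{f u, f w} = {f u', f w'}" and uw': "u' \<in> VS len" "w' \<in> VS len" "A u' w'"
    using assms(1) unfolding emb_def by blast
  have inj: "f a = f b \<longleftrightarrow> a = b" if "a \<in> VS len" "b \<in> VS len" for a b
    using assms(1) that inj_on_eq_iff[of f "VS len" a b] unfolding emb_def by blast
  have "u = u' \<and> w = w' \<or> u = w' \<and> w = u'"
    using eq assms(2,3) uw' by (simp add: doubleton_eq_iff inj)
  then show "A u w" using uw'(3) A_sym by auto
next
  assume "A u w"
  then show "{f u, f w} \<in> EG" using assms unfolding emb_def by blast
qed

lemma emb_edges:
  assumes "emb f len A W EG"
  shows "EG \<subseteq> {e. e \<subseteq> W \<and> card e = 2}"
proof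
  fix e assume "e \<in> EG"
  then obtain u w where e: "e = {f u, f w}" "u \<in> VS len" "w \<in> VS len" "A u w"
    using assms unfolding emb_def by blast
  then have "f u \<noteq> f w" using assms A_irrefl inj_on_eq_iff[of f "VS len" u w] by (auto simp: emb_def)
  then show "e \<in> {e. e \<subseteq> W \<and> card e = 2}" using e assms unfolding emb_def by auto
qed

text \<open>Without urpaths there is only one realization up to isomorphism, so containment is the
  existence of an induced copy.\<close>

lemma contains_plain_iff:
  assumes emb: "emb f len A W EG" and wf: "wf_pathograph F" and U: "pU F = {}"
  shows "contains_pg W EG F \<longleftrightarrow> (\<exists>\<psi>. inj_on \<psi> (pV F) \<and> \<psi> ` pV F \<subseteq> VS len \<and>
     (\<forall>x\<in>pV F. \<forall>y\<in>pV F. {x, y} \<in> pE F \<longleftrightarrow> A (\<psi> x) (\<psi> y)))" (is "?L \<longleftrightarrow> ?R")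
proof -
  have inj: "inj_on f (VS len)" and W: "W = f ` VS len" using emb by (auto simp: emb_def)
  have S: "pS F = {}" and pR: "pR F = {}" and E: "\<And>e. e \<in> pE F \<Longrightarrow> e \<subseteq> pV F \<and> card e = 2"
    using wf U by (auto simp: wf_pathograph_def)
  have ?R if L: ?L
  proof -
    obtain W' where W': "W' \<subseteq> W" "realization F W' {e \<in> EG. e \<subseteq> W'}"
      using L by (auto simp: contains_pg_def)
    then obtain \<phi> where \<phi>: "inj_on \<phi> (pV F)" "W' = \<phi> ` pV F"
      "\<And>e. e \<in> pE F \<Longrightarrow> \<phi> ` e \<in> {e \<in> EG. e \<subseteq> W'}"
      "\<And>e. e \<in> {e \<in> EG. e \<subseteq> W'} \<Longrightarrow> \<exists>e'\<in>pE F. e = \<phi> ` e'"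
      unfolding realization_def U S pR by auto
    define g where "g = the_inv_into (VS len) f"
    have g: "f (g (\<phi> x)) = \<phi> x" "g (\<phi> x) \<in> VS len" if "x \<in> pV F" for x
    proof -
      have "\<phi> x \<in> f ` VS len" using that \<phi>(2) W'(1) W by blast
      then show "f (g (\<phi> x)) = \<phi> x" "g (\<phi> x) \<in> VS len"
        unfolding g_def using f_the_inv_into_f[OF inj] the_inv_into_into[OF inj] by auto
    qed
    show ?R
    proof (intro exI[of _ "g \<circ> \<phi>"] conjI ballI)
      show "inj_on (g \<circ> \<phi>) (pV F)"
      proof (rule inj_onI)
        fix x y assume xy: "x \<in> pV F" "y \<in> pV F" "(g \<circ> \<phi>) x = (g \<circ> \<phi>) y"
        then have "f (g (\<phi> x)) = f (g (\<phi> y))" by simp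
        then show "x = y" using g(1) xy inj_onD[OF \<phi>(1)] by simp
      qed
      show "(g \<circ> \<phi>) ` pV F \<subseteq> VS len" using g by auto
      fix x y assume xy: "x \<in> pV F" "y \<in> pV F"
      have 1: "A (g (\<phi> x)) (g (\<phi> y)) \<longleftrightarrow> {\<phi> x, \<phi> y} \<in> EG"
        using emb_edge_iff[OF emb g(2)[OF xy(1)] g(2)[OF xy(2)]] g(1) xy by simp
      have "{x, y} \<in> pE F \<longleftrightarrow> {\<phi> x, \<phi> y} \<in> EG"
      proof
        assume "{x, y} \<in> pE F"
        then show "{\<phi> x, \<phi> y} \<in> EG" using \<phi>(3) by fastforce
      next
        assume "{\<phi> x, \<phi> y} \<in> EG"
        then obtain e' where e': "e' \<in> pE F" "{\<phi> x, \<phi> y} = \<phi> ` e'"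
          using \<phi>(4)[of "{\<phi> x, \<phi> y}"] \<phi>(2) xy by auto
        then have "\<phi> ` {x, y} = \<phi> ` e'" by simp
        then have "{x, y} = e'" using inj_on_image_eq_iff[OF \<phi>(1), of "{x, y}" e'] E[OF e'(1)] xy by blast
        then show "{x, y} \<in> pE F" using e' by simp
      qed
      with 1 show "{x, y} \<in> pE F \<longleftrightarrow> A ((g \<circ> \<phi>) x) ((g \<circ> \<phi>) y)" by simp
    qed
  qed
  moreover have ?L if R: ?R
  proof -
    obtain \<psi> where "inj_on \<psi> (pV F) \<and> \<psi> ` pV F \<subseteq> VS len \<and>
       (\<forall>x\<in>pV F. \<forall>y\<in>pV F. {x, y} \<in> pE F \<longleftrightarrow> A (\<psi> x) (\<psi> y))" using R ..
    then have \<psi>: "inj_on \<psi> (pV F)" "\<psi> ` pV F \<subseteq> VS len"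
      "\<And>x y. x \<in> pV F \<Longrightarrow> y \<in> pV F \<Longrightarrow> {x, y} \<in> pE F \<longleftrightarrow> A (\<psi> x) (\<psi> y)" by simp_all
    let ?\<phi> = "f \<circ> \<psi>" and ?W' = "(f \<circ> \<psi>) ` pV F"
    have sub: "?W' \<subseteq> W" using \<psi>(2) W by auto
    have edge: "{x, y} \<in> pE F \<longleftrightarrow> {f (\<psi> x), f (\<psi> y)} \<in> EG" if "x \<in> pV F" "y \<in> pV F" for x y
      using \<psi>(3)[OF that] emb_edge_iff[OF emb, of "\<psi> x" "\<psi> y"] \<psi>(2) that by auto
    have "realization F ?W' {e \<in> EG. e \<subseteq> ?W'}"
      unfolding realization_def U S pR
    proof (intro conjI exI[of _ ?\<phi>] exI[of _ "\<lambda>_. []"] exI[of _ "\<lambda>_. (0, 0)"])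
      show "finite ?W'" using wf by (simp add: wf_pathograph_def)
      show "{e \<in> EG. e \<subseteq> ?W'} \<subseteq> {e. e \<subseteq> ?W' \<and> card e = 2}" using emb_edges[OF emb] by auto
      show "inj_on ?\<phi> (pV F)" using comp_inj_on[OF \<psi>(1) inj_on_subset[OF inj \<psi>(2)]] .
      show "\<forall>e\<in>pE F. ?\<phi> ` e \<in> {e \<in> EG. e \<subseteq> ?W'}"
      proof
        fix e assume e: "e \<in> pE F"
        then obtain x y where xy: "e = {x, y}" "x \<in> pV F" "y \<in> pV F"
          using E[OF e] by (auto simp: card_2_iff)
        then show "?\<phi> ` e \<in> {e \<in> EG. e \<subseteq> ?W'}" using edge[of x y] e by auto
      qed
      show "\<forall>e\<in>{e \<in> EG. e \<subseteq> ?W'}. (\<exists>e'\<in>pE F. e = ?\<phi> ` e') \<or>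
           (\<exists>u\<in>{}. e \<in> path_edges (?\<phi> (fst (0, 0)) # [] @ [?\<phi> (snd (0, 0))])) \<or>
           (\<exists>(v, u)\<in>{}. \<exists>x\<in>set []. e = {?\<phi> v, x}) \<or>
           (\<exists>u u'. {u, u'} \<in> {} \<and> (\<exists>x\<in>set []. \<exists>y\<in>set []. e = {x, y}))"
      proof (intro ballI disjI1)
        fix e assume e: "e \<in> {e \<in> EG. e \<subseteq> ?W'}"
        then have "card e = 2" using emb_edges[OF emb] by auto
        then obtain a b where "e = {a, b}" by (auto simp: card_2_iff)
        then obtain x y where xy: "e = {f (\<psi> x), f (\<psi> y)}" "x \<in> pV F" "y \<in> pV F" using e by auto
        then have "{x, y} \<in> pE F" using edge e by auto
        then show "\<exists>e'\<in>pE F. e = ?\<phi> ` e'" using xy by (intro bexI[of _ "{x, y}"]) auto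
      qed
    qed auto
    then show ?L unfolding contains_pg_def using sub by blast
  qed
  ultimately show ?thesis ..
qed

end

locale free_layout = layout +
  fixes f :: "vert \<Rightarrow> nat" and W :: "nat set" and EG :: "nat set set"
  assumes emb: "emb f len A W EG" and free: "pg_free forbidden W EG"
begin

text \<open>Since \<open>forbidden\<close> consists of all small pathographs that occur in no good graph, every small set of
  vertices looks like a set of vertices of some good graph.\<close>

lemma local_embedding:
  assumes X: "X \<subseteq> VS len" "X \<inter> range Rt = {}" "card X \<le> 2 * k + 3"
  obtains len' A' T' st' val' v' p where "good k m s0 h R len' A' T' st' val' v'"
    "\<And>i j. Pt i j \<in> X \<Longrightarrow> p i j < len' i"
    "\<And>i j j'. Pt i j \<in> X \<Longrightarrow> Pt i j' \<in> X \<Longrightarrow> p i j = p i j' \<Longrightarrow> j = j'"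
    "\<And>i j i' j'. Pt i j \<in> X \<Longrightarrow> Pt i' j' \<in> X \<Longrightarrow> A (Pt i j) (Pt i' j') \<longleftrightarrow> A' (Pt i (p i j)) (Pt i' (p i' j'))"
    "\<And>i j x. Pt i j \<in> X \<Longrightarrow> rigid_root x \<Longrightarrow> A (Rt x) (Pt i j) \<longleftrightarrow> A' (Rt x) (Pt i (p i j))"
proof -
  have "finite X" using X(1) finite_VS finite_subset by blast
  then obtain xs where xs: "set xs = X" "distinct xs" using finite_distinct_list by blast
  let ?n = "length xs"
  \<comment> \<open>Numbers the vertices of the pattern: a root keeps its number, and the
    \<open>n\<close>-th element of \<open>X\<close> becomes \<open>nR + n\<close>.\<close>
  define hh where "hh = (\<lambda>y. if y < nR then Rt y else xs ! (y - nR))"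
  let ?V = "{..<nR + ?n}"
  have nl: "?n \<le> 2 * k + 3" using X(3) xs distinct_card by fastforce
  have hroot: "hh y = Rt y" if "y < nR" for y using that by (simp add: hh_def)
  have hX: "hh y \<in> X" if "y \<in> ?V" "\<not> y < nR" for y using that xs(1) by (auto simp: hh_def)
  have hV: "hh y \<in> VS len" if "y \<in> ?V" for y
    using that hX[of y] X(1) by (cases "y < nR") (auto simp: hh_def)
  have inj: "inj_on hh ?V"
  proof (rule inj_onI)
    fix y z assume yz: "y \<in> ?V" "z \<in> ?V" "hh y = hh z"
    have "y < nR \<longleftrightarrow> z < nR" using hX[OF yz(1)] hX[OF yz(2)] hroot[of y] hroot[of z] yz(3) X(2) by (metis disjoint_iff rangeI)
    then show "y = z" using yz xs(2) by (auto simp: hh_def nth_eq_iff_index_eq split: if_splits)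
  qed
  have img: "hh ` ?V = Rt ` {..<nR} \<union> X"
  proof (intro set_eqI iffI)
    fix u assume "u \<in> hh ` ?V"
    then show "u \<in> Rt ` {..<nR} \<union> X" using hroot hX by fastforce
  next
    fix u assume "u \<in> Rt ` {..<nR} \<union> X"
    then show "u \<in> hh ` ?V"
    proof
      assume "u \<in> Rt ` {..<nR}"
      then obtain x where "x < nR" "u = Rt x" by auto
      then show ?thesis using hroot[of x] by (intro image_eqI[of _ _ x]) auto
    next
      assume "u \<in> X"
      then obtain n where "n < ?n" "u = xs ! n" using xs(1) by (metis in_set_conv_nth)
      then show ?thesis by (intro image_eqI[of _ _ "nR + n"]) (auto simp: hh_def)
    qed
  qed
  define F where "F = \<lparr>pV = ?V, pU = {}, pE = {{y, z} | y z. y \<in> ?V \<and> z \<in> ?V \<and> A (hh y) (hh z)},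
    pS = {}, pR = {}, ppi = (\<lambda>_. {})\<rparr>"
  have ne: "y \<noteq> z" if "A (hh y) (hh z)" for y z using that A_irrefl by auto
  have "card {y, z} = 2" if "A (hh y) (hh z)" for y z using ne[OF that] by simp
  then have wf: "wf_pathograph F" unfolding wf_pathograph_def F_def by auto
  have edge: "{y, z} \<in> pE F \<longleftrightarrow> A (hh y) (hh z)" if "y \<in> ?V" "z \<in> ?V" for y z
    using that A_sym by (auto simp: F_def doubleton_eq_iff)
  have FV: "pV F = ?V" "pU F = {}" by (simp_all add: F_def)
  have "contains_pg W EG F"
    unfolding contains_plain_iff[OF emb wf FV(2)] FV(1)
    using inj hV edge by (intro exI[of _ hh]) auto
  then have "F \<notin> forbidden" using free unfolding pg_free_def by blast
  then obtain W' EG' where "good_graph W' EG'" and c: "contains_pg W' EG' F"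
    using wf nl by (auto simp: forbidden_def F_def)
  then obtain f' len' A' T' st' val' v' where emb': "emb f' len' A' W' EG'"
    and good: "good k m s0 h R len' A' T' st' val' v'" unfolding good_graph_def by blast
  interpret G: good k m s0 h R len' A' T' st' val' v' by (rule good)
  obtain \<psi> where \<psi>: "inj_on \<psi> ?V" "\<psi> ` ?V \<subseteq> VS len'"
    "\<And>x y. x \<in> ?V \<Longrightarrow> y \<in> ?V \<Longrightarrow> A (hh x) (hh y) \<longleftrightarrow> A' (\<psi> x) (\<psi> y)"
    using c edge unfolding G.contains_plain_iff[OF emb' wf FV(2)] FV(1) by auto
  have inj': "inj_on \<psi> {..<nR}" using \<psi>(1) by (rule inj_on_subset) auto
  have VS': "\<psi> x \<in> VS len'" if "x < nR" for x using \<psi>(2) that by auto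
  have adj': "A' (\<psi> x) (\<psi> y) \<longleftrightarrow> radj x y" if "x < nR" "y < nR" for x y
    using \<psi>(3)[of x y] A_root[OF that] hroot that by simp
  have r1: "\<psi> ` {..<nR} = Rt ` {..<nR}"
    by (rule G.rigidity(1)[OF inj']) (use VS' adj' in blast)+
  have r2: "\<psi> x = Rt x" if "rigid_root x" for x
    by (rule G.rigidity(2)[OF inj']) (use VS' adj' that in blast)+
  define g where "g = the_inv_into ?V hh"
  have gV: "g u \<in> ?V" "hh (g u) = u" if "u \<in> X" for u
  proof -
    have "u \<in> hh ` ?V" using img that by blast
    then show "g u \<in> ?V" "hh (g u) = u" unfolding g_def
      using f_the_inv_into_f[OF inj] the_inv_into_into[OF inj] by auto
  qed
  define p where "p = (\<lambda>i j. case \<psi> (g (Pt i j)) of Pt i' j' \<Rightarrow> j' | Rt _ \<Rightarrow> 0)"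
  have key: "\<psi> (g (Pt i j)) = Pt i (p i j) \<and> p i j < len' i" if ij: "Pt i j \<in> X" for i j
  proof -
    note g1 = gV[OF ij]
    have nr: "\<not> g (Pt i j) < nR" using g1 hroot[of "g (Pt i j)"] by auto
    have notR: "\<psi> (g (Pt i j)) \<notin> Rt ` {..<nR}"
    proof
      assume "\<psi> (g (Pt i j)) \<in> Rt ` {..<nR}"
      then have "\<psi> (g (Pt i j)) \<in> \<psi> ` {..<nR}" by (simp only: r1)
      then obtain x where "x < nR" "\<psi> (g (Pt i j)) = \<psi> x" by blast
      then show False using inj_onD[OF \<psi>(1), of "g (Pt i j)" x] g1 nr by auto
    qed
    have "\<psi> (g (Pt i j)) \<in> VS len'" using \<psi>(2) g1 by auto
    then obtain i' j' where ij': "\<psi> (g (Pt i j)) = Pt i' j'" "i' \<le> k" "j' < len' i'"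
      using notR by (cases "\<psi> (g (Pt i j))") auto
    have ijk: "i \<le> k" "j < len i" using ij X(1) by auto
    \<comment> \<open>Every path vertex of a good graph carries a position label, and a label
      belongs to one line only. The label edge pulls back to the original vertex, so original and
      copy lie on lines of the same index.\<close>
    let ?x = "lab i' (j' mod 3)"
    have sp: "spk ?x i'" by (rule spk_lab) simp
    then have x: "?x < nD" "rigid_root ?x" using spk_less rigid_root_spk ij' by auto
    have "A' (Rt ?x) (Pt i' j')" using G.G_lab ij' by simp
    then have "A' (\<psi> ?x) (\<psi> (g (Pt i j)))" using r2[OF x(2)] ij' by simp
    then have "A (Rt ?x) (Pt i j)" using \<psi>(3)[of ?x "g (Pt i j)"] g1 hroot[of ?x] x(1) nD_nR by simp
    then have "spk ?x i" using A_label[of ?x i j] x(1) ijk pa_ge[of i] pb_ge[of i] nD_nR by auto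
    then have "i = i'" using spk_inj sp ij' ijk by blast
    then show ?thesis using ij' by (simp add: p_def)
  qed
  show thesis
  proof (rule that[OF good, of p])
    fix i j assume ij: "Pt i j \<in> X"
    show "p i j < len' i" using key ij by simp
    fix x assume x: "rigid_root x"
    show "A (Rt x) (Pt i j) \<longleftrightarrow> A' (Rt x) (Pt i (p i j))"
      using \<psi>(3)[of x "g (Pt i j)"] gV[OF ij] hroot[of x] r2[OF x] key[OF ij] rigid_root_less[OF x] by simp
  next
    fix i j j' assume ij: "Pt i j \<in> X" "Pt i j' \<in> X" "p i j = p i j'"
    then have "\<psi> (g (Pt i j)) = \<psi> (g (Pt i j'))" using key by simp
    then have "g (Pt i j) = g (Pt i j')" using inj_onD[OF \<psi>(1)] gV ij by blast
    then have "hh (g (Pt i j)) = hh (g (Pt i j'))" by simp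
    then show "j = j'" using gV(2)[OF ij(1)] gV(2)[OF ij(2)] by simp
  next
    fix i j i' j' assume ij: "Pt i j \<in> X" "Pt i' j' \<in> X"
    show "A (Pt i j) (Pt i' j') \<longleftrightarrow> A' (Pt i (p i j)) (Pt i' (p i' j'))"
      using \<psi>(3)[of "g (Pt i j)" "g (Pt i' j')"] gV[OF ij(1)] gV[OF ij(2)] key[OF ij(1)] key[OF ij(2)] by simp
  qed
qed

end

section \<open>Edges of paths\<close>

lemma realizationE:
  assumes "realization H W EG"
  obtains \<phi> P en where "finite W" "EG \<subseteq> {e. e \<subseteq> W \<and> card e = 2}" "inj_on \<phi> (pV H)"
    "\<forall>u\<in>pU H. {fst (en u), snd (en u)} = ppi H u"
    "\<forall>u\<in>pU H. P u \<noteq> [] \<and> distinct (P u) \<and> set (P u) \<inter> \<phi> ` pV H = {}"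
    "\<forall>u\<in>pU H. \<forall>u'\<in>pU H. u \<noteq> u' \<longrightarrow> set (P u) \<inter> set (P u') = {}"
    "W = \<phi> ` pV H \<union> (\<Union>u\<in>pU H. set (P u))"
    "\<forall>e\<in>pE H. \<phi> ` e \<in> EG"
    "\<forall>u\<in>pU H. path_edges (\<phi> (fst (en u)) # P u @ [\<phi> (snd (en u))]) \<subseteq> EG"
    "\<forall>(v, u)\<in>pS H. \<exists>x\<in>set (P u). {\<phi> v, x} \<in> EG"
    "\<forall>u u'. {u, u'} \<in> pR H \<longrightarrow> (\<exists>x\<in>set (P u). \<exists>y\<in>set (P u'). {x, y} \<in> EG)"
    "\<forall>e\<in>EG. (\<exists>e'\<in>pE H. e = \<phi> ` e') \<or>
       (\<exists>u\<in>pU H. e \<in> path_edges (\<phi> (fst (en u)) # P u @ [\<phi> (snd (en u))])) \<or>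
       (\<exists>(v, u)\<in>pS H. \<exists>x\<in>set (P u). e = {\<phi> v, x}) \<or>
       (\<exists>u u'. {u, u'} \<in> pR H \<and> (\<exists>x\<in>set (P u). \<exists>y\<in>set (P u'). e = {x, y}))"
  using assms unfolding realization_def by (elim conjE exE) (rule that)

lemma path_edges_Cons: "xs \<noteq> [] \<Longrightarrow> path_edges (x # xs) = insert {x, hd xs} (path_edges xs)"
proof (intro set_eqI iffI)
  fix e assume xs: "xs \<noteq> []" and "e \<in> path_edges (x # xs)"
  then obtain i where "e = {(x # xs) ! i, (x # xs) ! Suc i}" "Suc i < length (x # xs)" by (auto simp: path_edges_def)
  then show "e \<in> insert {x, hd xs} (path_edges xs)"
    using xs by (cases i) (auto simp: path_edges_def hd_conv_nth)
next
  fix e assume xs: "xs \<noteq> []" and e: "e \<in> insert {x, hd xs} (path_edges xs)"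
  show "e \<in> path_edges (x # xs)"
  proof (cases "e = {x, hd xs}")
    case True
    then show ?thesis using xs unfolding path_edges_def by (auto simp: hd_conv_nth intro!: exI[of _ 0])
  next
    case False
    then obtain i where "e = {xs ! i, xs ! Suc i}" "Suc i < length xs" using e by (auto simp: path_edges_def)
    then show ?thesis unfolding path_edges_def by (auto intro!: exI[of _ "Suc i"])
  qed
qed

lemma path_edges_snoc: "xs \<noteq> [] \<Longrightarrow> path_edges (xs @ [y]) = insert {last xs, y} (path_edges xs)"
proof (induction xs)
  case (Cons x xs)
  show ?case
  proof (cases "xs = []")
    case True
    then show ?thesis by (auto simp: path_edges_def)
  next
    case False
    then show ?thesis using Cons.IH path_edges_Cons[of "xs @ [y]" x] path_edges_Cons[of xs x] by auto
  qed
qed simp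

lemma path_edges_map_upt:
  "path_edges (map g [o'..<n]) = {{g j, g (Suc j)} | j. o' \<le> j \<and> Suc j < n}"
proof (intro set_eqI iffI)
  fix e assume "e \<in> path_edges (map g [o'..<n])"
  then obtain i where "e = {map g [o'..<n] ! i, map g [o'..<n] ! Suc i}" "Suc i < n - o'"
    by (auto simp: path_edges_def)
  then show "e \<in> {{g j, g (Suc j)} | j. o' \<le> j \<and> Suc j < n}"
    by (intro CollectI exI[of _ "o' + i"]) auto
next
  fix e assume "e \<in> {{g j, g (Suc j)} | j. o' \<le> j \<and> Suc j < n}"
  then obtain j where "e = {g j, g (Suc j)}" "o' \<le> j" "Suc j < n" by auto
  then show "e \<in> path_edges (map g [o'..<n])" unfolding path_edges_def
    by (intro CollectI exI[of _ "j - o'"]) auto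
qed

lemma path_edges_urpath:
  assumes "o' < n"
  shows "path_edges (x # map g [o'..<n] @ [y]) =
    insert {x, g o'} (insert {g (n - 1), y} {{g j, g (Suc j)} | j. o' \<le> j \<and> Suc j < n})"
proof -
  let ?xs = "map g [o'..<n]"
  have ne: "?xs \<noteq> []" and ne': "?xs @ [y] \<noteq> []" using assms by auto
  have "hd (?xs @ [y]) = g o'" using assms by (simp add: hd_append hd_map)
  moreover have "last ?xs = g (n - 1)" using assms by (simp add: last_map)
  ultimately show ?thesis
    using path_edges_Cons[OF ne', of x] path_edges_snoc[OF ne, of y] path_edges_map_upt[of g o' n] by simp
qed

lemma path_edges_meet:
  assumes "e \<in> path_edges (x # xs @ [y])" "xs \<noteq> []"
  shows "e \<inter> set xs \<noteq> {}" "e \<subseteq> insert x (insert y (set xs))"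
proof -
  have "path_edges xs \<subseteq> {e. e \<inter> set xs \<noteq> {} \<and> e \<subseteq> insert x (insert y (set xs))}"
    by (auto simp: path_edges_def)
  moreover have "hd (xs @ [y]) = hd xs" using assms(2) by simp
  ultimately have "path_edges (x # xs @ [y]) \<subseteq> {e. e \<inter> set xs \<noteq> {} \<and> e \<subseteq> insert x (insert y (set xs))}"
    using path_edges_Cons[of "xs @ [y]" x] path_edges_snoc[OF assms(2), of y] assms(2) by auto
  then show "e \<inter> set xs \<noteq> {}" "e \<subseteq> insert x (insert y (set xs))" using assms(1) by auto
qed

text \<open>A discrete intermediate value theorem. It shows that a copy of an urpath between the two
  ends of a line visits the entire line.\<close>

lemma unit_steps_cover:
  fixes js :: "nat list"
  assumes "js \<noteq> []" "\<And>n. Suc n < length js \<Longrightarrow> js ! Suc n = Suc (js ! n) \<or> js ! n = Suc (js ! Suc n)"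
    and "hd js \<le> v \<and> v \<le> last js \<or> last js \<le> v \<and> v \<le> hd js"
  shows "v \<in> set js"
  using assms
proof (induction js)
  case (Cons j js)
  show ?case
  proof (cases "js = [] \<or> v = j")
    case True
    then show ?thesis using Cons.prems(3) by auto
  next
    case False
    have "js ! n = Suc (js ! Suc n) \<or> js ! Suc n = Suc (js ! n)" if "Suc n < length js" for n
      using Cons.prems(2)[of "Suc n"] that by auto
    moreover have "hd js = Suc j \<or> j = Suc (hd js)"
      using Cons.prems(2)[of 0] False by (simp add: hd_conv_nth)
    then have "hd js \<le> v \<and> v \<le> last js \<or> last js \<le> v \<and> v \<le> hd js"
      using Cons.prems(3) False by auto
    ultimately have "v \<in> set js" using Cons.IH False by blast
    then show ?thesis by simp
  qed
qed simp

context layout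
begin

lemma start_iff: assumes "i \<le> k" "j < len i" shows "A (Rt (pa i)) (Pt i j) \<longleftrightarrow> j = 0"
proof
  assume "A (Rt (pa i)) (Pt i j)"
  then have "pa i = pa i \<and> j = 0 \<or> pa i = pb i \<and> Suc j = len i \<or> spk (pa i) i"
    using A_label[of "pa i" i j] pa_less assms by blast
  moreover have "pa i \<noteq> pb i" by (simp add: pa_def pb_def)
  ultimately show "j = 0" using spk_less[of "pa i" i] pa_ge[of i] assms by auto
qed (use A_start assms in auto)

lemma end_iff: assumes "i \<le> k" "j < len i" shows "A (Rt (pb i)) (Pt i j) \<longleftrightarrow> Suc j = len i"
proof
  assume "A (Rt (pb i)) (Pt i j)"
  then have "pb i = pa i \<and> j = 0 \<or> pb i = pb i \<and> Suc j = len i \<or> spk (pb i) i"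
    using A_label[of "pb i" i j] pb_less assms by blast
  moreover have "pa i \<noteq> pb i" by (simp add: pa_def pb_def)
  ultimately show "Suc j = len i" using spk_less[of "pb i" i] pb_ge[of i] assms by auto
next
  assume "Suc j = len i"
  then have "len i - 1 = j" by simp
  then show "A (Rt (pb i)) (Pt i j)" using A_end[OF assms(1)] by simp
qed

end

section \<open>Position labels and existence of values in a free layout\<close>

context free_layout
begin

text \<open>Residues modulo 3 orient an edge, since the successor and the predecessor of a number
  have different residues; modulo 2 they would agree.\<close>

lemma next_index:
  fixes a b j :: nat
  assumes "a mod 3 = j mod 3" "b mod 3 = Suc j mod 3" "b = Suc a \<or> a = Suc b"
  shows "b = Suc a"
  using assms by presburger

text \<open>Strong induction with the window \<open>j - 2\<close>, \<open>j - 1\<close>,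
  \<open>j\<close>. The residues known by induction orient the first edge of its copy upwards, and
  injectivity keeps the copy from turning back, so the third position is two further. For
  \<open>j \<le> 1\<close> the root \<open>pa i\<close> places the copy of position 0 at 0.\<close>

lemma index_label:
  assumes i: "i \<le> k" and "j < len i" and "r < 3"
  shows "A (Rt (lab i r)) (Pt i j) \<longleftrightarrow> r = j mod 3"
  using assms(2,3)
proof (induction j arbitrary: r rule: less_induct)
  case (less j)
  have rig: "rigid_root (lab i r')" if "r' < 3" for r' using rigid_root_spk[OF spk_lab[OF that]] i by blast
  define X where "X = {Pt i j' | j'. j' \<le> j \<and> j \<le> j' + 2}"
  have Xeq: "X = Pt i ` {j - 2..j}" unfolding X_def by (auto simp: image_iff)
  have "card X \<le> card {j - 2..j}" unfolding Xeq by (rule card_image_le) simp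
  also have "\<dots> \<le> 2 * k + 3" by simp
  finally have cX: "card X \<le> 2 * k + 3" .
  have XV: "X \<subseteq> VS len" "X \<inter> range Rt = {}" using i less.prems(1) by (auto simp: X_def)
  obtain len' A' T' st' val' v' p where good: "good k m s0 h R len' A' T' st' val' v'"
    and p: "\<And>i j. Pt i j \<in> X \<Longrightarrow> p i j < len' i"
    "\<And>i j j'. Pt i j \<in> X \<Longrightarrow> Pt i j' \<in> X \<Longrightarrow> p i j = p i j' \<Longrightarrow> j = j'"
    "\<And>i j i' j'. Pt i j \<in> X \<Longrightarrow> Pt i' j' \<in> X \<Longrightarrow> A (Pt i j) (Pt i' j') \<longleftrightarrow> A' (Pt i (p i j)) (Pt i' (p i' j'))"
    "\<And>i j x. Pt i j \<in> X \<Longrightarrow> rigid_root x \<Longrightarrow> A (Rt x) (Pt i j) \<longleftrightarrow> A' (Rt x) (Pt i (p i j))"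
    by (rule local_embedding[OF XV cX]) blast
  interpret G: good k m s0 h R len' A' T' st' val' v' by (rule good)
  have memX: "Pt i j' \<in> X" if "j' \<le> j" "j \<le> j' + 2" for j' using that by (auto simp: X_def)
  have lab': "A (Rt (lab i r')) (Pt i j') \<longleftrightarrow> r' = p i j' mod 3" if "j' \<le> j" "j \<le> j' + 2" "r' < 3" for j' r'
    using p(4)[OF memX[OF that(1,2)] rig[OF that(3)]] G.G_lab[OF i p(1)[OF memX[OF that(1,2)]] that(3)] by simp
  have modj: "p i j' mod 3 = j' mod 3" if "j' < j" "j \<le> j' + 2" for j'
  proof -
    have "A (Rt (lab i (p i j' mod 3))) (Pt i j')" using lab'[of j' "p i j' mod 3"] that by simp
    then show ?thesis using less.IH[of j' "p i j' mod 3"] that less.prems(1) by simp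
  qed
  have nxt: "p i (Suc j') = Suc (p i j') \<or> p i j' = Suc (p i (Suc j'))" if "Suc j' \<le> j" "j \<le> j' + 2" for j'
  proof -
    have X2: "Pt i j' \<in> X" "Pt i (Suc j') \<in> X" using memX that by auto
    have "A (Pt i j') (Pt i (Suc j'))" using A_path[of i j' "Suc j'"] i that less.prems(1) by simp
    then have "A' (Pt i (p i j')) (Pt i (p i (Suc j')))" using p(3)[OF X2] by simp
    then show ?thesis using G.A_path[OF i p(1)[OF X2(1)] p(1)[OF X2(2)]] by simp
  qed
  have "p i j mod 3 = j mod 3"
  proof -
    have z: "p i 0 = 0" if "j \<le> 2"
    proof -
      have X0: "Pt i 0 \<in> X" using memX that by simp
      have "A (Rt (pa i)) (Pt i 0)" using A_start[OF i] .
      then have "A' (Rt (pa i)) (Pt i (p i 0))" using p(4)[OF X0 rigid_root_pa[OF i]] by simp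
      then show ?thesis using G.start_iff[OF i p(1)[OF X0]] by simp
    qed
    consider "j = 0" | "j = 1" | j0 where "j = Suc (Suc j0)" by (metis One_nat_def not0_implies_Suc)
    then show ?thesis
    proof cases
      case 1
      then show ?thesis using z by simp
    next
      case 2
      then show ?thesis using z nxt[of 0] by simp
    next
      case (3 j0)
      have "p i (Suc j0) = Suc (p i j0)"
        using next_index[OF modj[of j0] modj[of "Suc j0"] nxt[of j0]] 3 by simp
      moreover have "p i j \<noteq> p i j0" using p(2)[OF memX[of j] memX[of j0]] 3 by auto
      ultimately have "p i j = Suc (Suc (p i j0))" using nxt[of "Suc j0"] 3 by auto
      then show ?thesis using modj[of j0] 3 by (simp add: mod_Suc)
    qed
  qed
  then show ?case using lab'[of j r] less.prems(2) by simp
qed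

text \<open>No bounded set of vertices shows that a time is joined to nothing on a value line. The
  violating pattern therefore contains the line as an urpath that has no spoke to the time. In a
  good graph a copy of this urpath covers the whole line and so meets the value of the copied time,
  an edge that the missing spoke excludes.\<close>

lemma value_exists:
  assumes t: "t < len 0" and i: "i < k"
  shows "\<exists>j<len (Suc i). A (Pt 0 t) (Pt (Suc i) j)"
proof (rule ccontr)
  assume "\<not> ?thesis"
  then have none: "\<not> A (Pt 0 t) (Pt (Suc i) j)" if "j < len (Suc i)" for j using that by blast
  define I where "I = Suc i"
  have I: "I \<le> k" "0 < I" "I \<noteq> 0" using i by (auto simp: I_def)
  have none': "\<not> A (Pt 0 t) (Pt I j)" "\<not> A (Pt I j) (Pt 0 t)" if "j < len I" for j
    using none that A_sym by (auto simp: I_def)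
  have lenI: "0 < len I" using len_pos I by simp
  define hh where "hh = (\<lambda>y. if y < nR then Rt y else Pt 0 t)"
  have hroot: "hh y = Rt y" if "y < nR" for y using that by (simp add: hh_def)
  have hnR: "hh nR = Pt 0 t" by (simp add: hh_def)
  let ?V = "{..nR}" and ?u = "Suc nR"
  have hV: "hh y \<in> VS len" if "y \<in> ?V" for y using that t by (auto simp: hh_def)
  have injh: "inj_on hh ?V" by (rule inj_onI) (auto simp: hh_def split: if_splits)
  have ablt: "pa I < nR" "pb I < nR" "pa I \<noteq> pb I" using pa_less pb_less I by (auto simp: pa_def pb_def)
  have lablt: "lab I r < nR" "lab I r < nD" if "r < 3" for r
    using spk_less[OF spk_lab[OF that] I(1)] nD_nR by auto
  \<comment> \<open>Vertex \<open>nR\<close> is the time. Only the three position labels have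
    spokes, so in a realization no edge joins \<open>nR\<close> to the urpath.\<close>
  define F where "F = \<lparr>pV = ?V, pU = {?u}, pE = {{y, z} | y z. y \<in> ?V \<and> z \<in> ?V \<and> A (hh y) (hh z)},
    pS = {(lab I r, ?u) | r. r < 3}, pR = {}, ppi = (\<lambda>u. if u = ?u then {pa I, pb I} else {})\<rparr>"
  have Fsel: "pV F = ?V" "pU F = {?u}" "pS F = {(lab I r, ?u) | r. r < 3}" "pR F = {}"
    "ppi F ?u = {pa I, pb I}" by (simp_all add: F_def)
  have edge: "{y, z} \<in> pE F \<longleftrightarrow> A (hh y) (hh z)" if "y \<in> ?V" "z \<in> ?V" for y z
    using that A_sym by (auto simp: F_def doubleton_eq_iff)
  have pE: "\<exists>y z. e = {y, z} \<and> y \<in> ?V \<and> z \<in> ?V \<and> A (hh y) (hh z)" if "e \<in> pE F" for e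
    using that by (auto simp: F_def)
  have "y \<noteq> z" if "A (hh y) (hh z)" for y z using that A_irrefl by auto
  then have c2: "card {y, z} = 2" if "A (hh y) (hh z)" for y z using that by auto
  have nE: "{pa I, pb I} \<notin> pE F"
    using edge[of "pa I" "pb I"] hroot ablt A_root[of "pa I" "pb I"] pa_ge[of I] pb_ge[of I]
    by (auto simp: radj_def)
  have wf: "wf_pathograph F"
    unfolding wf_pathograph_def
  proof (intro conjI ballI)
    show "pE F \<subseteq> {e. e \<subseteq> pV F \<and> card e = 2}" using pE c2 Fsel(1) by fastforce
    show "pS F \<subseteq> pV F \<times> pU F" using lablt by (auto simp: Fsel less_imp_le)
    fix u assume "u \<in> pU F"
    then have u: "u = ?u" by (simp add: Fsel)
    show "ppi F u \<subseteq> pV F" "card (ppi F u) = 2" "ppi F u \<notin> pE F"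
      using ablt nE by (auto simp: u Fsel)
  qed (auto simp: Fsel)
  have injf: "inj_on f (VS len)" and W: "W = f ` VS len" using emb by (auto simp: emb_def)
  let ?S = "hh ` ?V \<union> Pt I ` {..<len I}"
  let ?W' = "f ` ?S" and ?EG' = "{e \<in> EG. e \<subseteq> f ` ?S}"
  have SV: "?S \<subseteq> VS len" using hV I by auto
  have EGI: "{f u, f w} \<in> ?EG'" if "u \<in> ?S" "w \<in> ?S" "A u w" for u w
  proof -
    have "u \<in> VS len" "w \<in> VS len" using that SV by blast+
    then show ?thesis using that emb_edge_iff[OF emb] by auto
  qed
  have rS: "Rt x \<in> ?S" if "x < nR" for x
    using hroot[OF that] that by (intro UnI1 image_eqI[of _ _ x]) auto
  \<comment> \<open>The complete line \<open>I\<close> realizes the urpath, with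
    \<open>A_spoke\<close> providing an edge for every spoke.\<close>
  have "contains_pg W EG F"
    unfolding contains_pg_def
  proof (intro exI[of _ ?W'] conjI)
    show "?W' \<subseteq> W" unfolding W using SV by blast
    let ?\<phi> = "f \<circ> hh" and ?P = "map (\<lambda>j. f (Pt I j)) [0..<len I]"
    have \<phi>r: "?\<phi> x = f (Rt x)" if "x < nR" for x using hroot[OF that] by simp
    have pe: "path_edges (?\<phi> (pa I) # ?P @ [?\<phi> (pb I)]) =
        insert {f (Rt (pa I)), f (Pt I 0)} (insert {f (Pt I (len I - 1)), f (Rt (pb I))}
          {{f (Pt I j), f (Pt I (Suc j))} | j. 0 \<le> j \<and> Suc j < len I})"
      using path_edges_urpath[OF lenI, of "?\<phi> (pa I)" "\<lambda>j. f (Pt I j)" "?\<phi> (pb I)"] \<phi>r ablt by simp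
    let ?Q = "\<lambda>e. (\<exists>e'\<in>pE F. e = ?\<phi> ` e') \<or>
           (\<exists>u\<in>pU F. e \<in> path_edges (?\<phi> (fst ((\<lambda>_. (pa I, pb I)) u)) # (\<lambda>_. ?P) u @ [?\<phi> (snd ((\<lambda>_. (pa I, pb I)) u))])) \<or>
           (\<exists>(v, u)\<in>pS F. \<exists>x\<in>set ((\<lambda>_. ?P) u). e = {?\<phi> v, x}) \<or>
           (\<exists>u u'. {u, u'} \<in> pR F \<and> (\<exists>x\<in>set ((\<lambda>_. ?P) u). \<exists>y\<in>set ((\<lambda>_. ?P) u'). e = {x, y}))"
    have Q1: "?Q {f (hh y), f (hh z)}" if "y \<in> ?V" "z \<in> ?V" "A (hh y) (hh z)" for y z
      by (intro disjI1 bexI[of _ "{y, z}"]) (use edge that in auto)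
    have Q2: "?Q {f (Pt I j), f (Pt I j')}" if "j < len I" "j' < len I" "A (Pt I j) (Pt I j')" for j j'
    proof -
      have "j' = Suc j \<or> j = Suc j'" using A_path[OF I(1) that(1,2)] that(3) by simp
      then have "{f (Pt I j), f (Pt I j')} \<in> path_edges (?\<phi> (pa I) # ?P @ [?\<phi> (pb I)])"
        unfolding pe using that(1,2) by auto
      then show ?thesis by (simp add: Fsel)
    qed
    have Q3: "?Q {f (hh y), f (Pt I j)}" if yV: "y \<in> ?V" and jI: "j < len I" and Ayj: "A (hh y) (Pt I j)" for y j
    proof (cases "y = nR")
      case True
      then show ?thesis using yV jI Ayj none' hnR by simp
    next
      case False
      then have y: "y < nR" using yV by simp
      then have "A (Rt y) (Pt I j)" using Ayj hroot by simp
      then consider "y = pa I" "j = 0" | "y = pb I" "Suc j = len I" | "spk y I"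
        using A_label[OF y I(1) jI] by blast
      then show ?thesis
      proof cases
        case 1
        then have "{f (hh y), f (Pt I j)} \<in> path_edges (?\<phi> (pa I) # ?P @ [?\<phi> (pb I)])"
          unfolding pe using hroot[OF y] by simp
        then show ?thesis by (simp add: Fsel)
      next
        case 2
        then have "len I - 1 = j" by simp
        then have "{f (hh y), f (Pt I j)} \<in> path_edges (?\<phi> (pa I) # ?P @ [?\<phi> (pb I)])"
          unfolding pe using hroot[OF y] 2 by (simp add: insert_commute)
        then show ?thesis by (simp add: Fsel)
      next
        case 3
        then obtain r where r: "r < 3" "y = lab I r" using I by (auto simp: spk_def)
        have "f (Pt I j) \<in> set ?P" using jI by simp
        then have "\<exists>(v, u)\<in>pS F. \<exists>x\<in>set ((\<lambda>_. ?P) u). {f (hh y), f (Pt I j)} = {?\<phi> v, x}"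
          unfolding Fsel using r by (intro bexI[of _ "(lab I r, ?u)"]) auto
        then show ?thesis by blast
      qed
    qed
    show "realization F ?W' ?EG'"
      unfolding realization_def
    proof (intro conjI exI[of _ ?\<phi>] exI[of _ "\<lambda>_. ?P"] exI[of _ "\<lambda>_. (pa I, pb I)"])
      show "finite ?W'" by simp
      show "?EG' \<subseteq> {e. e \<subseteq> ?W' \<and> card e = 2}" using emb_edges[OF emb] by auto
      show "inj_on ?\<phi> (pV F)" unfolding Fsel
        using comp_inj_on[OF injh inj_on_subset[OF injf]] hV by blast
      show "\<forall>u\<in>pU F. {fst (pa I, pb I), snd (pa I, pb I)} = ppi F u" by (simp add: Fsel)
      have "inj_on (\<lambda>j. f (Pt I j)) {0..<len I}"
        by (rule inj_onI) (use inj_onD[OF injf] I in fastforce)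
      moreover have "f (Pt I j) \<noteq> f (hh y)" if "j < len I" "y \<le> nR" for j y
      proof
        assume "f (Pt I j) = f (hh y)"
        then have "Pt I j = hh y" using inj_onD[OF injf, of "Pt I j" "hh y"] hV that I by simp
        then show False using I by (auto simp: hh_def split: if_splits)
      qed
      ultimately show "\<forall>u\<in>pU F. ?P \<noteq> [] \<and> distinct ?P \<and> set ?P \<inter> ?\<phi> ` pV F = {}"
        using lenI by (auto simp: Fsel distinct_map)
      show "\<forall>u\<in>pU F. \<forall>u'\<in>pU F. u \<noteq> u' \<longrightarrow> set ?P \<inter> set ?P = {}" by (simp add: Fsel)
      show "?W' = ?\<phi> ` pV F \<union> (\<Union>u\<in>pU F. set ?P)" by (auto simp: Fsel image_Un image_comp lessThan_atLeast0)
      show "\<forall>e\<in>pE F. ?\<phi> ` e \<in> ?EG'"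
      proof
        fix e assume "e \<in> pE F"
        then obtain y z where yz: "e = {y, z}" "y \<in> ?V" "z \<in> ?V" "A (hh y) (hh z)" using pE by blast
        then have "{f (hh y), f (hh z)} \<in> ?EG'" by (intro EGI) auto
        then show "?\<phi> ` e \<in> ?EG'" using yz by simp
      qed
      show "\<forall>u\<in>pU F. path_edges (?\<phi> (fst (pa I, pb I)) # ?P @ [?\<phi> (snd (pa I, pb I))]) \<subseteq> ?EG'"
      proof
        fix u
        have "{f (Rt (pa I)), f (Pt I 0)} \<in> ?EG'"
          by (rule EGI) (use rS ablt lenI A_start[OF I(1)] in auto)
        moreover have "{f (Pt I (len I - 1)), f (Rt (pb I))} \<in> ?EG'"
          by (rule EGI) (use rS ablt lenI A_sym[OF A_end[OF I(1)]] in auto)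
        moreover have "{f (Pt I j), f (Pt I (Suc j))} \<in> ?EG'" if "Suc j < len I" for j
          by (rule EGI) (use that A_path[of I j "Suc j"] I in auto)
        ultimately show "path_edges (?\<phi> (fst (pa I, pb I)) # ?P @ [?\<phi> (snd (pa I, pb I))]) \<subseteq> ?EG'"
          unfolding fst_conv snd_conv pe by blast
      qed
      show "\<forall>(v, u)\<in>pS F. \<exists>x\<in>set ?P. {?\<phi> v, x} \<in> ?EG'"
      proof (clarsimp simp only: Fsel)
        fix r :: nat assume r: "r < 3"
        obtain j where j: "j < len I" "A (Rt (lab I r)) (Pt I j)" using A_spoke[OF I(1) r] by blast
        have "{f (Rt (lab I r)), f (Pt I j)} \<in> ?EG'" by (rule EGI) (use j rS lablt[OF r] in auto)
        then show "\<exists>x\<in>set ?P. {?\<phi> (lab I r), x} \<in> ?EG'"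
          using j hroot[OF lablt(1)[OF r]] by (intro bexI[of _ "f (Pt I j)"]) auto
      qed
      show "\<forall>u u'. {u, u'} \<in> pR F \<longrightarrow> (\<exists>x\<in>set ?P. \<exists>y\<in>set ?P. {x, y} \<in> ?EG')" by (simp add: Fsel)
      show "\<forall>e\<in>?EG'. ?Q e"
      proof
        fix e assume e: "e \<in> ?EG'"
        then have "card e = 2" using emb_edges[OF emb] by auto
        then obtain a b where "e = {a, b}" by (auto simp: card_2_iff)
        then obtain u w where uw: "e = {f u, f w}" "u \<in> ?S" "w \<in> ?S" using e by auto
        then have "u \<in> VS len" "w \<in> VS len" using SV by blast+
        then have A: "A u w" "A w u" using emb_edge_iff[OF emb, of u w] e uw(1) A_sym by auto
        from uw(2,3) consider
          y z where "y \<in> ?V" "z \<in> ?V" "u = hh y" "w = hh z"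
        | y j where "y \<in> ?V" "j < len I" "u = hh y" "w = Pt I j"
        | y j where "y \<in> ?V" "j < len I" "w = hh y" "u = Pt I j"
        | j j' where "j < len I" "j' < len I" "u = Pt I j" "w = Pt I j'" by blast
        then show "?Q e"
        proof cases
          case 1
          then show ?thesis using Q1 A uw(1) by simp
        next
          case 2
          then show ?thesis using Q3[of y j] A uw(1) by simp
        next
          case 3
          then have "e = {f (hh y), f (Pt I j)}" using uw(1) by (simp add: insert_commute)
          then show ?thesis using Q3[of y j] A 3 by simp
        next
          case 4
          then show ?thesis using Q2 A uw(1) by simp
        qed
      qed
    qed
  qed
  then have "F \<notin> forbidden" using free unfolding pg_free_def by blast
  then obtain W1 EG1 where "good_graph W1 EG1" and c: "contains_pg W1 EG1 F"
    using wf unfolding forbidden_def by (auto simp: F_def)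
  then obtain f' len' A' T' st' val' v' where emb': "emb f' len' A' W1 EG1"
    and good: "good k m s0 h R len' A' T' st' val' v'" unfolding good_graph_def by blast
  interpret G: good k m s0 h R len' A' T' st' val' v' by (rule good)
  have injf': "inj_on f' (VS len')" and W1: "W1 = f' ` VS len'" using emb' by (auto simp: emb_def)
  obtain W2 where W2: "W2 \<subseteq> W1" "realization F W2 {e \<in> EG1. e \<subseteq> W2}"
    using c unfolding contains_pg_def by blast
  let ?E2 = "{e \<in> EG1. e \<subseteq> W2}"
  obtain \<phi> P en where \<phi>: "inj_on \<phi> (pV F)"
    and en0: "\<forall>u\<in>pU F. {fst (en u), snd (en u)} = ppi F u"
    and P0: "\<forall>u\<in>pU F. P u \<noteq> [] \<and> distinct (P u) \<and> set (P u) \<inter> \<phi> ` pV F = {}"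
    and W2eq: "W2 = \<phi> ` pV F \<union> (\<Union>u\<in>pU F. set (P u))"
    and e1: "\<forall>e\<in>pE F. \<phi> ` e \<in> ?E2"
    and e2: "\<forall>u\<in>pU F. path_edges (\<phi> (fst (en u)) # P u @ [\<phi> (snd (en u))]) \<subseteq> ?E2"
    and e30: "\<forall>e\<in>?E2. (\<exists>e'\<in>pE F. e = \<phi> ` e') \<or>
       (\<exists>u\<in>pU F. e \<in> path_edges (\<phi> (fst (en u)) # P u @ [\<phi> (snd (en u))])) \<or>
       (\<exists>(v, u)\<in>pS F. \<exists>x\<in>set (P u). e = {\<phi> v, x}) \<or>
       (\<exists>u u'. {u, u'} \<in> pR F \<and> (\<exists>x\<in>set (P u). \<exists>y\<in>set (P u'). e = {x, y}))"
    using W2(2) by (rule realizationE)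
  have e3: "\<forall>e\<in>?E2. (\<exists>e'\<in>pE F. e = \<phi> ` e') \<or>
           (e \<in> path_edges (\<phi> (fst (en ?u)) # P ?u @ [\<phi> (snd (en ?u))])) \<or>
           (\<exists>r<3. \<exists>x\<in>set (P ?u). e = {\<phi> (lab I r), x})"
  proof
    fix e assume "e \<in> ?E2"
    from e30[rule_format, OF this] show "(\<exists>e'\<in>pE F. e = \<phi> ` e') \<or>
           (e \<in> path_edges (\<phi> (fst (en ?u)) # P ?u @ [\<phi> (snd (en ?u))])) \<or>
           (\<exists>r<3. \<exists>x\<in>set (P ?u). e = {\<phi> (lab I r), x})"
    proof (elim disjE)
      assume "\<exists>(v, u)\<in>pS F. \<exists>x\<in>set (P u). e = {\<phi> v, x}"
      then have "\<exists>r<3. \<exists>x\<in>set (P ?u). e = {\<phi> (lab I r), x}" unfolding Fsel by fastforce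
      then show ?thesis by blast
    qed (simp_all add: Fsel)
  qed
  have en: "{fst (en ?u), snd (en ?u)} = {pa I, pb I}" using en0 by (simp add: Fsel)
  have P: "P ?u \<noteq> []" "set (P ?u) \<inter> \<phi> ` ?V = {}" using P0 by (simp_all add: Fsel)
  note \<phi> = \<phi>[unfolded Fsel]
  have W2eq: "W2 = \<phi> ` ?V \<union> set (P ?u)" using W2eq by (simp add: Fsel)
  have e2: "path_edges (\<phi> (fst (en ?u)) # P ?u @ [\<phi> (snd (en ?u))]) \<subseteq> ?E2" using e2 by (simp add: Fsel)
  obtain ps where ps: "P ?u = ps" by simp
  obtain ea eb where enu: "fst (en ?u) = ea" "snd (en ?u) = eb" by simp
  note P = P[unfolded ps] and W2eq = W2eq[unfolded ps] and e2 = e2[unfolded ps enu]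
    and e3 = e3[unfolded ps enu] and en = en[unfolded enu]
  have eab: "ea \<in> {pa I, pb I}" "eb \<in> {pa I, pb I}" using en by blast+
  define g where "g = the_inv_into (VS len') f'"
  have g: "f' (g x) = x" "g x \<in> VS len'" if "x \<in> W2" for x
  proof -
    have "x \<in> f' ` VS len'" using that W2(1) W1 by blast
    then show "f' (g x) = x" "g x \<in> VS len'"
      unfolding g_def using f_the_inv_into_f[OF injf'] the_inv_into_into[OF injf'] by auto
  qed
  have gedge: "A' (g x) (g y) \<longleftrightarrow> {x, y} \<in> ?E2" if "x \<in> W2" "y \<in> W2" for x y
    using G.emb_edge_iff[OF emb' g(2)[OF that(1)] g(2)[OF that(2)]] g(1) that by simp
  define \<psi> where "\<psi> = (\<lambda>y. g (\<phi> y))"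
  have \<phi>W: "\<phi> y \<in> W2" if "y \<in> ?V" for y using W2eq that by blast
  have psW: "x \<in> W2" if "x \<in> set ps" for x using W2eq that by blast
  have \<phi>ps: "\<phi> y \<notin> set ps" if "y \<in> ?V" for y using P(2) that by blast
  have \<psi>adj: "A' (\<psi> y) (\<psi> z) \<longleftrightarrow> A (hh y) (hh z)" if yz: "y \<in> ?V" "z \<in> ?V" for y z
  proof -
    have "{\<phi> y, \<phi> z} \<in> ?E2 \<longleftrightarrow> {y, z} \<in> pE F"
    proof
      assume "{y, z} \<in> pE F"
      then show "{\<phi> y, \<phi> z} \<in> ?E2" using e1 by fastforce
    next
      assume e: "{\<phi> y, \<phi> z} \<in> ?E2"
      have nps: "{\<phi> y, \<phi> z} \<inter> set ps = {}" using \<phi>ps yz by simp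
      have "\<exists>e'\<in>pE F. {\<phi> y, \<phi> z} = \<phi> ` e'"
        using e3[rule_format, OF e] nps path_edges_meet(1)[OF _ P(1), of "{\<phi> y, \<phi> z}" "\<phi> ea" "\<phi> eb"] by blast
      then obtain e' where e': "e' \<in> pE F" "\<phi> ` {y, z} = \<phi> ` e'" by auto
      have "e' \<subseteq> ?V" using pE[OF e'(1)] by blast
      then have "{y, z} = e'" using inj_on_image_eq_iff[OF \<phi>, of "{y, z}" e'] e'(2) yz by blast
      then show "{y, z} \<in> pE F" using e' by simp
    qed
    then show ?thesis using gedge[OF \<phi>W[OF yz(1)] \<phi>W[OF yz(2)]] edge[OF yz] by (simp add: \<psi>_def)
  qed
  have inj\<psi>: "inj_on \<psi> ?V"
  proof (rule inj_onI)
    fix y z assume yz: "y \<in> ?V" "z \<in> ?V" "\<psi> y = \<psi> z"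
    then have "f' (g (\<phi> y)) = f' (g (\<phi> z))" by (simp add: \<psi>_def)
    then have "\<phi> y = \<phi> z" using g(1) \<phi>W yz by simp
    then show "y = z" using inj_onD[OF \<phi>] yz by blast
  qed
  have inj\<psi>': "inj_on \<psi> {..<nR}" using inj\<psi> by (rule inj_on_subset) auto
  have VS': "\<psi> x \<in> VS len'" if "x \<in> ?V" for x using g(2)[OF \<phi>W[OF that]] by (simp add: \<psi>_def)
  have VS'': "\<psi> x \<in> VS len'" if "x < nR" for x using VS' that by simp
  have adj': "A' (\<psi> x) (\<psi> y) \<longleftrightarrow> radj x y" if "x < nR" "y < nR" for x y
    using \<psi>adj[of x y] A_root[OF that] hroot that by simp
  have r1: "\<psi> ` {..<nR} = Rt ` {..<nR}"
    by (rule G.rigidity(1)[OF inj\<psi>']) (use VS'' adj' in blast)+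
  have r2: "\<psi> x = Rt x" if "rigid_root x" for x
    by (rule G.rigidity(2)[OF inj\<psi>']) (use VS'' adj' that in blast)+
  have nonroot: "\<exists>i' j'. g x = Pt i' j' \<and> i' \<le> k \<and> j' < len' i'" if x: "x \<in> W2" "x \<notin> \<phi> ` {..<nR}" for x
  proof (cases "g x")
    case (Rt y)
    then have "g x \<in> Rt ` {..<nR}" using g(2)[OF x(1)] by simp
    then have "g x \<in> \<psi> ` {..<nR}" by (simp only: r1)
    then obtain y where y: "y < nR" "g x = g (\<phi> y)" by (auto simp: \<psi>_def)
    then have "f' (g x) = f' (g (\<phi> y))" by simp
    moreover have "\<phi> y \<in> W2" using \<phi>W y by simp
    ultimately have "x = \<phi> y" using g(1)[OF x(1)] g(1)[of "\<phi> y"] by metis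
    then show ?thesis using x(2) y by blast
  next
    case (Pt i' j')
    then show ?thesis using g(2)[OF x(1)] by simp
  qed
  \<comment> \<open>Used twice: to locate the copied urpath through its labels, and at the end to
    rule out an edge at \<open>nR\<close>.\<close>
  have spoke: "y \<in> {pa I, pb I} \<or> (\<exists>r<3. y = lab I r)"
    if y: "y \<in> ?V" and x: "x \<in> set ps" and e: "{\<phi> y, x} \<in> ?E2" for y x
  proof -
    consider e' where "e' \<in> pE F" "{\<phi> y, x} = \<phi> ` e'"
      | "{\<phi> y, x} \<in> path_edges (\<phi> ea # ps @ [\<phi> eb])"
      | r x' where "r < 3" "x' \<in> set ps" "{\<phi> y, x} = {\<phi> (lab I r), x'}"
      using e3[rule_format, OF e] by blast
    then show ?thesis
    proof cases
      case (1 e')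
      then have "x \<in> \<phi> ` ?V" using pE[OF 1(1)] by blast
      then show ?thesis using x P(2) by blast
    next
      case 2
      then have "\<phi> y \<in> insert (\<phi> ea) (insert (\<phi> eb) (set ps))"
        using path_edges_meet(2)[OF 2 P(1)] by blast
      then have "\<phi> y = \<phi> ea \<or> \<phi> y = \<phi> eb" using \<phi>ps[OF y] by blast
      moreover have "ea \<in> ?V" "eb \<in> ?V" using eab ablt by auto
      ultimately have "y = ea \<or> y = eb" using inj_onD[OF \<phi>] y by blast
      then show ?thesis using eab by blast
    next
      case (3 r x')
      then have "\<phi> y = \<phi> (lab I r)" using \<phi>ps[OF y] by (auto simp: doubleton_eq_iff)
      then have "y = lab I r" using inj_onD[OF \<phi>] y lablt(1)[OF 3(1)] by (simp add: less_imp_le)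
      then show ?thesis using 3 by blast
    qed
  qed
  \<comment> \<open>Each inner vertex of the copy carries a position label in the good graph; by
    \<open>spoke\<close> this is a label of line \<open>I\<close>, so the vertex lies on that
    line.\<close>
  have psI: "\<exists>j'<len' I. g x = Pt I j'" if x: "x \<in> set ps" for x
  proof -
    have "x \<notin> \<phi> ` {..<nR}" using x P(2) by auto
    then obtain i' j' where ij: "g x = Pt i' j'" "i' \<le> k" "j' < len' i'"
      using nonroot[OF psW[OF x]] by blast
    let ?y = "lab i' (j' mod 3)"
    have sp: "spk ?y i'" by (rule spk_lab) simp
    then have y: "?y < nD" "rigid_root ?y" using spk_less rigid_root_spk ij by auto
    then have yV: "?y \<in> ?V" using nD_nR by simp
    have "A' (\<psi> ?y) (g x)" using r2[OF y(2)] G.G_lab ij by simp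
    then have "{\<phi> ?y, x} \<in> ?E2" using gedge[OF \<phi>W[OF yV] psW[OF x]] by (simp add: \<psi>_def)
    then have "?y \<in> {pa I, pb I} \<or> (\<exists>r<3. ?y = lab I r)" using spoke yV x by blast
    then obtain r where "r < 3" "?y = lab I r" using y(1) pa_ge[of I] pb_ge[of I] by auto
    then have "i' = I" using lab_inj[of i' "j' mod 3" I r] by simp
    then show ?thesis using ij by auto
  qed
  define js where "js = map (\<lambda>x. case g x of Pt i' j' \<Rightarrow> j' | Rt _ \<Rightarrow> 0) ps"
  have js: "g (ps ! n) = Pt I (js ! n)" "js ! n < len' I" if "n < length ps" for n
    using psI[of "ps ! n"] that by (auto simp: js_def)
  have ljs: "length js = length ps" by (simp add: js_def)
  have jsne: "js \<noteq> []" using P(1) by (simp add: js_def)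
  have pe_nth: "{(\<phi> ea # ps @ [\<phi> eb]) ! n, (\<phi> ea # ps @ [\<phi> eb]) ! Suc n} \<in> ?E2" if "n \<le> length ps" for n
  proof -
    have "Suc n < length (\<phi> ea # ps @ [\<phi> eb])" using that by simp
    then have "{(\<phi> ea # ps @ [\<phi> eb]) ! n, (\<phi> ea # ps @ [\<phi> eb]) ! Suc n} \<in> path_edges (\<phi> ea # ps @ [\<phi> eb])"
      unfolding path_edges_def by blast
    then show ?thesis using e2 by (rule subsetD[rotated])
  qed
  have step: "js ! Suc n = Suc (js ! n) \<or> js ! n = Suc (js ! Suc n)" if n: "Suc n < length js" for n
  proof -
    have n': "n < length ps" "Suc n < length ps" using n ljs by auto
    have "{ps ! n, ps ! Suc n} \<in> ?E2" using pe_nth[of "Suc n"] n' by (simp add: nth_append)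
    then have "A' (g (ps ! n)) (g (ps ! Suc n))" using gedge psW n' by simp
    then show ?thesis using js[OF n'(1)] js[OF n'(2)] G.A_path[OF I(1)] by simp
  qed
  have hd: "A' (Rt ea) (Pt I (hd js))"
  proof -
    have eaV: "ea \<in> ?V" using eab ablt by auto
    have "rigid_root ea" using eab rigid_root_pa rigid_root_pb I by auto
    moreover have 0: "0 < length ps" using P(1) by simp
    then have "{\<phi> ea, ps ! 0} \<in> ?E2" using pe_nth[of 0] by (simp add: nth_append)
    then have "A' (\<psi> ea) (g (ps ! 0))" using gedge[OF \<phi>W[OF eaV] psW] 0 by (simp add: \<psi>_def)
    ultimately show ?thesis using r2 js[OF 0] jsne by (simp add: hd_conv_nth)
  qed
  have last: "A' (Rt eb) (Pt I (last js))"
  proof -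
    let ?n = "length ps - 1"
    have ebV: "eb \<in> ?V" using eab ablt by auto
    have "rigid_root eb" using eab rigid_root_pa rigid_root_pb I by auto
    moreover have 0: "?n < length ps" using P(1) by simp
    then have "{ps ! ?n, \<phi> eb} \<in> ?E2" using pe_nth[of "length ps"] P(1) by (simp add: nth_append nth_Cons')
    then have "{\<phi> eb, ps ! ?n} \<in> ?E2" by (simp add: insert_commute)
    then have "A' (\<psi> eb) (g (ps ! ?n))" using gedge[OF \<phi>W[OF ebV] psW] 0 by (simp add: \<psi>_def)
    ultimately show ?thesis using r2 js[OF 0] jsne ljs by (simp add: last_conv_nth)
  qed
  have hdl: "hd js < len' I" "last js < len' I"
  proof -
    have "j < len' I" if "j \<in> set js" for j
      using that js(2) unfolding in_set_conv_nth ljs by blast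
    then show "hd js < len' I" "last js < len' I" using jsne by simp_all
  qed
  have cover: "v \<in> set js" if "v < len' I" for v
  proof (rule unit_steps_cover[OF jsne step])
    \<comment> \<open>The pattern does not fix the direction in which the copy traverses the
      line.\<close>
    consider "ea = pa I" "eb = pb I" | "ea = pb I" "eb = pa I" using en by (auto simp: doubleton_eq_iff)
    then show "hd js \<le> v \<and> v \<le> last js \<or> last js \<le> v \<and> v \<le> hd js"
    proof cases
      case 1
      then have "hd js = 0" "Suc (last js) = len' I"
        using hd last G.start_iff[OF I(1) hdl(1)] G.end_iff[OF I(1) hdl(2)] by auto
      then show ?thesis using that by auto
    next
      case 2
      then have "last js = 0" "Suc (hd js) = len' I"
        using hd last G.start_iff[OF I(1) hdl(2)] G.end_iff[OF I(1) hdl(1)] by auto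
      then show ?thesis using that by auto
    qed
  qed
  have nRV: "nR \<in> ?V" by simp
  have "\<phi> nR \<notin> \<phi> ` {..<nR}" using inj_onD[OF \<phi>, of nR] by force
  then obtain i' t' where it: "\<psi> nR = Pt i' t'" "i' \<le> k" "t' < len' i'"
    using nonroot[OF \<phi>W[OF nRV]] by (auto simp: \<psi>_def)
  \<comment> \<open>The position label of \<open>t\<close>, known from \<open>index_label\<close>,
    identifies the copy of \<open>nR\<close> as a time.\<close>
  let ?y = "lab 0 (t mod 3)"
  have sp: "spk ?y 0" by (rule spk_lab) simp
  then have y: "?y < nD" "rigid_root ?y" using spk_less rigid_root_spk by auto
  have "A (Rt ?y) (Pt 0 t)" using index_label[of 0 t] t by simp
  then have "A' (\<psi> ?y) (\<psi> nR)" using \<psi>adj[of ?y nR] y(1) nD_nR hroot[of ?y] hnR by simp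
  then have "A' (Rt ?y) (Pt i' t')" using r2[OF y(2)] it by simp
  then have "spk ?y i'" using G.A_label[of ?y i' t'] y(1) it pa_ge[of i'] pb_ge[of i'] nD_nR by auto
  then have i0: "i' = 0" using spk_inj[OF sp] it by blast
  let ?v = "val' t' i"
  have v: "?v < len' I" using G.val_less[of t' i] it i0 i by (simp add: I_def)
  have "?v \<in> set js" using cover[OF v] .
  then obtain n where n: "n < length ps" "js ! n = ?v" using ljs by (metis in_set_conv_nth)
  have "A' (\<psi> nR) (g (ps ! n))" using js[OF n(1)] n(2) G.G_val[of t' i ?v] it i0 i v by (simp add: I_def)
  then have "{\<phi> nR, ps ! n} \<in> ?E2" using gedge[OF \<phi>W[OF nRV] psW] n(1) by (simp add: \<psi>_def)
  then have "nR \<in> {pa I, pb I} \<or> (\<exists>r<3. nR = lab I r)" using spoke[OF nRV nth_mem[OF n(1)]] by blast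
  then show False using ablt lablt(1) by fastforce
qed

end

text \<open>A copy preserves adjacency, which does not tell the two directions apart; preserved
  residues modulo 3 do.\<close>

lemma successor_index:
  fixes a b x y :: nat
  assumes "a mod 3 = x mod 3" "b mod 3 = y mod 3" and iff: "(b = Suc a \<or> a = Suc b) \<longleftrightarrow> (y = Suc x \<or> x = Suc y)"
  shows "b = Suc a \<longleftrightarrow> y = Suc x"
proof -
  have no: False if "c mod 3 = Suc d mod 3" "Suc c mod 3 = d mod 3" for c d :: nat
    using that by presburger
  show ?thesis
  proof
    assume b: "b = Suc a"
    then have "y = Suc x \<or> x = Suc y" using iff by simp
    then show "y = Suc x" using no[of a y] assms(1,2) b by auto
  next
    assume y: "y = Suc x"
    then have "b = Suc a \<or> a = Suc b" using iff by simp
    then show "b = Suc a" using no[of x b] assms(1,2) y by auto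
  qed
qed

section \<open>Reading the run off a free layout\<close>

context free_layout
begin

text \<open>At first a mere choice, nonempty by \<open>value_exists\<close>;
  \<open>value_unique\<close> later shows that there is only one candidate.\<close>

definition value_of :: "nat \<Rightarrow> nat \<Rightarrow> nat" where
  "value_of t i = (SOME j. j < len (Suc i) \<and> A (Pt 0 t) (Pt (Suc i) j))"

definition state_of :: "nat \<Rightarrow> nat" where
  "state_of t = (SOME s. s < m \<and> A (Rt (stl s)) (Pt 0 t))"

lemma value_of:
  assumes "t < len 0" "i < k"
  shows "value_of t i < len (Suc i)" "A (Pt 0 t) (Pt (Suc i) (value_of t i))"
  using someI_ex[OF value_exists[OF assms]] unfolding value_of_def by auto

text \<open>Collects the features that a window shares with its copy in a good graph: being an end,
  equality and succession of positions, values, states and the end of the run. Absolute positions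
  may differ, so only what a transition can see is compared.\<close>

definition similar :: "vert set \<Rightarrow> (nat \<Rightarrow> nat) \<Rightarrow> nat \<Rightarrow> (nat \<Rightarrow> nat) \<Rightarrow> (nat \<Rightarrow> nat \<Rightarrow> nat) \<Rightarrow>
    (nat \<Rightarrow> nat \<Rightarrow> nat) \<Rightarrow> bool" where
  "similar X len' T' st' val' p \<longleftrightarrow>
     (\<forall>i j. Pt i j \<in> X \<longrightarrow> p i j < len' i \<and> (p i j = 0 \<longleftrightarrow> j = 0) \<and> (Suc (p i j) = len' i \<longleftrightarrow> Suc j = len i)) \<and>
     (\<forall>i j j'. Pt i j \<in> X \<longrightarrow> Pt i j' \<in> X \<longrightarrow> (p i j' = p i j \<longleftrightarrow> j' = j) \<and> (p i j' = Suc (p i j) \<longleftrightarrow> j' = Suc j)) \<and>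
     (\<forall>t i j. Pt 0 t \<in> X \<longrightarrow> Pt (Suc i) j \<in> X \<longrightarrow> (A (Pt 0 t) (Pt (Suc i) j) \<longleftrightarrow> val' (p 0 t) i = p (Suc i) j)) \<and>
     (\<forall>t. Pt 0 t \<in> X \<longrightarrow> state_of t = st' (p 0 t) \<and> (A (Rt junk) (Pt 0 t) \<longleftrightarrow> T' < p 0 t)) \<and>
     (\<forall>t s. Pt 0 t \<in> X \<longrightarrow> s < m \<longrightarrow> (A (Rt (stl s)) (Pt 0 t) \<longleftrightarrow> s = state_of t))"

lemma similarD:
  assumes "similar X len' T' st' val' p"
  shows "\<And>i j. Pt i j \<in> X \<Longrightarrow> p i j < len' i \<and> (p i j = 0 \<longleftrightarrow> j = 0) \<and> (Suc (p i j) = len' i \<longleftrightarrow> Suc j = len i)"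
    "\<And>i j j'. Pt i j \<in> X \<Longrightarrow> Pt i j' \<in> X \<Longrightarrow> p i j' = p i j \<longleftrightarrow> j' = j"
    "\<And>i j j'. Pt i j \<in> X \<Longrightarrow> Pt i j' \<in> X \<Longrightarrow> p i j' = Suc (p i j) \<longleftrightarrow> j' = Suc j"
    "\<And>t i j. Pt 0 t \<in> X \<Longrightarrow> Pt (Suc i) j \<in> X \<Longrightarrow> A (Pt 0 t) (Pt (Suc i) j) \<longleftrightarrow> val' (p 0 t) i = p (Suc i) j"
    "\<And>t. Pt 0 t \<in> X \<Longrightarrow> state_of t = st' (p 0 t)"
    "\<And>t. Pt 0 t \<in> X \<Longrightarrow> A (Rt junk) (Pt 0 t) \<longleftrightarrow> T' < p 0 t"
    "\<And>t s. Pt 0 t \<in> X \<Longrightarrow> s < m \<Longrightarrow> A (Rt (stl s)) (Pt 0 t) \<longleftrightarrow> s = state_of t"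
  using assms unfolding similar_def by simp_all

lemma local_time:
  assumes X: "X \<subseteq> VS len" "X \<inter> range Rt = {}" "card X \<le> 2 * k + 3"
  obtains len' A' T' st' val' v' p where "good k m s0 h R len' A' T' st' val' v'"
    "similar X len' T' st' val' p"
proof -
  obtain len' A' T' st' val' v' p where good: "good k m s0 h R len' A' T' st' val' v'"
    and p: "\<And>i j. Pt i j \<in> X \<Longrightarrow> p i j < len' i"
    "\<And>i j j'. Pt i j \<in> X \<Longrightarrow> Pt i j' \<in> X \<Longrightarrow> p i j = p i j' \<Longrightarrow> j = j'"
    "\<And>i j i' j'. Pt i j \<in> X \<Longrightarrow> Pt i' j' \<in> X \<Longrightarrow> A (Pt i j) (Pt i' j') \<longleftrightarrow> A' (Pt i (p i j)) (Pt i' (p i' j'))"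
    "\<And>i j x. Pt i j \<in> X \<Longrightarrow> rigid_root x \<Longrightarrow> A (Rt x) (Pt i j) \<longleftrightarrow> A' (Rt x) (Pt i (p i j))"
    by (rule local_embedding[OF X]) blast
  interpret G: good k m s0 h R len' A' T' st' val' v' by (rule good)
  have ik: "i \<le> k" "j < len i" if "Pt i j \<in> X" for i j using that X(1) by auto
  have mod3: "p i j mod 3 = j mod 3" if ij: "Pt i j \<in> X" for i j
  proof -
    have r: "j mod 3 < 3" by simp
    have "A (Rt (lab i (j mod 3))) (Pt i j)" using index_label[OF ik[OF ij] r] by simp
    then have "A' (Rt (lab i (j mod 3))) (Pt i (p i j))"
      using p(4)[OF ij rigid_root_spk[OF spk_lab[OF r] ik(1)[OF ij]]] by simp
    then show ?thesis using G.G_lab[OF ik(1)[OF ij] p(1)[OF ij] r] by simp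
  qed
  have zero: "p i j = 0 \<longleftrightarrow> j = 0" if ij: "Pt i j \<in> X" for i j
    using p(4)[OF ij rigid_root_pa[OF ik(1)[OF ij]]] start_iff[OF ik[OF ij]] G.start_iff[OF ik(1)[OF ij] p(1)[OF ij]]
    by simp
  have last: "Suc (p i j) = len' i \<longleftrightarrow> Suc j = len i" if ij: "Pt i j \<in> X" for i j
    using p(4)[OF ij rigid_root_pb[OF ik(1)[OF ij]]] end_iff[OF ik[OF ij]] G.end_iff[OF ik(1)[OF ij] p(1)[OF ij]]
    by simp
  have eq: "p i j' = p i j \<longleftrightarrow> j' = j" if "Pt i j \<in> X" "Pt i j' \<in> X" for i j j'
    using p(2)[OF that] by auto
  have suc: "p i j' = Suc (p i j) \<longleftrightarrow> j' = Suc j" if ij: "Pt i j \<in> X" "Pt i j' \<in> X" for i j j'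
  proof -
    have "(p i j' = Suc (p i j) \<or> p i j = Suc (p i j')) \<longleftrightarrow> (j' = Suc j \<or> j = Suc j')"
      using p(3)[OF ij] A_path[OF ik[OF ij(1)] ik(2)[OF ij(2)]]
        G.A_path[OF ik(1)[OF ij(1)] p(1)[OF ij(1)] p(1)[OF ij(2)]] by simp
    then show ?thesis by (rule successor_index[OF mod3[OF ij(1)] mod3[OF ij(2)]])
  qed
  have vals: "A (Pt 0 t) (Pt (Suc i) j) \<longleftrightarrow> val' (p 0 t) i = p (Suc i) j"
    if tj: "Pt 0 t \<in> X" "Pt (Suc i) j \<in> X" for t i j
    using p(3)[OF tj] G.G_val[OF p(1)[OF tj(1)] _ p(1)[OF tj(2)]] ik(1)[OF tj(2)] by simp
  have lab: "A (Rt (stl s)) (Pt 0 t) \<longleftrightarrow> st' (p 0 t) = s" if "Pt 0 t \<in> X" "s < m" for t s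
    using p(4)[OF that(1) rigid_root_spk[OF spk_stl[OF that(2)]]] G.G_st[OF p(1)[OF that(1)] that(2)] by simp
  have state: "state_of t = st' (p 0 t)" if t: "Pt 0 t \<in> X" for t
    unfolding state_of_def
  proof (rule some_equality)
    show "st' (p 0 t) < m \<and> A (Rt (stl (st' (p 0 t)))) (Pt 0 t)"
      using lab[OF t] G.st_less[OF p(1)[OF t]] by simp
  qed (use lab[OF t] in auto)
  have junk': "A (Rt junk) (Pt 0 t) \<longleftrightarrow> T' < p 0 t" if t: "Pt 0 t \<in> X" for t
    using p(4)[OF t rigid_root_spk[OF spk_junk]] G.G_junk[OF p(1)[OF t]] by simp
  have lab': "A (Rt (stl s)) (Pt 0 t) \<longleftrightarrow> s = state_of t" if "Pt 0 t \<in> X" "s < m" for t s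
    using lab[OF that] state[OF that(1)] by auto
  have "similar X len' T' st' val' p"
    unfolding similar_def
    by (intro conjI allI impI) (simp_all only: p(1) zero last eq suc vals state junk' lab')
  then show thesis by (rule that[OF good])
qed

text \<open>The time and the two candidate values form a window, and in a good graph a time has one
  value per counter, never the last vertex of the line.\<close>

lemma value_unique:
  assumes t: "t < len 0" and i: "i < k" and j: "j < len (Suc i)"
  shows "A (Pt 0 t) (Pt (Suc i) j) \<longleftrightarrow> j = value_of t i" "Suc (value_of t i) < len (Suc i)"
proof -
  note v = value_of[OF t i]
  let ?X = "{Pt 0 t, Pt (Suc i) j, Pt (Suc i) (value_of t i)}"
  have X: "?X \<subseteq> VS len" "?X \<inter> range Rt = {}" using t i j v by auto
  have c: "card ?X \<le> 2 * k + 3" using card_insert_le_m1[of 3] by (simp add: card_insert_if)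
  obtain len' A' T' st' val' v' p where good: "good k m s0 h R len' A' T' st' val' v'"
    and sim: "similar ?X len' T' st' val' p"
    by (rule local_time[OF X c])
  note p = similarD[OF sim]
  interpret G: good k m s0 h R len' A' T' st' val' v' by (rule good)
  have mem: "Pt 0 t \<in> ?X" "Pt (Suc i) j \<in> ?X" "Pt (Suc i) (value_of t i) \<in> ?X" by auto
  have e: "val' (p 0 t) i = p (Suc i) (value_of t i)" using p(4)[OF mem(1,3)] v by simp
  show "A (Pt 0 t) (Pt (Suc i) j) \<longleftrightarrow> j = value_of t i"
    using p(4)[OF mem(1,2)] p(2)[OF mem(3,2)] e by auto
  have "Suc (val' (p 0 t) i) < len' (Suc i)" using G.val_less p(1)[OF mem(1)] i by blast
  then have "Suc (value_of t i) \<noteq> len (Suc i)" using e p(1)[OF mem(3)] by simp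
  then show "Suc (value_of t i) < len (Suc i)" using v by simp
qed

lemma state_label:
  assumes t: "t < len 0" and s: "s < m"
  shows "A (Rt (stl s)) (Pt 0 t) \<longleftrightarrow> s = state_of t"
proof -
  let ?X = "{Pt 0 t}"
  have X: "?X \<subseteq> VS len" "?X \<inter> range Rt = {}" "card ?X \<le> 2 * k + 3" using t by auto
  obtain len' A' T' st' val' v' p where "good k m s0 h R len' A' T' st' val' v'"
    and sim: "similar ?X len' T' st' val' p"
    by (rule local_time[OF X])
  show ?thesis using similarD(7)[OF sim _ s] by simp
qed

text \<open>Time 0 and the value 0 are recognised by the start roots of their lines, so their copies
  are at 0 and inherit the initial configuration. Counter 0 is excepted because the good graph may
  belong to another input.\<close>

lemma initial_time:
  shows "state_of 0 = s0" "\<not> A (Rt junk) (Pt 0 0)" "Suc 0 < len 0" "\<And>i. 0 < i \<Longrightarrow> i < k \<Longrightarrow> value_of 0 i = 0"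
proof -
  have l: "0 < len 0" using len_pos by simp
  have main: "state_of 0 = s0 \<and> \<not> A (Rt junk) (Pt 0 0) \<and> Suc 0 < len 0 \<and> (0 < i \<longrightarrow> value_of 0 i = 0)" if i: "i < k" for i
  proof -
    note v = value_of[OF l i]
    let ?X = "{Pt 0 0, Pt (Suc i) (value_of 0 i)}"
    have X: "?X \<subseteq> VS len" "?X \<inter> range Rt = {}" "card ?X \<le> 2 * k + 3" using l i v by auto
    obtain len' A' T' st' val' v' p where good: "good k m s0 h R len' A' T' st' val' v'"
      and sim: "similar ?X len' T' st' val' p"
    by (rule local_time[OF X])
  note p = similarD[OF sim]
    interpret G: good k m s0 h R len' A' T' st' val' v' by (rule good)
    have mem: "Pt 0 0 \<in> ?X" "Pt (Suc i) (value_of 0 i) \<in> ?X" by auto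
    have p0: "p 0 0 = 0" using p(1)[OF mem(1)] by simp
    have "state_of 0 = s0" using p(5)[OF mem(1)] p0 G.run by (simp add: is_run_def)
    moreover have "\<not> A (Rt junk) (Pt 0 0)" using p(6)[OF mem(1)] p0 by simp
    moreover have "Suc 0 < len 0" using p(1)[OF mem(1)] p0 G.T_len l by auto
    moreover have "value_of 0 i = 0" if "0 < i"
    proof -
      have "val' 0 i = p (Suc i) (value_of 0 i)" using p(4)[OF mem] v p0 by simp
      moreover have "val' 0 i = 0" using G.run i that by (simp add: is_run_def)
      ultimately show ?thesis using p(1)[OF mem(2)] by simp
    qed
    ultimately show ?thesis by blast
  qed
  show "state_of 0 = s0" "\<not> A (Rt junk) (Pt 0 0)" "Suc 0 < len 0" using main[OF k_pos] by blast+
  show "\<And>i. 0 < i \<Longrightarrow> i < k \<Longrightarrow> value_of 0 i = 0" using main by blast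
qed

text \<open>Two times with all their values, at most \<open>2 * k + 2\<close> vertices, form the
  largest window used. Its copy shows a step of some run, or its end, and the step transfers by
  \<open>R_cong\<close>, because zero tests and differences are visible in the window.\<close>

lemma consecutive_times:
  assumes t: "Suc t < len 0" and nj: "\<not> A (Rt junk) (Pt 0 t)"
  shows "A (Rt junk) (Pt 0 (Suc t)) \<Longrightarrow> state_of t = h"
    and "\<not> A (Rt junk) (Pt 0 (Suc t)) \<Longrightarrow> R (state_of t) (state_of (Suc t)) (\<lambda>i. value_of t i = 0)
      (\<lambda>i. int (value_of (Suc t) i) - int (value_of t i))"
proof -
  have t0: "t < len 0" using t by simp
  let ?V = "(\<lambda>i. Pt (Suc i) (value_of t i)) ` {..<k} \<union> (\<lambda>i. Pt (Suc i) (value_of (Suc t) i)) ` {..<k}"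
  let ?X = "insert (Pt 0 t) (insert (Pt 0 (Suc t)) ?V)"
  have X: "?X \<subseteq> VS len" "?X \<inter> range Rt = {}" using t t0 value_of[OF t0] value_of[OF t] by auto
  have "card ?V \<le> card {..<k} + card {..<k}"
    by (intro order_trans[OF card_Un_le] add_mono card_image_le) auto
  then have "card ?X \<le> 2 * k + 3"
    using card_insert_le_m1[of "2 * k + 2" "insert (Pt 0 (Suc t)) ?V"] by (simp add: card_insert_if)
  note X = X this
  obtain len' A' T' st' val' v' p where good: "good k m s0 h R len' A' T' st' val' v'"
    and sim: "similar ?X len' T' st' val' p"
    by (rule local_time[OF X])
  note p = similarD[OF sim]
  interpret G: good k m s0 h R len' A' T' st' val' v' by (rule good)
  have mem: "Pt 0 t \<in> ?X" "Pt 0 (Suc t) \<in> ?X" by auto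
  have memv: "Pt (Suc i) (value_of t i) \<in> ?X" "Pt (Suc i) (value_of (Suc t) i) \<in> ?X" if "i < k" for i
    using that by auto
  have ps: "p 0 (Suc t) = Suc (p 0 t)" using p(3)[OF mem] by simp
  have le: "p 0 t \<le> T'" using nj p(6)[OF mem(1)] by simp
  show "state_of t = h" if "A (Rt junk) (Pt 0 (Suc t))"
  proof -
    have "p 0 t = T'" using that p(6)[OF mem(2)] ps le by simp
    then show ?thesis using p(5)[OF mem(1)] G.run by (simp add: is_run_def)
  qed
  show "R (state_of t) (state_of (Suc t)) (\<lambda>i. value_of t i = 0)
      (\<lambda>i. int (value_of (Suc t) i) - int (value_of t i))" if "\<not> A (Rt junk) (Pt 0 (Suc t))"
  proof -
    have "p 0 t < T'" using that p(6)[OF mem(2)] ps by simp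
    then have step: "R (st' (p 0 t)) (st' (p 0 (Suc t))) (\<lambda>i. val' (p 0 t) i = 0)
        (\<lambda>i. int (val' (p 0 (Suc t)) i) - int (val' (p 0 t) i))"
      using G.run ps by (simp add: is_run_def)
    have va: "val' (p 0 t) i = p (Suc i) (value_of t i)" "val' (p 0 (Suc t)) i = p (Suc i) (value_of (Suc t) i)"
      if i: "i < k" for i
      using p(4)[OF mem(1) memv(1)[OF i]] p(4)[OF mem(2) memv(2)[OF i]] value_of(2)[OF t0 i] value_of(2)[OF t i] by auto
    have "R (st' (p 0 t)) (st' (p 0 (Suc t))) (\<lambda>i. value_of t i = 0)
      (\<lambda>i. int (value_of (Suc t) i) - int (value_of t i))"
    proof (rule R_cong[OF step])
      fix i assume i: "i < k"
      show "(value_of t i = 0) = (val' (p 0 t) i = 0)" using va(1)[OF i] p(1)[OF memv(1)[OF i]] by simp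
      \<comment> \<open>Only equality and succession of positions carry over from the copy, so a
        difference can be transferred because \<open>R_delta\<close> restricts it to at most
        one.\<close>
      have "int (val' (p 0 (Suc t)) i) - int (val' (p 0 t) i) \<in> {-1, 0, 1}" using R_delta[OF step i] .
      then consider "val' (p 0 (Suc t)) i = val' (p 0 t) i" | "val' (p 0 (Suc t)) i = Suc (val' (p 0 t) i)"
        | "val' (p 0 t) i = Suc (val' (p 0 (Suc t)) i)" by fastforce
      then show "int (value_of (Suc t) i) - int (value_of t i) = int (val' (p 0 (Suc t)) i) - int (val' (p 0 t) i)"
      proof cases
        case 1
        then have "value_of (Suc t) i = value_of t i" using va[OF i] p(2)[OF memv[OF i]] by simp
        then show ?thesis using 1 by simp
      next
        case 2
        then have "value_of (Suc t) i = Suc (value_of t i)" using va[OF i] p(3)[OF memv[OF i]] by simp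
        then show ?thesis using 2 by simp
      next
        case 3
        then have "value_of t i = Suc (value_of (Suc t) i)" using va[OF i] p(3)[OF memv(2)[OF i] memv(1)[OF i]] by simp
        then show ?thesis using 3 by simp
      qed
    qed
    then show ?thesis using p(5)[OF mem(1)] p(5)[OF mem(2)] by simp
  qed
qed

text \<open>The last time is recognised by \<open>pb 0\<close>, and in a good graph the last time
  comes after halting.\<close>

lemma final_time: "A (Rt junk) (Pt 0 (len 0 - 1))"
proof -
  let ?t = "len 0 - 1"
  have l: "0 < len 0" using len_pos by simp
  let ?X = "{Pt 0 ?t}"
  have X: "?X \<subseteq> VS len" "?X \<inter> range Rt = {}" "card ?X \<le> 2 * k + 3" using l by auto
  obtain len' A' T' st' val' v' p where good: "good k m s0 h R len' A' T' st' val' v'"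
    and sim: "similar ?X len' T' st' val' p"
    by (rule local_time[OF X])
  note p = similarD[OF sim]
  interpret G: good k m s0 h R len' A' T' st' val' v' by (rule good)
  have mem: "Pt 0 ?t \<in> ?X" by simp
  have "Suc (p 0 ?t) = len' 0" using p(1)[OF mem] l by simp
  then show ?thesis using p(6)[OF mem] G.T_len by simp
qed

text \<open>The halting time is the one before the first time joined to \<open>junk\<close>. Such a
  time exists by \<open>final_time\<close>, and it is not time 0 by \<open>initial_time\<close>; all
  earlier steps obey \<open>R\<close>.\<close>

theorem accepts_value: "accepts (value_of 0 0)"
proof -
  define J where "J = (LEAST t. A (Rt junk) (Pt 0 t))"
  have J: "A (Rt junk) (Pt 0 J)" unfolding J_def by (rule LeastI[of "\<lambda>t. A (Rt junk) (Pt 0 t)", OF final_time])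
  have notJ: "\<not> A (Rt junk) (Pt 0 t)" if "t < J" for t using not_less_Least[of t] that unfolding J_def by blast
  have Jl: "J < len 0" using Least_le[of "\<lambda>t. A (Rt junk) (Pt 0 t)", OF final_time] len_pos[of 0] unfolding J_def by simp
  obtain T where T: "J = Suc T" using J initial_time(2) by (cases J) auto
  have "is_run T state_of value_of (value_of 0 0)"
    unfolding is_run_def
  proof (intro conjI allI impI)
    show "state_of 0 = s0" by (rule initial_time)
    show "state_of T = h" using consecutive_times(1)[of T] J notJ[of T] Jl T by simp
    show "value_of 0 i = (if i = 0 then value_of 0 0 else 0)" if "i < k" for i
      using initial_time(4)[of i] that by auto
    show "R (state_of t) (state_of (Suc t)) (\<lambda>i. value_of t i = 0)
      (\<lambda>i. int (value_of (Suc t) i) - int (value_of t i))" if "t < T" for t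
      using consecutive_times(2)[of t] notJ[of t] notJ[of "Suc t"] that T Jl by simp
  qed
  then show ?thesis unfolding accepts_def by blast
qed

end

subsection \<open>The pathographs of the reduction\<close>

context machine
begin

text \<open>The vertex \<open>tz\<close> is the initial time, \<open>qv j\<close> the value \<open>j\<close> of counter \<open>0\<close>; both are the explicitly
  given initial segments of the corresponding paths.\<close>

definition tz :: nat where "tz = nR + k + 1"
definition qv :: "nat \<Rightarrow> nat" where "qv j = tz + 1 + j"
definition vset :: "nat \<Rightarrow> nat set" where "vset n = {x. x < nR \<or> tz \<le> x \<and> x \<le> qv n}"

text \<open>The term \<open>y - tz - 1\<close> recovers \<open>j\<close> from
  \<open>y = qv j\<close>. With \<open>b\<close> the initial value is the last explicit one; without
  \<open>b\<close> the initial time is joined to no explicit value, so that its value must lie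
  beyond \<open>n\<close>.\<close>

definition dirE :: "nat \<Rightarrow> bool \<Rightarrow> nat \<Rightarrow> nat \<Rightarrow> bool" where
  "dirE n b x y \<longleftrightarrow> x < nR \<and> y < nR \<and> radj x y \<or>
     y = tz \<and> (x = pa 0 \<or> x = lab 0 0 \<or> x = stl s0) \<or>
     tz < y \<and> (x = lab 1 ((y - tz - 1) mod 3) \<or> x = pa 1 \<and> y = tz + 1 \<or> tz < x \<and> y = Suc x) \<or>
     b \<and> x = tz \<and> y = tz + 1 + n"

definition pgE :: "nat \<Rightarrow> bool \<Rightarrow> nat set set" where
  "pgE n b = {{x, y} | x y. x \<in> vset n \<and> y \<in> vset n \<and> dirE n b x y}"

definition path_start :: "nat \<Rightarrow> nat \<Rightarrow> nat" where
  "path_start n i = (if i = 0 then tz else if i = 1 then qv n else pa i)"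

text \<open>Urpath \<open>nR + i\<close> continues path \<open>i\<close> behind its explicit
  segment. For \<open>b\<close> the spoke from \<open>tz\<close> to urpath \<open>nR + 1\<close> is
  absent, so \<open>qv n\<close> is the only possible initial value; otherwise this spoke leaves the
  initial value open. The remaining edges between times and values are licensed by the other spokes
  of explicit vertices and by the rungs.\<close>

definition Hpg :: "nat \<Rightarrow> bool \<Rightarrow> pathograph" where
  "Hpg n b = \<lparr>pV = vset n, pU = {u. nR \<le> u \<and> u \<le> nR + k}, pE = pgE n b,
     pS = {(x, u). nR \<le> u \<and> u \<le> nR + k \<and> (x < nR \<and> spk x (u - nR) \<or>
       x = tz \<and> nR + 1 \<le> u \<and> (u = nR + 1 \<longrightarrow> \<not> b) \<or> tz < x \<and> x \<le> qv n \<and> u = nR)},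
     pR = {{nR, u} | u. nR + 1 \<le> u \<and> u \<le> nR + k},
     ppi = (\<lambda>u. {path_start n (u - nR), pb (u - nR)})\<rparr>"

text \<open>The explicit part alone, as a pattern to be forbidden: it says that counter 0 starts
  with \<open>n\<close> or, for \<open>b\<close> false, with none of the values up to
  \<open>n\<close>.\<close>

definition Dpg :: "nat \<Rightarrow> bool \<Rightarrow> pathograph" where
  "Dpg n b = \<lparr>pV = vset n, pU = {}, pE = pgE n b, pS = {}, pR = {}, ppi = (\<lambda>_. {})\<rparr>"

definition vert_of :: "nat \<Rightarrow> vert" where
  "vert_of x = (if x < nR then Rt x else if x = tz then Pt 0 0 else Pt 1 (x - tz - 1))"

text \<open>The number of explicit vertices of path \<open>i\<close>, and hence the position of the
  first inner vertex of its urpath.\<close>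

definition offset :: "nat \<Rightarrow> nat \<Rightarrow> nat" where
  "offset n i = (if i = 0 then 1 else if i = 1 then Suc n else 0)"

lemma Hpg_simps [simp]:
  "pV (Hpg n b) = vset n" "pU (Hpg n b) = {u. nR \<le> u \<and> u \<le> nR + k}" "pE (Hpg n b) = pgE n b"
  "pS (Hpg n b) = {(x, u). nR \<le> u \<and> u \<le> nR + k \<and> (x < nR \<and> spk x (u - nR) \<or>
       x = tz \<and> nR + 1 \<le> u \<and> (u = nR + 1 \<longrightarrow> \<not> b) \<or> tz < x \<and> x \<le> qv n \<and> u = nR)}"
  "pR (Hpg n b) = {{nR, u} | u. nR + 1 \<le> u \<and> u \<le> nR + k}"
  "ppi (Hpg n b) u = {path_start n (u - nR), pb (u - nR)}"
  by (simp_all add: Hpg_def)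

lemma Dpg_simps [simp]: "pV (Dpg n b) = vset n" "pU (Dpg n b) = {}" "pE (Dpg n b) = pgE n b"
  by (simp_all add: Dpg_def)

lemma tz_gt: "nR < tz" "x < nR \<Longrightarrow> x < tz" "x < nR \<Longrightarrow> x \<noteq> tz"
  by (auto simp: tz_def)

lemma vset_cases [consumes 1, case_names root time val]:
  assumes "x \<in> vset n"
  obtains "x < nR" | "x = tz" | j where "j \<le> n" "x = qv j"
proof -
  consider "x < nR" | "x = tz" | "tz < x" "x \<le> qv n"
    using assms unfolding vset_def mem_Collect_eq by linarith
  then show thesis
  proof cases
    case 3
    then show ?thesis using that(3)[of "x - tz - 1"] by (auto simp: qv_def)
  qed (use that in auto)
qed

lemma vset_mem: "x < nR \<Longrightarrow> x \<in> vset n" "tz \<in> vset n" "j \<le> n \<Longrightarrow> qv j \<in> vset n"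
  by (auto simp: vset_def qv_def)

lemma vert_of_simps: "x < nR \<Longrightarrow> vert_of x = Rt x" "vert_of tz = Pt 0 0" "vert_of (qv j) = Pt 1 j"
  using tz_gt by (auto simp: vert_of_def qv_def)

lemma explicit_roots: "lab 0 0 < nR \<and> lab 1 (j mod 3) < nR \<and> stl s0 < nR \<and> pa 0 < nR \<and> pa 1 < nR"
proof -
  have "spk (lab 0 0) 0" "spk (lab 1 (j mod 3)) 1" by (simp_all add: spk_lab)
  then show ?thesis
    using spk_less[of _ 0] spk_less[of _ 1] spk_stl[OF s0_less] k_pos nD_nR(1) pa_less[of 0] pa_less[of 1] by fastforce
qed

lemma dirE_simps:
  "x < nR \<Longrightarrow> y < nR \<Longrightarrow> dirE n b x y \<longleftrightarrow> radj x y"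
  "x < nR \<Longrightarrow> dirE n b x tz \<longleftrightarrow> x = pa 0 \<or> x = lab 0 0 \<or> x = stl s0"
  "x < nR \<Longrightarrow> \<not> dirE n b tz x"
  "x < nR \<Longrightarrow> dirE n b x (qv j) \<longleftrightarrow> x = lab 1 (j mod 3) \<or> x = pa 1 \<and> j = 0"
  "x < nR \<Longrightarrow> \<not> dirE n b (qv j) x"
  "\<not> dirE n b tz tz"
  "dirE n b tz (qv j) \<longleftrightarrow> b \<and> j = n"
  "\<not> dirE n b (qv j) tz"
  "dirE n b (qv j) (qv j') \<longleftrightarrow> j' = Suc j"
  using explicit_roots[of j] explicit_roots[of j'] tz_gt(1) unfolding dirE_def qv_def by auto

lemma path_start_vset: "i \<le> k \<Longrightarrow> path_start n i \<in> vset n"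
  using pa_less[of i] by (auto simp: path_start_def vset_mem)

lemma path_start_ne: "i \<le> k \<Longrightarrow> path_start n i \<noteq> pb i"
  using pb_less[of i] tz_gt by (auto simp: path_start_def qv_def pa_def pb_def)

lemma pgE_iff: "x \<in> vset n \<Longrightarrow> y \<in> vset n \<Longrightarrow> {x, y} \<in> pgE n b \<longleftrightarrow> dirE n b x y \<or> dirE n b y x"
  by (auto simp: pgE_def doubleton_eq_iff)

lemma dirE_irrefl: "x \<in> vset n \<Longrightarrow> \<not> dirE n b x x"
  by (cases rule: vset_cases, assumption) (auto simp: dirE_simps radj_def)

lemma pgE_subset: "pgE n b \<subseteq> {e. e \<subseteq> vset n \<and> card e = 2}"
proof
  fix e assume "e \<in> pgE n b"
  then obtain x y where e: "e = {x, y}" "x \<in> vset n" "y \<in> vset n" "dirE n b x y" by (auto simp: pgE_def)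
  then have "x \<noteq> y" using dirE_irrefl by auto
  then show "e \<in> {e. e \<subseteq> vset n \<and> card e = 2}" using e by auto
qed

lemma finite_vset: "finite (vset n)"
  by (rule finite_subset[of _ "{..qv n}"]) (auto simp: vset_def qv_def tz_def)

lemma wf_Dpg: "wf_pathograph (Dpg n b)"
  using pgE_subset[of n b] finite_vset[of n] by (simp add: wf_pathograph_def Dpg_def)

lemma wf_Hpg: "wf_pathograph (Hpg n b)"
  unfolding wf_pathograph_def
proof (intro conjI ballI)
  show "pE (Hpg n b) \<subseteq> {e. e \<subseteq> pV (Hpg n b) \<and> card e = 2}" using pgE_subset by simp
  show "pV (Hpg n b) \<inter> pU (Hpg n b) = {}" by (auto simp: vset_def tz_def)
  show "pS (Hpg n b) \<subseteq> pV (Hpg n b) \<times> pU (Hpg n b)" by (auto simp: vset_def qv_def)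
  show "pR (Hpg n b) \<subseteq> {r. r \<subseteq> pU (Hpg n b) \<and> card r = 2}" by auto
  show "finite (pV (Hpg n b))" "finite (pU (Hpg n b))" using finite_vset by simp_all
  fix u assume "u \<in> pU (Hpg n b)"
  then have i: "u - nR \<le> k" by auto
  have pb: "pb (u - nR) \<in> vset n" using pb_less[OF i] by (rule vset_mem)
  show "ppi (Hpg n b) u \<subseteq> pV (Hpg n b)" using path_start_vset[OF i] pb by simp
  show "card (ppi (Hpg n b) u) = 2" using path_start_ne[OF i] by simp
  let ?i = "u - nR"
  \<comment> \<open>Ends of an urpath must not be adjacent. The roots \<open>pb\<close> are
    independent and are joined to no explicit path vertex.\<close>
  have "\<not> dirE n b (path_start n ?i) (pb ?i)" "\<not> dirE n b (pb ?i) (path_start n ?i)"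
  proof -
    have ne: "pb ?i \<noteq> pa j" "pb ?i \<noteq> lab 0 0" "pb ?i \<noteq> lab 1 (n mod 3)" "pb ?i \<noteq> stl s0" for j
      using pb_ge[of ?i] spk_less[OF spk_lab[of 0 0]] spk_less[OF spk_lab[of "n mod 3" 1]]
        spk_less[OF spk_stl[OF s0_less]] k_pos by (auto simp: pa_def pb_def, presburger)
    have "\<not> radj (pa ?i) (pb ?i)" "\<not> radj (pb ?i) (pa ?i)"
      using pa_ge[of ?i] pb_ge[of ?i] by (auto simp: radj_def)
    then show "\<not> dirE n b (path_start n ?i) (pb ?i)" "\<not> dirE n b (pb ?i) (path_start n ?i)"
      using ne pb_less[OF i] pa_less[OF i] by (auto simp: path_start_def dirE_simps)
  qed
  then show "ppi (Hpg n b) u \<notin> pE (Hpg n b)"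
    using pgE_iff[OF path_start_vset[OF i] pb] by simp
qed

end

context layout
begin

text \<open>The assumptions are the facts on labels and values that a layout leaves open. They hold
  for prolonged runs as well as in free layouts, so the lemma serves both directions of the
  reduction.\<close>

lemma explicit_adj:
  assumes l0: "Suc 0 < len 0" and l1: "Suc n < len 1"
    and a1: "\<And>r. r < 3 \<Longrightarrow> A (Rt (lab 0 r)) (Pt 0 0) \<longleftrightarrow> r = 0"
    and a2: "\<And>s. s < m \<Longrightarrow> A (Rt (stl s)) (Pt 0 0) \<longleftrightarrow> s = s0"
    and a3: "\<not> A (Rt junk) (Pt 0 0)"
    and a4: "\<And>j r. j \<le> n \<Longrightarrow> r < 3 \<Longrightarrow> A (Rt (lab 1 r)) (Pt 1 j) \<longleftrightarrow> r = j mod 3"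
    and a5: "\<And>j. j \<le> n \<Longrightarrow> A (Pt 0 0) (Pt 1 j) \<longleftrightarrow> b \<and> j = n"
    and xy: "x \<in> vset n" "y \<in> vset n"
  shows "A (vert_of x) (vert_of y) \<longleftrightarrow> dirE n b x y \<or> dirE n b y x"
proof -
  have sym: "A u w \<longleftrightarrow> A w u" for u w using A_sym by blast
  have k1: "1 \<le> k" using k_pos by simp
  have RP0: "A (Rt x) (Pt 0 0) \<longleftrightarrow> x = pa 0 \<or> x = lab 0 0 \<or> x = stl s0" if x: "x < nR" for x
  proof
    assume A: "A (Rt x) (Pt 0 0)"
    then consider "x = pa 0" | "x = pb 0" "Suc 0 = len 0" | "spk x 0" using A_label[OF x] l0 by fastforce
    then show "x = pa 0 \<or> x = lab 0 0 \<or> x = stl s0"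
    proof cases
      case 3
      then show ?thesis using a1 a2 a3 A by (auto simp: spk_def)
    qed (use l0 in auto)
  next
    assume "x = pa 0 \<or> x = lab 0 0 \<or> x = stl s0"
    then show "A (Rt x) (Pt 0 0)" using A_start[of 0] a1[of 0] a2[OF s0_less] by auto
  qed
  have RP1: "A (Rt x) (Pt 1 j) \<longleftrightarrow> x = lab 1 (j mod 3) \<or> x = pa 1 \<and> j = 0" if x: "x < nR" and j: "j \<le> n" for x j
  proof
    have jl: "j < len 1" using j l1 by simp
    assume A: "A (Rt x) (Pt 1 j)"
    then consider "x = pa 1" "j = 0" | "x = pb 1" "Suc j = len 1" | "spk x 1" using A_label[OF x k1 jl] by blast
    then show "x = lab 1 (j mod 3) \<or> x = pa 1 \<and> j = 0"
    proof cases
      case 3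
      then show ?thesis using a4[OF j] A by (auto simp: spk_def)
    qed (use l1 j in auto)
  next
    assume "x = lab 1 (j mod 3) \<or> x = pa 1 \<and> j = 0"
    then show "A (Rt x) (Pt 1 j)" using A_start[OF k1] a4[OF j, of "j mod 3"] by auto
  qed
  have PP: "A (Pt 1 j) (Pt 1 j') \<longleftrightarrow> j' = Suc j \<or> j = Suc j'" if "j \<le> n" "j' \<le> n" for j j'
    using A_path[OF k1, of j j'] that l1 by simp
  show ?thesis
    using xy(1)
  proof (cases rule: vset_cases)
    case root
    note x = this
    show ?thesis using xy(2)
    proof (cases rule: vset_cases)
      case root
      then show ?thesis using x A_root[OF x root] radj_sym[of x y] by (simp add: vert_of_simps dirE_simps)
    next
      case time
      then show ?thesis using x RP0[OF x] by (simp add: vert_of_simps dirE_simps)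
    next
      case (val j)
      then show ?thesis using x RP1[OF x] by (simp add: vert_of_simps dirE_simps)
    qed
  next
    case time
    note x = this
    show ?thesis using xy(2)
    proof (cases rule: vset_cases)
      case root
      then show ?thesis using x RP0[OF root] sym[of "Pt 0 0"] by (simp add: vert_of_simps dirE_simps)
    next
      case time
      then show ?thesis using x A_irrefl by (simp add: vert_of_simps dirE_simps)
    next
      case (val j)
      then show ?thesis using x a5 by (simp add: vert_of_simps dirE_simps)
    qed
  next
    case (val j0)
    note x = this
    show ?thesis using xy(2)
    proof (cases rule: vset_cases)
      case root
      then show ?thesis using x RP1[OF root x(1)] sym[of "Pt 1 j0"] by (simp add: vert_of_simps dirE_simps)
    next
      case time
      then show ?thesis using x a5[OF x(1)] sym[of "Pt 1 j0"] by (simp add: vert_of_simps dirE_simps)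
    next
      case (val j)
      then show ?thesis using x PP by (simp add: vert_of_simps dirE_simps)
    qed
  qed
qed

end

context machine
begin

lemma vert_of_VS:
  assumes "0 < len 0" "n < len 1" "x \<in> vset n"
  shows "vert_of x \<in> VS len"
  using assms(3) by (cases rule: vset_cases) (use assms k_pos in \<open>auto simp: vert_of_simps\<close>)

lemma inj_on_vert_of: "inj_on vert_of (vset n)"
proof (rule inj_onI)
  fix x y assume x: "x \<in> vset n" and y: "y \<in> vset n" and eq: "vert_of x = vert_of y"
  show "x = y" using x
  proof (cases rule: vset_cases)
    case root
    from y show ?thesis using eq root by (cases rule: vset_cases) (auto simp: vert_of_simps)
  next
    case time
    from y show ?thesis using eq time by (cases rule: vset_cases) (auto simp: vert_of_simps)
  next
    case (val j)
    from y show ?thesis using eq val by (cases rule: vset_cases) (auto simp: vert_of_simps)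
  qed
qed

lemma vert_of_internal: "x \<in> vset n \<Longrightarrow> offset n i \<le> j \<Longrightarrow> vert_of x \<noteq> Pt i j"
  by (cases rule: vset_cases, assumption) (auto simp: vert_of_simps offset_def split: if_splits)

lemma VS_cases [consumes 1, case_names explicit internal]:
  assumes "u \<in> VS len"
  obtains x where "x \<in> vset n" "u = vert_of x"
  | i j where "i \<le> k" "offset n i \<le> j" "j < len i" "u = Pt i j"
proof (cases u)
  case (Rt x)
  then show ?thesis using that(1)[of x] assms by (simp add: vset_mem vert_of_simps)
next
  case (Pt i j)
  show ?thesis
  proof (cases "offset n i \<le> j")
    case True
    then show ?thesis using that(2)[of i j] assms Pt by simp
  next
    case False
    then consider "i = 0" "j = 0" | "i = 1" "j \<le> n" by (auto simp: offset_def split: if_splits)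
    then show ?thesis using that(1)[of tz] that(1)[of "qv j"] Pt by cases (auto simp: vset_mem vert_of_simps)
  qed
qed

end

context layout
begin

text \<open>The assumptions \<open>sp\<close>, \<open>t0\<close>, \<open>q\<close> and
  \<open>rung\<close> provide the edges that spokes and rungs demand, \<open>adj\<close> those among
  explicit vertices, and \<open>t1\<close> excludes the edges for which \<open>b\<close> provides no
  spoke.\<close>

lemma realizes_Hpg:
  assumes emb: "emb f len A W EG"
    and adj: "\<And>x y. x \<in> vset n \<Longrightarrow> y \<in> vset n \<Longrightarrow> A (vert_of x) (vert_of y) \<longleftrightarrow> dirE n b x y \<or> dirE n b y x"
    and off: "\<And>i. i \<le> k \<Longrightarrow> offset n i < len i"
    and sp: "\<And>x i. i \<le> k \<Longrightarrow> spk x i \<Longrightarrow> \<exists>j. offset n i \<le> j \<and> j < len i \<and> A (Rt x) (Pt i j)"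
    and t0: "\<And>i. 1 \<le> i \<Longrightarrow> i \<le> k \<Longrightarrow> (i = 1 \<longrightarrow> \<not> b) \<Longrightarrow> \<exists>j. offset n i \<le> j \<and> j < len i \<and> A (Pt 0 0) (Pt i j)"
    and t1: "\<And>j. b \<Longrightarrow> n < j \<Longrightarrow> j < len 1 \<Longrightarrow> \<not> A (Pt 0 0) (Pt 1 j)"
    and q: "\<And>j. j \<le> n \<Longrightarrow> \<exists>t. 1 \<le> t \<and> t < len 0 \<and> A (Pt 0 t) (Pt 1 j)"
    and rung: "\<And>i. 1 \<le> i \<Longrightarrow> i \<le> k \<Longrightarrow> \<exists>t j. 1 \<le> t \<and> t < len 0 \<and> offset n i \<le> j \<and> j < len i \<and> A (Pt 0 t) (Pt i j)"
  shows "realization (Hpg n b) W EG"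
proof -
  have k1: "1 \<le> k" using k_pos by simp
  have injf: "inj_on f (VS len)" and W: "W = f ` VS len" using emb by (auto simp: emb_def)
  have l0: "1 < len 0" and l1: "Suc n < len 1" using off[of 0] off[OF k1] by (auto simp: offset_def)
  have V: "vert_of x \<in> VS len" if "x \<in> vset n" for x using vert_of_VS[OF _ _ that] l0 l1 by simp
  let ?\<phi> = "f \<circ> vert_of"
  define P where "P = (\<lambda>u. map (\<lambda>j. f (Pt (u - nR) j)) [offset n (u - nR)..<len (u - nR)])"
  define en where "en = (\<lambda>u. (path_start n (u - nR), pb (u - nR)))"
  have Pr: "f (Pt i j) \<in> set (P (nR + i))" if "offset n i \<le> j" "j < len i" for i j
    using that by (auto simp: P_def)
  have setP: "set (P u) = (\<lambda>j. f (Pt (u - nR) j)) ` {offset n (u - nR)..<len (u - nR)}" for u by (simp add: P_def)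
  have edge: "{f u, f w} \<in> EG" if "u \<in> VS len" "w \<in> VS len" "A u w" for u w
    using emb_edge_iff[OF emb that(1,2)] that(3) by simp
  have start: "A (vert_of (path_start n i)) (Pt i (offset n i))" if i: "i \<le> k" for i
  proof -
    consider "i = 0" | "i = 1" | "2 \<le> i" by linarith
    then show ?thesis
    proof cases
      case 1
      then show ?thesis using A_path[of 0 0 1] l0 by (simp add: path_start_def offset_def vert_of_simps)
    next
      case 2
      then show ?thesis using A_path[OF k1, of n "Suc n"] l1 by (simp add: path_start_def offset_def vert_of_simps)
    next
      case 3
      then show ?thesis using A_start[OF i] pa_less[OF i] by (simp add: path_start_def offset_def vert_of_simps)
    qed
  qed
  have pbv: "vert_of (pb i) = Rt (pb i)" if "i \<le> k" for i using pb_less[OF that] by (simp add: vert_of_simps)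
  have pe: "path_edges (?\<phi> (path_start n i) # P (nR + i) @ [?\<phi> (pb i)]) =
     insert {f (vert_of (path_start n i)), f (Pt i (offset n i))} (insert {f (Pt i (len i - 1)), f (Rt (pb i))}
       {{f (Pt i j), f (Pt i (Suc j))} | j. offset n i \<le> j \<and> Suc j < len i})" if "i \<le> k" for i
    using path_edges_urpath[OF off[OF that], of "?\<phi> (path_start n i)" "\<lambda>j. f (Pt i j)" "?\<phi> (pb i)"] pbv[OF that]
    by (simp add: P_def)
  let ?H = "Hpg n b"
  \<comment> \<open>The licences for an edge in a realization. The facts \<open>Q1\<close>,
    \<open>Q2\<close> and \<open>Q3\<close> treat edges with two, one and no explicit end.\<close>
  let ?Q = "\<lambda>e. (\<exists>e'\<in>pE ?H. e = ?\<phi> ` e') \<or>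
           (\<exists>u\<in>pU ?H. e \<in> path_edges (?\<phi> (fst (en u)) # P u @ [?\<phi> (snd (en u))])) \<or>
           (\<exists>(v, u)\<in>pS ?H. \<exists>x\<in>set (P u). e = {?\<phi> v, x}) \<or>
           (\<exists>u u'. {u, u'} \<in> pR ?H \<and> (\<exists>x\<in>set (P u). \<exists>y\<in>set (P u'). e = {x, y}))"
  have Qpath: "?Q e" if "i \<le> k" "e \<in> path_edges (?\<phi> (path_start n i) # P (nR + i) @ [?\<phi> (pb i)])" for e i
  proof -
    have "\<exists>u\<in>pU ?H. e \<in> path_edges (?\<phi> (fst (en u)) # P u @ [?\<phi> (snd (en u))])"
      by (rule bexI[of _ "nR + i"]) (use that in \<open>auto simp: en_def\<close>)
    then show ?thesis by blast
  qed
  have Qspoke: "?Q {f (vert_of x), f (Pt i j)}"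
    if "(x, nR + i) \<in> pS ?H" "offset n i \<le> j" "j < len i" for x i j
  proof -
    have "\<exists>(v, u)\<in>pS ?H. \<exists>y\<in>set (P u). {f (vert_of x), f (Pt i j)} = {?\<phi> v, y}"
      by (rule bexI[OF _ that(1)]) (use Pr[OF that(2,3)] in auto)
    then show ?thesis by blast
  qed
  have Q1: "?Q {f (vert_of x), f (vert_of y)}" if "x \<in> vset n" "y \<in> vset n" "A (vert_of x) (vert_of y)" for x y
  proof -
    have "{x, y} \<in> pE ?H" using pgE_iff[OF that(1,2), of b] adj[OF that(1,2)] that(3) by simp
    then have "\<exists>e'\<in>pE ?H. {f (vert_of x), f (vert_of y)} = ?\<phi> ` e'" by (rule bexI[rotated]) simp
    then show ?thesis by blast
  qed
  have Q2: "?Q {f (vert_of x), f (Pt i j)}"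
    if x: "x \<in> vset n" and i: "i \<le> k" and j: "offset n i \<le> j" "j < len i" and A: "A (vert_of x) (Pt i j)" for x i j
    using x
  proof (cases rule: vset_cases)
    case root
    then have "A (Rt x) (Pt i j)" using A by (simp add: vert_of_simps)
    then consider "x = pa i" "j = 0" | "x = pb i" "Suc j = len i" | "spk x i"
      using A_label[OF root i j(2)] by blast
    then show ?thesis
    proof cases
      case 1
      then have "path_start n i = x" "offset n i = j" using j by (auto simp: path_start_def offset_def split: if_splits)
      then have "{f (vert_of x), f (Pt i j)} \<in> path_edges (?\<phi> (path_start n i) # P (nR + i) @ [?\<phi> (pb i)])"
        unfolding pe[OF i] by simp
      then show ?thesis by (rule Qpath[OF i])
    next
      case 2
      then have "len i - 1 = j" by simp
      then have "{f (vert_of x), f (Pt i j)} \<in> path_edges (?\<phi> (path_start n i) # P (nR + i) @ [?\<phi> (pb i)])"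
        unfolding pe[OF i] using 2 pbv[OF i] by (simp add: insert_commute)
      then show ?thesis by (rule Qpath[OF i])
    next
      case 3
      then have "(x, nR + i) \<in> pS ?H" using root i by simp
      then show ?thesis using j by (rule Qspoke)
    qed
  next
    case time
    then have A0: "A (Pt 0 0) (Pt i j)" using A by (simp add: vert_of_simps)
    show ?thesis
    proof (cases "i = 0")
      case True
      then have "j = 1" using A_path[of 0 0 j] A0 j l0 by simp
      then have "{f (vert_of x), f (Pt i j)} \<in> path_edges (?\<phi> (path_start n i) # P (nR + i) @ [?\<phi> (pb i)])"
        unfolding pe[OF i] using True time by (simp add: path_start_def offset_def)
      then show ?thesis by (rule Qpath[OF i])
    next
      case False
      have "\<not> b" if "i = 1" using t1[of j] A0 j that by (auto simp: offset_def)
      then have "(x, nR + i) \<in> pS ?H" using time i False by auto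
      then show ?thesis using j by (rule Qspoke)
    qed
  next
    case (val j0)
    then have A0: "A (Pt 1 j0) (Pt i j)" using A by (simp add: vert_of_simps)
    consider "i = 0" | "i = 1" | "2 \<le> i" by linarith
    then show ?thesis
    proof cases
      case 1
      then have "(x, nR + i) \<in> pS ?H" using val by (auto simp: qv_def)
      then show ?thesis using j by (rule Qspoke)
    next
      case 2
      then have "j = Suc j0" "j0 = n" using A_path[OF k1, of j0 j] A0 j val l1 by (auto simp: offset_def)
      then have "{f (vert_of x), f (Pt i j)} \<in> path_edges (?\<phi> (path_start n i) # P (nR + i) @ [?\<phi> (pb i)])"
        unfolding pe[OF i] using 2 val by (simp add: path_start_def offset_def)
      then show ?thesis by (rule Qpath[OF i])
    next
      case 3
      then show ?thesis using A_values[of 1 i j0 j] A0 i j val l1 k1 by simp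
    qed
  qed
  have Q3: "?Q {f (Pt i j), f (Pt i' j')}"
    if i: "i \<le> k" "offset n i \<le> j" "j < len i" and i': "i' \<le> k" "offset n i' \<le> j'" "j' < len i'"
      and A: "A (Pt i j) (Pt i' j')" for i j i' j'
  proof (cases "i = i'")
    case True
    then have "j' = Suc j \<or> j = Suc j'" using A_path[OF i(1,3), of j'] i' A by simp
    then have "{f (Pt i j), f (Pt i' j')} \<in> path_edges (?\<phi> (path_start n i) # P (nR + i) @ [?\<phi> (pb i)])"
      unfolding pe[OF i(1)] using True i i' by auto
    then show ?thesis by (rule Qpath[OF i(1)])
  next
    case False
    then have or: "i = 0 \<or> i' = 0" using A_values[of i i' j j'] i i' A by auto
    have "{nR + i, nR + i'} \<in> pR ?H"
    proof (cases "i = 0")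
      case True
      then show ?thesis using False i' by (auto intro!: exI[of _ "nR + i'"])
    next
      case False
      then have "i' = 0" using or by simp
      then have "{nR + i, nR + i'} = {nR, nR + i}" by auto
      then show ?thesis using False i by (auto intro!: exI[of _ "nR + i"])
    qed
    then have "\<exists>u u'. {u, u'} \<in> pR ?H \<and> (\<exists>x\<in>set (P u). \<exists>y\<in>set (P u'). {f (Pt i j), f (Pt i' j')} = {x, y})"
      using Pr[OF i(2,3)] Pr[OF i'(2,3)] by blast
    then show ?thesis by blast
  qed
  show ?thesis
    unfolding realization_def
  proof (intro conjI exI[of _ ?\<phi>] exI[of _ P] exI[of _ en])
    show "finite W" unfolding W using finite_VS by blast
    show "EG \<subseteq> {e. e \<subseteq> W \<and> card e = 2}" by (rule emb_edges[OF emb])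
    show "inj_on ?\<phi> (pV ?H)"
      using comp_inj_on[OF inj_on_vert_of inj_on_subset[OF injf]] V by (simp add: image_subset_iff)
    show "\<forall>u\<in>pU ?H. {fst (en u), snd (en u)} = ppi ?H u" by (simp add: en_def)
    show "\<forall>u\<in>pU ?H. P u \<noteq> [] \<and> distinct (P u) \<and> set (P u) \<inter> ?\<phi> ` pV ?H = {}"
    proof (intro ballI conjI)
      fix u assume "u \<in> pU ?H"
      then have i: "u - nR \<le> k" by auto
      show "P u \<noteq> []" using off[OF i] by (simp add: P_def)
      have "inj_on (\<lambda>j. f (Pt (u - nR) j)) {offset n (u - nR)..<len (u - nR)}"
      proof (rule inj_onI)
        fix j j' assume "j \<in> {offset n (u - nR)..<len (u - nR)}" "j' \<in> {offset n (u - nR)..<len (u - nR)}"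
          "f (Pt (u - nR) j) = f (Pt (u - nR) j')"
        then show "j = j'" using inj_onD[OF injf, of "Pt (u - nR) j" "Pt (u - nR) j'"] i by simp
      qed
      then show "distinct (P u)" by (simp add: P_def distinct_map)
      show "set (P u) \<inter> ?\<phi> ` pV ?H = {}"
      proof (rule ccontr)
        assume "set (P u) \<inter> ?\<phi> ` pV ?H \<noteq> {}"
        then obtain j x where "offset n (u - nR) \<le> j" "j < len (u - nR)" "x \<in> vset n" "f (Pt (u - nR) j) = f (vert_of x)"
          unfolding setP by auto
        then show False using inj_onD[OF injf, of "Pt (u - nR) j" "vert_of x"] V i vert_of_internal[of x n "u - nR" j] by simp
      qed
    qed
    show "\<forall>u\<in>pU ?H. \<forall>u'\<in>pU ?H. u \<noteq> u' \<longrightarrow> set (P u) \<inter> set (P u') = {}"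
    proof (intro ballI impI, rule ccontr)
      fix u u' assume u: "u \<in> pU ?H" "u' \<in> pU ?H" "u \<noteq> u'" and ne: "set (P u) \<inter> set (P u') \<noteq> {}"
      then obtain j j' where "j < len (u - nR)" "j' < len (u' - nR)" "f (Pt (u - nR) j) = f (Pt (u' - nR) j')"
        unfolding setP by auto
      moreover have "u - nR \<le> k" "u' - nR \<le> k" "u - nR \<noteq> u' - nR" using u by auto
      ultimately show False using inj_onD[OF injf, of "Pt (u - nR) j" "Pt (u' - nR) j'"] by simp
    qed
    show "W = ?\<phi> ` pV ?H \<union> (\<Union>u\<in>pU ?H. set (P u))"
    proof (intro set_eqI iffI)
      fix w assume "w \<in> W"
      then obtain u where u: "u \<in> VS len" "w = f u" unfolding W by auto
      from u(1) show "w \<in> ?\<phi> ` pV ?H \<union> (\<Union>u\<in>pU ?H. set (P u))"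
      proof (cases rule: VS_cases[where n = n])
        case (explicit x)
        then show ?thesis using u by auto
      next
        case (internal i j)
        then show ?thesis using u Pr[of i j] by (intro UnI2 UN_I[of "nR + i"]) auto
      qed
    next
      fix w assume "w \<in> ?\<phi> ` pV ?H \<union> (\<Union>u\<in>pU ?H. set (P u))"
      then show "w \<in> W"
      proof
        assume "w \<in> ?\<phi> ` pV ?H"
        then show ?thesis unfolding W using V by auto
      next
        assume "w \<in> (\<Union>u\<in>pU ?H. set (P u))"
        then obtain u j where "nR \<le> u" "u \<le> nR + k" "j < len (u - nR)" "w = f (Pt (u - nR) j)"
          unfolding setP by auto
        then show ?thesis unfolding W by (intro image_eqI[of _ _ "Pt (u - nR) j"]) auto
      qed
    qed
    show "\<forall>e\<in>pE ?H. ?\<phi> ` e \<in> EG"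
    proof
      fix e assume "e \<in> pE ?H"
      then obtain x y where e: "e = {x, y}" "x \<in> vset n" "y \<in> vset n" "dirE n b x y" by (auto simp: pgE_def)
      then have "{f (vert_of x), f (vert_of y)} \<in> EG" using adj by (intro edge V) auto
      then show "?\<phi> ` e \<in> EG" using e by simp
    qed
    show "\<forall>u\<in>pU ?H. path_edges (?\<phi> (fst (en u)) # P u @ [?\<phi> (snd (en u))]) \<subseteq> EG"
    proof
      fix u assume "u \<in> pU ?H"
      then have u: "nR \<le> u" "u \<le> nR + k" by simp_all
      define i where "i = u - nR"
      have i: "i \<le> k" "u = nR + i" using u by (auto simp: i_def)
      have "{f (vert_of (path_start n i)), f (Pt i (offset n i))} \<in> EG"
        using off[OF i(1)] i start V path_start_vset by (intro edge) auto
      moreover have "{f (Pt i (len i - 1)), f (Rt (pb i))} \<in> EG"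
        using off[OF i(1)] i A_sym[OF A_end[OF i(1)]] pb_less by (intro edge) auto
      moreover have "{f (Pt i j), f (Pt i (Suc j))} \<in> EG" if "Suc j < len i" for j
        using that i A_path[OF i(1), of j "Suc j"] by (intro edge) auto
      ultimately show "path_edges (?\<phi> (fst (en u)) # P u @ [?\<phi> (snd (en u))]) \<subseteq> EG"
        using pe[OF i(1)] i by (auto simp: en_def)
    qed
    show "\<forall>(v, u)\<in>pS ?H. \<exists>x\<in>set (P u). {?\<phi> v, x} \<in> EG"
    proof (intro ballI, clarify)
      fix x u assume xu: "(x, u) \<in> pS ?H"
      define i where "i = u - nR"
      have i: "i \<le> k" "u = nR + i" using xu by (auto simp: i_def)
      have "\<exists>j. x \<in> vset n \<and> offset n i \<le> j \<and> j < len i \<and> A (vert_of x) (Pt i j)"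
      proof -
        consider "x < nR" "spk x i" | "x = tz" "1 \<le> i" "i = 1 \<longrightarrow> \<not> b" | j where "j \<le> n" "x = qv j" "i = 0"
        proof -
          have "x < nR \<and> spk x i \<or> x = tz \<and> 1 \<le> i \<and> (i = 1 \<longrightarrow> \<not> b) \<or> tz < x \<and> x \<le> qv n \<and> i = 0"
            using xu i by auto
          moreover have "\<exists>j\<le>n. x = qv j" if "tz < x" "x \<le> qv n"
            using that by (intro exI[of _ "x - tz - 1"]) (auto simp: qv_def)
          ultimately show thesis using that by blast
        qed
        then show ?thesis
        proof cases
          case 1
          then show ?thesis using sp[OF i(1) 1(2)] by (auto simp: vset_mem vert_of_simps)
        next
          case 2
          then show ?thesis using t0[OF 2(2) i(1) 2(3)] by (auto simp: vset_mem vert_of_simps)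
        next
          case (3 j)
          then obtain t where "1 \<le> t" "t < len 0" "A (Pt 0 t) (Pt 1 j)" using q by blast
          then show ?thesis using 3 A_sym[of "Pt 0 t" "Pt 1 j"]
            by (intro exI[of _ t]) (auto simp: vset_mem vert_of_simps offset_def)
        qed
      qed
      then obtain j where j: "x \<in> vset n" "offset n i \<le> j" "j < len i" "A (vert_of x) (Pt i j)" by blast
      then have "{f (vert_of x), f (Pt i j)} \<in> EG" using i V by (intro edge) auto
      then show "\<exists>y\<in>set (P u). {?\<phi> x, y} \<in> EG" using Pr[OF j(2,3)] i by (intro bexI[of _ "f (Pt i j)"]) auto
    qed
    show "\<forall>u u'. {u, u'} \<in> pR ?H \<longrightarrow> (\<exists>x\<in>set (P u). \<exists>y\<in>set (P u'). {x, y} \<in> EG)"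
    proof (intro allI impI)
      fix u u' assume "{u, u'} \<in> pR ?H"
      then obtain w where w: "{u, u'} = {nR, w}" "nR + 1 \<le> w" "w \<le> nR + k" by auto
      define i where "i = w - nR"
      have i: "1 \<le> i" "i \<le> k" "w = nR + i" using w by (auto simp: i_def)
      obtain t j where tj: "1 \<le> t" "t < len 0" "offset n i \<le> j" "j < len i" "A (Pt 0 t) (Pt i j)"
        using rung[OF i(1,2)] by blast
      then have e: "{f (Pt 0 t), f (Pt i j)} \<in> EG" using i by (intro edge) auto
      have m1: "f (Pt 0 t) \<in> set (P nR)" using Pr[of 0 t] tj by (simp add: offset_def)
      have m2: "f (Pt i j) \<in> set (P w)" using Pr[OF tj(3,4)] i by simp
      have "u = nR \<and> u' = w \<or> u = w \<and> u' = nR" using w(1) by (simp add: doubleton_eq_iff)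
      then show "\<exists>x\<in>set (P u). \<exists>y\<in>set (P u'). {x, y} \<in> EG"
      proof
        assume "u = nR \<and> u' = w"
        then show ?thesis using e m1 m2 by blast
      next
        assume "u = w \<and> u' = nR"
        moreover have "{f (Pt i j), f (Pt 0 t)} \<in> EG" using e by (simp add: insert_commute)
        ultimately show ?thesis using m1 m2 by blast
      qed
    qed
    show "\<forall>e\<in>EG. ?Q e"
    proof
      fix e assume e: "e \<in> EG"
      then obtain u w where uw: "e = {f u, f w}" "u \<in> VS len" "w \<in> VS len" "A u w"
        using emb unfolding emb_def by blast
      have A': "A w u" using A_sym[OF uw(4)] .
      from uw(2) show "?Q e"
      proof (cases rule: VS_cases[where n = n])
        case (explicit x)
        note x = this
        from uw(3) show ?thesis
        proof (cases rule: VS_cases[where n = n])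
          case (explicit y)
          then show ?thesis using Q1[OF x(1) explicit(1)] uw x by simp
        next
          case (internal i j)
          then show ?thesis using Q2[OF x(1) internal(1-3)] uw x by simp
        qed
      next
        case (internal i j)
        note x = this
        from uw(3) show ?thesis
        proof (cases rule: VS_cases[where n = n])
          case (explicit y)
          have "e = {f (vert_of y), f (Pt i j)}" using uw x explicit by (simp add: insert_commute)
          then show ?thesis using Q2[OF explicit(1) x(1-3)] A' x explicit by simp
        next
          case (internal i' j')
          then show ?thesis using Q3[OF x(1-3) internal(1-3)] uw x by simp
        qed
      qed
    qed
  qed
qed

end

section \<open>From realizations to layouts\<close>

lemma path_edges_rev: "path_edges (rev xs) = path_edges xs"
proof -
  have sub: "path_edges (rev ys) \<subseteq> path_edges ys" for ys :: "'a list"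
  proof
    fix e assume "e \<in> path_edges (rev ys)"
    then obtain i where i: "e = {rev ys ! i, rev ys ! Suc i}" "Suc i < length ys" by (auto simp: path_edges_def)
    define j where "j = length ys - Suc (Suc i)"
    have "rev ys ! i = ys ! Suc j" "rev ys ! Suc i = ys ! j" "Suc j < length ys"
      using i(2) by (auto simp: rev_nth j_def Suc_diff_Suc)
    then have "e = {ys ! j, ys ! Suc j}" "Suc j < length ys" using i by (auto simp: insert_commute)
    then show "e \<in> path_edges ys" unfolding path_edges_def by blast
  qed
  show ?thesis using sub[of xs] sub[of "rev xs"] by simp
qed

context machine
begin

lemma vert_of_eq:
  assumes "x \<in> vset n"
  shows "vert_of x = Rt y \<longleftrightarrow> x = y \<and> y < nR"
    "vert_of x = Pt i j \<longleftrightarrow> x = tz \<and> i = 0 \<and> j = 0 \<or> x = qv j \<and> i = 1 \<and> j \<le> n"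
proof -
  have *: "qv j \<noteq> tz" "tz \<noteq> qv j" "\<not> tz < nR" "\<not> qv j < nR" for j using tz_gt by (auto simp: qv_def)
  have **: "qv j = qv j' \<longleftrightarrow> j = j'" for j j' by (auto simp: qv_def)
  from assms show "vert_of x = Rt y \<longleftrightarrow> x = y \<and> y < nR"
    by (cases rule: vset_cases) (use * in \<open>auto simp: vert_of_simps\<close>)
  from assms show "vert_of x = Pt i j \<longleftrightarrow> x = tz \<and> i = 0 \<and> j = 0 \<or> x = qv j \<and> i = 1 \<and> j \<le> n"
    by (cases rule: vset_cases) (use * ** in \<open>auto simp: vert_of_simps\<close>)
qed

text \<open>Bounds the edges of a realization of \<open>Hpg n b\<close> once its explicit vertices and urpaths are merged into
  the paths of a layout.\<close>

definition conn :: "nat \<Rightarrow> bool \<Rightarrow> (nat \<Rightarrow> nat) \<Rightarrow> vert \<Rightarrow> vert \<Rightarrow> bool" where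
  "conn n b len u w \<longleftrightarrow>
     (\<exists>x\<in>vset n. \<exists>y\<in>vset n. dirE n b x y \<and> u = vert_of x \<and> w = vert_of y) \<or>
     (\<exists>i\<le>k. u = vert_of (path_start n i) \<and> w = Pt i (offset n i)) \<or>
     (\<exists>i\<le>k. u = Rt (pb i) \<and> w = Pt i (len i - 1)) \<or>
     (\<exists>i\<le>k. \<exists>j. offset n i \<le> j \<and> Suc j < len i \<and> u = Pt i j \<and> w = Pt i (Suc j)) \<or>
     (\<exists>x i j. x \<in> vset n \<and> (x, nR + i) \<in> pS (Hpg n b) \<and> offset n i \<le> j \<and> j < len i \<and> u = vert_of x \<and> w = Pt i j) \<or>
     (\<exists>i t j. 1 \<le> i \<and> i \<le> k \<and> 1 \<le> t \<and> t < len 0 \<and> offset n i \<le> j \<and> j < len i \<and> u = Pt 0 t \<and> w = Pt i j)"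

lemma conn_cases [consumes 1, case_names explicit first last mid spoke rung]:
  assumes "conn n b len u w"
  obtains x y where "x \<in> vset n" "y \<in> vset n" "dirE n b x y" "u = vert_of x" "w = vert_of y"
  | i where "i \<le> k" "u = vert_of (path_start n i)" "w = Pt i (offset n i)"
  | i where "i \<le> k" "u = Rt (pb i)" "w = Pt i (len i - 1)"
  | i j where "i \<le> k" "offset n i \<le> j" "Suc j < len i" "u = Pt i j" "w = Pt i (Suc j)"
  | x i j where "x \<in> vset n" "(x, nR + i) \<in> pS (Hpg n b)" "offset n i \<le> j" "j < len i" "u = vert_of x" "w = Pt i j"
  | i t j where "1 \<le> i" "i \<le> k" "1 \<le> t" "t < len 0" "offset n i \<le> j" "j < len i" "u = Pt 0 t" "w = Pt i j"
  using assms unfolding conn_def by (elim disjE bexE exE conjE) (rule that; assumption)+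

lemma conn_root:
  assumes "conn n b len (Rt x) (Rt y)" shows "radj x y"
  using assms
proof (cases rule: conn_cases)
  case (explicit x' y')
  then have "x' = x" "y' = y" "x < nR" "y < nR" using vert_of_eq(1) by metis+
  then show ?thesis using explicit by (simp add: dirE_simps)
qed auto

lemma conn_Pt_Rt: "\<not> conn n b len (Pt i j) (Rt x)"
proof
  assume "conn n b len (Pt i j) (Rt x)"
  then show False
  proof (cases rule: conn_cases)
    case (explicit x' y')
    then have "y' = x" "x < nR" using vert_of_eq(1) by metis+
    moreover have "x' = tz \<or> x' = qv j" using explicit(4) vert_of_eq(2)[OF explicit(1)] by metis
    ultimately show ?thesis using explicit by (auto simp: dirE_simps)
  qed auto
qed

lemma conn_label:
  assumes "conn n b len (Rt x) (Pt i j)" "i \<le> k" "0 < len i"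
  shows "x = pa i \<and> j = 0 \<or> x = pb i \<and> Suc j = len i \<or> spk x i"
  using assms(1)
proof (cases rule: conn_cases)
  case (explicit x' y')
  then have x: "x' = x" "x < nR" using vert_of_eq(1) by metis+
  have "y' = tz \<and> i = 0 \<and> j = 0 \<or> y' = qv j \<and> i = 1 \<and> j \<le> n" using explicit(5) vert_of_eq(2)[OF explicit(2)] by metis
  then show ?thesis using explicit(3) x spk_lab[of 0 0] spk_lab[of "j mod 3" 1] spk_stl[OF s0_less]
    by (auto simp: dirE_simps)
next
  case (first i')
  then have i: "i' = i" "j = offset n i" by auto
  then have "x = path_start n i" "x < nR" using first(2) vert_of_eq(1)[OF path_start_vset[OF assms(2)]] by metis+
  then show ?thesis using i tz_gt(1) by (auto simp: path_start_def offset_def qv_def split: if_splits)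
next
  case (last i')
  then show ?thesis using assms by auto
next
  case (spoke x' i' j')
  then have "x' = x" "x < nR" using vert_of_eq(1) by metis+
  then show ?thesis using spoke tz_gt(1) by auto
qed auto

lemma conn_path:
  assumes "conn n b len (Pt i j) (Pt i j')" shows "j' = Suc j"
  using assms
proof (cases rule: conn_cases)
  case (explicit x y)
  have "x = tz \<and> i = 0 \<and> j = 0 \<or> x = qv j \<and> i = 1 \<and> j \<le> n" using explicit(4) vert_of_eq(2)[OF explicit(1)] by metis
  moreover have "y = tz \<and> i = 0 \<and> j' = 0 \<or> y = qv j' \<and> i = 1 \<and> j' \<le> n" using explicit(5) vert_of_eq(2)[OF explicit(2)] by metis
  ultimately show ?thesis using explicit(3) by (auto simp: dirE_simps)
next
  case (first i')
  then have "path_start n i = tz \<and> i = 0 \<and> j = 0 \<or> path_start n i = qv j \<and> i = 1 \<and> j \<le> n"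
    using vert_of_eq(2)[OF path_start_vset[OF first(1)]] by (metis vert.inject(2))
  then show ?thesis using first by (auto simp: offset_def path_start_def qv_def)
next
  case (spoke x i' j0)
  have "x = tz \<and> i = 0 \<and> j = 0 \<or> x = qv j \<and> i = 1 \<and> j \<le> n" using spoke(5) vert_of_eq(2)[OF spoke(1)] by metis
  then show ?thesis using spoke tz_gt(1) by (auto simp: qv_def)
qed auto

lemma conn_values:
  assumes "conn n b len (Pt i j) (Pt i' j')" "0 < i" "0 < i'" shows "i = i'"
  using assms(1)
proof (cases rule: conn_cases)
  case (explicit x y)
  have "i = 1" "i' = 1" using explicit(4,5) vert_of_eq(2)[OF explicit(1)] vert_of_eq(2)[OF explicit(2)] assms(2,3) by (metis less_irrefl)+
  then show ?thesis by simp
next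
  case (first i1)
  then have "path_start n i' = tz \<and> i = 0 \<and> j = 0 \<or> path_start n i' = qv j \<and> i = 1 \<and> j \<le> n"
    using vert_of_eq(2)[OF path_start_vset[OF first(1)]] by (metis vert.inject(2))
  then show ?thesis using assms(2,3) first pa_less[of i'] tz_gt by (auto simp: path_start_def qv_def split: if_splits)
next
  case (spoke x i1 j0)
  have "x = qv j" using spoke(5) vert_of_eq(2)[OF spoke(1)] assms(2) by (metis less_irrefl)
  then show ?thesis using spoke tz_gt(1) assms(3) by (auto simp: qv_def)
qed (use assms in auto)

text \<open>With \<open>b\<close> true there is no spoke from \<open>tz\<close> to urpath
  \<open>nR + 1\<close>, which leaves the explicit edge to \<open>qv n\<close> as the only
  licence.\<close>

lemma conn_initial:
  assumes "conn n True len (Pt 0 0) (Pt 1 j)" shows "j = n"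
  using assms
proof (cases rule: conn_cases)
  case (explicit x y)
  have "x = tz" "y = qv j" using explicit(4,5) vert_of_eq(2)[OF explicit(1)] vert_of_eq(2)[OF explicit(2)]
    by (metis zero_neq_one)+
  then show ?thesis using explicit(3) by (simp add: dirE_simps)
next
  case (first i')
  then show ?thesis by (auto simp: path_start_def vert_of_simps)
next
  case (spoke x i' j')
  have "x = tz" using spoke(5) vert_of_eq(2)[OF spoke(1)] by (metis zero_neq_one)
  then show ?thesis using spoke tz_gt(1) by auto
qed auto

lemma conn_initial': "\<not> conn n b len (Pt 1 j) (Pt 0 0)"
proof
  assume "conn n b len (Pt 1 j) (Pt 0 0)"
  then show False
  proof (cases rule: conn_cases)
    case (explicit x y)
    have "x = qv j" "y = tz" using explicit(4,5) vert_of_eq(2)[OF explicit(1)] vert_of_eq(2)[OF explicit(2)]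
      by (metis zero_neq_one)+
    then show ?thesis using explicit(3) by (simp add: dirE_simps)
  qed (auto simp: offset_def)
qed

text \<open>Each explicit segment is merged with its urpath into one line. The edges that the
  pathograph demands yield the positive conditions of a layout, and the list \<open>conn\<close> of
  licensed edges yields the negative ones.\<close>

theorem layout_of_realization:
  assumes "realization (Hpg n b) W EG"
  obtains f len A where "layout k m s0 h R len A" "emb f len A W EG"
    "b \<Longrightarrow> (\<forall>j<len 1. A (Pt 0 0) (Pt 1 j) \<longleftrightarrow> j = n)"
proof -
  let ?H = "Hpg n b"
  have k1: "1 \<le> k" using k_pos by simp
  obtain \<phi> P en where finW: "finite W" and EG2: "EG \<subseteq> {e. e \<subseteq> W \<and> card e = 2}"
    and inj\<phi>: "inj_on \<phi> (pV ?H)"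
    and en: "\<forall>u\<in>pU ?H. {fst (en u), snd (en u)} = ppi ?H u"
    and P: "\<forall>u\<in>pU ?H. P u \<noteq> [] \<and> distinct (P u) \<and> set (P u) \<inter> \<phi> ` pV ?H = {}"
    and Pdisj: "\<forall>u\<in>pU ?H. \<forall>u'\<in>pU ?H. u \<noteq> u' \<longrightarrow> set (P u) \<inter> set (P u') = {}"
    and W: "W = \<phi> ` pV ?H \<union> (\<Union>u\<in>pU ?H. set (P u))"
    and e1: "\<forall>e\<in>pE ?H. \<phi> ` e \<in> EG"
    and e2: "\<forall>u\<in>pU ?H. path_edges (\<phi> (fst (en u)) # P u @ [\<phi> (snd (en u))]) \<subseteq> EG"
    and e3: "\<forall>(v, u)\<in>pS ?H. \<exists>x\<in>set (P u). {\<phi> v, x} \<in> EG"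
    and e4: "\<forall>u u'. {u, u'} \<in> pR ?H \<longrightarrow> (\<exists>x\<in>set (P u). \<exists>y\<in>set (P u'). {x, y} \<in> EG)"
    and e5: "\<forall>e\<in>EG. (\<exists>e'\<in>pE ?H. e = \<phi> ` e') \<or>
       (\<exists>u\<in>pU ?H. e \<in> path_edges (\<phi> (fst (en u)) # P u @ [\<phi> (snd (en u))])) \<or>
       (\<exists>(v, u)\<in>pS ?H. \<exists>x\<in>set (P u). e = {\<phi> v, x}) \<or>
       (\<exists>u u'. {u, u'} \<in> pR ?H \<and> (\<exists>x\<in>set (P u). \<exists>y\<in>set (P u'). e = {x, y}))"
    using assms by (rule realizationE)
  have ur: "nR + i \<in> pU ?H" if "i \<le> k" for i using that by simp
  \<comment> \<open>The pair \<open>en u\<close> may list the ends of an urpath in either order;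
    \<open>Q i\<close> is the path read from its start.\<close>
  define Q where "Q = (\<lambda>i. if fst (en (nR + i)) = path_start n i then P (nR + i) else rev (P (nR + i)))"
  have setQ: "set (Q i) = set (P (nR + i))" for i by (simp add: Q_def)
  have Qne: "Q i \<noteq> []" and Qdist: "distinct (Q i)" and Q\<phi>: "set (Q i) \<inter> \<phi> ` vset n = {}" if "i \<le> k" for i
    using P ur[OF that] by (auto simp: Q_def)
  have Qpe: "path_edges (\<phi> (path_start n i) # Q i @ [\<phi> (pb i)]) =
      path_edges (\<phi> (fst (en (nR + i))) # P (nR + i) @ [\<phi> (snd (en (nR + i)))])" if i: "i \<le> k" for i
  proof -
    have eq: "{fst (en (nR + i)), snd (en (nR + i))} = {path_start n i, pb i}" using en[rule_format, OF ur[OF i]] by simp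
    show ?thesis
    proof (cases "fst (en (nR + i)) = path_start n i")
      case True
      then have "snd (en (nR + i)) = pb i" using eq path_start_ne[OF i, of n] by (auto simp: doubleton_eq_iff)
      then show ?thesis using True by (simp add: Q_def)
    next
      case False
      then have e: "fst (en (nR + i)) = pb i" "snd (en (nR + i)) = path_start n i" using eq by (auto simp: doubleton_eq_iff)
      have "\<phi> (path_start n i) # Q i @ [\<phi> (pb i)] = rev (\<phi> (pb i) # P (nR + i) @ [\<phi> (path_start n i)])"
        using False by (simp add: Q_def)
      then show ?thesis using path_edges_rev e by metis
    qed
  qed
  \<comment> \<open>The images of the explicit segments, to be put in front of the inner vertices of
    the urpaths.\<close>
  define pre where "pre = (\<lambda>i::nat. if i = 0 then [\<phi> tz] else if i = 1 then map (\<lambda>j. \<phi> (qv j)) [0..<Suc n] else [])"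
  have lpre: "length (pre i) = offset n i" for i by (simp add: pre_def offset_def)
  define len where "len = (\<lambda>i. offset n i + length (Q i))"
  define f where "f = (\<lambda>u. case u of Rt x \<Rightarrow> \<phi> x | Pt i j \<Rightarrow> (pre i @ Q i) ! j)"
  have off: "offset n i < len i" if "i \<le> k" for i using Qne[OF that] by (simp add: len_def)
  have l0: "1 < len 0" and l1: "Suc n < len 1" using off[of 0] off[OF k1] by (auto simp: offset_def)
  have fE: "f (vert_of x) = \<phi> x" if "x \<in> vset n" for x
    using that
  proof (cases rule: vset_cases)
    case (val j)
    then have "map (\<lambda>j. \<phi> (qv j)) [0..<Suc n] ! j = \<phi> (qv j)" by (simp del: upt_Suc)
    then show ?thesis using val by (simp add: vert_of_simps f_def pre_def nth_append del: upt_Suc)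
  qed (auto simp: vert_of_simps f_def pre_def)
  have fI: "f (Pt i (offset n i + j)) = Q i ! j" for i j
    unfolding f_def by (simp add: nth_append lpre)
  have Qmap: "Q i = map (\<lambda>j. f (Pt i j)) [offset n i..<len i]" for i
    by (rule nth_equalityI) (auto simp: len_def fI)
  have fIset: "f (Pt i j) \<in> set (P (nR + i))" if "offset n i \<le> j" "j < len i" for i j
    using that unfolding setQ[symmetric] Qmap by auto
  have fIset': "\<exists>j. offset n i \<le> j \<and> j < len i \<and> y = f (Pt i j)" if "y \<in> set (P (nR + i))" for y i
    using that unfolding setQ[symmetric] Qmap by auto
  have V: "vert_of x \<in> VS len" if "x \<in> vset n" for x using vert_of_VS[OF _ _ that] l0 l1 by simp
  have sep: "f (vert_of x) \<noteq> f (Pt i j)" if "x \<in> vset n" "i \<le> k" "offset n i \<le> j" "j < len i" for x i j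
    using fIset[OF that(3,4)] fE[OF that(1)] P ur[OF that(2)] that(1) by fastforce
  have inj: "inj_on f (VS len)"
  proof (rule inj_onI)
    fix u w assume u: "u \<in> VS len" and w: "w \<in> VS len" and eq: "f u = f w"
    from u show "u = w"
    proof (cases rule: VS_cases[where n = n])
      case (explicit x)
      note x = this
      from w show ?thesis
      proof (cases rule: VS_cases[where n = n])
        case (explicit y)
        then have "\<phi> x = \<phi> y" using x eq fE by simp
        then have "x = y" using inj_onD[OF inj\<phi>] x explicit by simp
        then show ?thesis using x explicit by simp
      next
        case (internal i j)
        then show ?thesis using sep x eq by blast
      qed
    next
      case (internal i j)
      note x = this
      from w show ?thesis
      proof (cases rule: VS_cases[where n = n])
        case (explicit y)
        then show ?thesis using sep[OF explicit(1) x(1-3)] x eq by simp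
      next
        case (internal i' j')
        have "i = i'"
        proof (rule ccontr)
          assume "i \<noteq> i'"
          then have "set (P (nR + i)) \<inter> set (P (nR + i')) = {}" using Pdisj ur[OF x(1)] ur[OF internal(1)] by simp
          then show False using fIset[OF x(2,3)] fIset[OF internal(2,3)] x internal eq by auto
        qed
        moreover have "j = j'"
        proof -
          have "Q i ! (j - offset n i) = Q i ! (j' - offset n i)"
            using fI[of i "j - offset n i"] fI[of i "j' - offset n i"] x internal eq \<open>i = i'\<close> by simp
          moreover have "j - offset n i < length (Q i)" "j' - offset n i < length (Q i)"
            using x internal \<open>i = i'\<close> by (auto simp: len_def)
          ultimately have "j - offset n i = j' - offset n i" using Qdist[OF x(1)] nth_eq_iff_index_eq by blast
          then show ?thesis using x internal \<open>i = i'\<close> by simp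
        qed
        ultimately show ?thesis using x internal by simp
      qed
    qed
  qed
  have Wf: "W = f ` VS len"
  proof (intro set_eqI iffI)
    fix w assume "w \<in> W"
    then consider x where "x \<in> vset n" "w = \<phi> x" | u where "nR \<le> u" "u \<le> nR + k" "w \<in> set (P u)" unfolding W by auto
    then show "w \<in> f ` VS len"
    proof cases
      case (1 x)
      then show ?thesis using fE V by (intro image_eqI[of _ _ "vert_of x"]) auto
    next
      case (2 u)
      then obtain j where "j < len (u - nR)" "w = f (Pt (u - nR) j)" using fIset'[of w "u - nR"] by auto
      then show ?thesis using 2 by (intro image_eqI[of _ _ "Pt (u - nR) j"]) auto
    qed
  next
    fix w assume "w \<in> f ` VS len"
    then obtain u where u: "u \<in> VS len" "w = f u" by auto
    from u(1) show "w \<in> W"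
    proof (cases rule: VS_cases[where n = n])
      case (explicit x)
      then show ?thesis using u fE W by auto
    next
      case (internal i j)
      then show ?thesis using u fIset[of i j] ur[of i] W by blast
    qed
  qed
  define A where "A = (\<lambda>u w. u \<in> VS len \<and> w \<in> VS len \<and> {f u, f w} \<in> EG)"
  have ne: "f u \<noteq> f w" if "{f u, f w} \<in> EG" for u w using that EG2 by (auto simp: card_insert_if split: if_splits)
  have emb: "emb f len A W EG"
    unfolding emb_def
  proof (intro conjI set_eqI iffI)
    fix e assume e: "e \<in> EG"
    then have "card e = 2" "e \<subseteq> W" using EG2 by auto
    then obtain a c where "e = {a, c}" "a \<in> W" "c \<in> W" by (auto simp: card_2_iff)
    then obtain u w where "e = {f u, f w}" "u \<in> VS len" "w \<in> VS len" unfolding Wf by auto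
    then show "e \<in> {{f u, f w} |u w. u \<in> VS len \<and> w \<in> VS len \<and> A u w}" using e by (auto simp: A_def)
  qed (use inj Wf in \<open>auto simp: A_def\<close>)
  have sym: "A w u" if "A u w" for u w using that by (auto simp: A_def insert_commute)
  have irrefl: "\<not> A u u" for u using ne[of u u] by (auto simp: A_def)
  have A_conn: "conn n b len u w \<or> conn n b len w u" if A: "A u w" for u w
  proof -
    have uw: "u \<in> VS len" "w \<in> VS len" "{f u, f w} \<in> EG" using A by (auto simp: A_def)
    have dbl: "conn n b len u w \<or> conn n b len w u"
      if c: "conn n b len u' w'" and V': "u' \<in> VS len" "w' \<in> VS len" and eq: "{f u, f w} = {f u', f w'}" for u' w'
    proof -
      have "f u = f u' \<and> f w = f w' \<or> f u = f w' \<and> f w = f u'" using eq by (auto simp: doubleton_eq_iff)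
      then have "u = u' \<and> w = w' \<or> u = w' \<and> w = u'" using inj_onD[OF inj] uw V' by blast
      then show ?thesis using c by auto
    qed
    from e5[rule_format, OF uw(3)] show ?thesis
    proof (elim disjE)
      assume "\<exists>e'\<in>pE ?H. {f u, f w} = \<phi> ` e'"
      then obtain x y where xy: "x \<in> vset n" "y \<in> vset n" "dirE n b x y" "{f u, f w} = \<phi> ` {x, y}"
        unfolding Hpg_simps pgE_def by blast
      then have "{f u, f w} = {f (vert_of x), f (vert_of y)}" using fE by simp
      moreover have "conn n b len (vert_of x) (vert_of y)" unfolding conn_def using xy by blast
      ultimately show ?thesis using dbl V xy by blast
    next
      assume "\<exists>u'\<in>pU ?H. {f u, f w} \<in> path_edges (\<phi> (fst (en u')) # P u' @ [\<phi> (snd (en u'))])"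
      then obtain u' where u': "nR \<le> u'" "u' \<le> nR + k"
        "{f u, f w} \<in> path_edges (\<phi> (fst (en u')) # P u' @ [\<phi> (snd (en u'))])" by auto
      define i where "i = u' - nR"
      have i: "i \<le> k" "u' = nR + i" using u' by (auto simp: i_def)
      have pbv: "f (Rt (pb i)) = \<phi> (pb i)" by (simp add: f_def)
      have "{f u, f w} \<in> path_edges (\<phi> (path_start n i) # map (\<lambda>j. f (Pt i j)) [offset n i..<len i] @ [\<phi> (pb i)])"
        using u'(3) Qpe[OF i(1)] unfolding i Qmap[symmetric] by simp
      then have "{f u, f w} = {\<phi> (path_start n i), f (Pt i (offset n i))} \<or> {f u, f w} = {f (Pt i (len i - 1)), \<phi> (pb i)} \<or>
          (\<exists>j. offset n i \<le> j \<and> Suc j < len i \<and> {f u, f w} = {f (Pt i j), f (Pt i (Suc j))})"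
        unfolding path_edges_urpath[OF off[OF i(1)]] by blast
      then show ?thesis
      proof (elim disjE exE conjE)
        assume "{f u, f w} = {\<phi> (path_start n i), f (Pt i (offset n i))}"
        then have "{f u, f w} = {f (vert_of (path_start n i)), f (Pt i (offset n i))}"
          using fE[OF path_start_vset[OF i(1)]] by simp
        moreover have "conn n b len (vert_of (path_start n i)) (Pt i (offset n i))"
          unfolding conn_def using i(1) by blast
        ultimately show ?thesis using dbl V[OF path_start_vset[OF i(1)]] off[OF i(1)] i(1) by simp
      next
        assume "{f u, f w} = {f (Pt i (len i - 1)), \<phi> (pb i)}"
        then have "{f u, f w} = {f (Rt (pb i)), f (Pt i (len i - 1))}" using pbv by (simp add: insert_commute)
        moreover have "conn n b len (Rt (pb i)) (Pt i (len i - 1))"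
          unfolding conn_def using i(1) by blast
        ultimately show ?thesis using dbl[of "Rt (pb i)" "Pt i (len i - 1)"] off[OF i(1)] i(1) pb_less[OF i(1)] by simp
      next
        fix j assume j: "offset n i \<le> j" "Suc j < len i" and eq: "{f u, f w} = {f (Pt i j), f (Pt i (Suc j))}"
        have "conn n b len (Pt i j) (Pt i (Suc j))" unfolding conn_def using i(1) j by blast
        then show ?thesis using dbl[OF _ _ _ eq] j i(1) by simp
      qed
    next
      assume "\<exists>(v, u')\<in>pS ?H. \<exists>x\<in>set (P u'). {f u, f w} = {\<phi> v, x}"
      then obtain x u' y where xu: "(x, u') \<in> pS ?H" "y \<in> set (P u')" "{f u, f w} = {\<phi> x, y}" by blast
      define i where "i = u' - nR"
      have i: "i \<le> k" "u' = nR + i" using xu(1) by (auto simp: i_def)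
      have x: "x \<in> vset n" using xu(1) by (auto simp: vset_def qv_def)
      obtain j where j: "offset n i \<le> j" "j < len i" "y = f (Pt i j)" using fIset'[of y i] xu(2) i by blast
      have "conn n b len (vert_of x) (Pt i j)" unfolding conn_def using x xu(1) i(2) j by blast
      then show ?thesis using dbl[of "vert_of x" "Pt i j"] V[OF x] j i(1) xu(3) fE[OF x] by simp
    next
      assume "\<exists>u1 u2. {u1, u2} \<in> pR ?H \<and> (\<exists>x\<in>set (P u1). \<exists>y\<in>set (P u2). {f u, f w} = {x, y})"
      then obtain u1 u2 x y where r: "{u1, u2} \<in> pR ?H" "x \<in> set (P u1)" "y \<in> set (P u2)" "{f u, f w} = {x, y}" by blast
      then obtain u' where u': "{u1, u2} = {nR, u'}" "nR + 1 \<le> u'" "u' \<le> nR + k" by auto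
      then have "u1 = nR \<and> u2 = u' \<or> u1 = u' \<and> u2 = nR" by (simp add: doubleton_eq_iff)
      then obtain x' y' where xy: "x' \<in> set (P nR)" "y' \<in> set (P u')" "{f u, f w} = {x', y'}"
        using r by (metis insert_commute)
      define i where "i = u' - nR"
      have i: "1 \<le> i" "i \<le> k" "u' = nR + i" using u' by (auto simp: i_def)
      obtain t where t: "1 \<le> t" "t < len 0" "x' = f (Pt 0 t)" using fIset'[of x' 0] xy(1) by (auto simp: offset_def)
      obtain j where j: "offset n i \<le> j" "j < len i" "y' = f (Pt i j)" using fIset'[of y' i] xy(2) i by blast
      have "conn n b len (Pt 0 t) (Pt i j)" unfolding conn_def using i t j by blast
      then show ?thesis using dbl[of "Pt 0 t" "Pt i j"] t j i xy(3) by simp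
    qed
  qed
  have dirE_A: "A (vert_of x) (vert_of y)" if "x \<in> vset n" "y \<in> vset n" "dirE n b x y" for x y
  proof -
    have "{x, y} \<in> pE ?H" using that by (auto simp: pgE_def)
    then have "\<phi> ` {x, y} \<in> EG" using e1 by blast
    then show ?thesis using V that fE by (simp add: A_def)
  qed
  have pathE: "e \<in> EG" if "i \<le> k" "e \<in> path_edges (\<phi> (path_start n i) # map (\<lambda>j. f (Pt i j)) [offset n i..<len i] @ [\<phi> (pb i)])" for i e
    using e2[rule_format, OF ur[OF that(1)]] that(2) Qpe[OF that(1)] unfolding Qmap[symmetric] by auto
  have first_A: "A (vert_of (path_start n i)) (Pt i (offset n i))" if i: "i \<le> k" for i
  proof -
    have "{\<phi> (path_start n i), f (Pt i (offset n i))} \<in> EG"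
      by (rule pathE[OF i]) (simp add: path_edges_urpath[OF off[OF i]])
    then show ?thesis using V[OF path_start_vset[OF i]] fE[OF path_start_vset[OF i]] off[OF i] i by (simp add: A_def)
  qed
  have last_A: "A (Rt (pb i)) (Pt i (len i - 1))" if i: "i \<le> k" for i
  proof -
    have "{f (Pt i (len i - 1)), \<phi> (pb i)} \<in> EG"
      by (rule pathE[OF i]) (simp add: path_edges_urpath[OF off[OF i]])
    moreover have "f (Rt (pb i)) = \<phi> (pb i)" by (simp add: f_def)
    ultimately show ?thesis using off[OF i] i pb_less[OF i] by (simp add: A_def insert_commute)
  qed
  have mid_A: "A (Pt i j) (Pt i (Suc j))" if i: "i \<le> k" and j: "Suc j < len i" for i j
  proof -
    consider "offset n i \<le> j" | "Suc j = offset n i" | "Suc j < offset n i" by linarith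
    then show ?thesis
    proof cases
      case 1
      have "{f (Pt i j), f (Pt i (Suc j))} \<in> EG"
        by (rule pathE[OF i]) (use 1 j in \<open>auto simp: path_edges_urpath[OF off[OF i]]\<close>)
      then show ?thesis using i j by (simp add: A_def)
    next
      case 2
      then have "vert_of (path_start n i) = Pt i j"
        by (auto simp: offset_def path_start_def vert_of_simps split: if_splits)
      then show ?thesis using first_A[OF i] 2 by simp
    next
      case 3
      then have "i = 1" "Suc j \<le> n" by (auto simp: offset_def split: if_splits)
      then show ?thesis using dirE_A[of "qv j" "qv (Suc j)"] by (simp add: vset_mem dirE_simps vert_of_simps)
    qed
  qed
  have "layout k m s0 h R len A"
  proof (intro layout.intro layout_axioms.intro machine_axioms)
    show "A w u" if "A u w" for u w using sym that .
    show "\<not> A u u" for u by (rule irrefl)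
    show "A (Rt x) (Rt y) \<longleftrightarrow> radj x y" if "x < nR" "y < nR" for x y
    proof
      assume "A (Rt x) (Rt y)"
      then show "radj x y" using A_conn conn_root radj_sym by blast
    next
      assume "radj x y"
      then show "A (Rt x) (Rt y)" using dirE_A[of x y] that by (simp add: vset_mem dirE_simps vert_of_simps)
    qed
    show "A (Pt i j) (Pt i j') \<longleftrightarrow> j' = Suc j \<or> j = Suc j'" if "i \<le> k" "j < len i" "j' < len i" for i j j'
    proof
      assume "A (Pt i j) (Pt i j')"
      then show "j' = Suc j \<or> j = Suc j'" using A_conn conn_path by blast
    next
      assume "j' = Suc j \<or> j = Suc j'"
      then show "A (Pt i j) (Pt i j')" using mid_A[OF that(1)] sym that by blast
    qed
    show "\<not> A (Pt i j) (Pt i' j')" if "0 < i" "0 < i'" "i \<noteq> i'" for i i' j j'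
      using A_conn conn_values that by metis
    show "A (Rt (pa i)) (Pt i 0)" if i: "i \<le> k" for i
    proof -
      consider "i = 0" | "i = 1" | "2 \<le> i" by linarith
      then show ?thesis
      proof cases
        case 1
        then show ?thesis using dirE_A[of "pa 0" tz] explicit_roots by (simp add: vset_mem dirE_simps vert_of_simps)
      next
        case 2
        then show ?thesis using dirE_A[of "pa 1" "qv 0"] explicit_roots by (simp add: vset_mem dirE_simps vert_of_simps)
      next
        case 3
        then show ?thesis using first_A[OF i] pa_less[OF i] by (simp add: path_start_def offset_def vert_of_simps)
      qed
    qed
    show "A (Rt (pb i)) (Pt i (len i - 1))" if "i \<le> k" for i using last_A that .
    show "0 < len i" if "i \<le> k" for i using off[OF that] by simp
    show "x = pa i \<and> j = 0 \<or> x = pb i \<and> Suc j = len i \<or> spk x i" if "i \<le> k" "A (Rt x) (Pt i j)" for x i j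
      using A_conn[OF that(2)] conn_label[OF _ that(1)] conn_Pt_Rt off[OF that(1)] by (metis gr_zeroI not_less_zero)
    show "\<exists>j<len i. A (Rt (lab i r)) (Pt i j)" if i: "i \<le> k" and r: "r < 3" for i r
    proof -
      have l: "lab i r < nR" using spk_less[OF spk_lab[OF r] i] nD_nR by simp
      then have "(lab i r, nR + i) \<in> pS ?H" using spk_lab[OF r, of i] i by simp
      then obtain y where y: "y \<in> set (P (nR + i))" "{\<phi> (lab i r), y} \<in> EG" using e3 by blast
      then obtain j where j: "j < len i" "y = f (Pt i j)" using fIset' by blast
      have "A (Rt (lab i r)) (Pt i j)" using y j l i by (simp add: A_def f_def)
      then show ?thesis using j by blast
    qed
  qed
  moreover have "\<forall>j<len 1. A (Pt 0 0) (Pt 1 j) \<longleftrightarrow> j = n" if b: b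
  proof (intro allI impI iffI)
    fix j assume "A (Pt 0 0) (Pt 1 j)"
    then show "j = n" using A_conn[of "Pt 0 0" "Pt 1 j"] conn_initial[of n len j] conn_initial'[of n b len j] b by auto
  next
    fix j assume "j < len 1" "j = n"
    then show "A (Pt 0 0) (Pt 1 j)" using dirE_A[of tz "qv n"] b by (simp add: vset_mem dirE_simps vert_of_simps)
  qed
  ultimately show thesis using that emb by blast
qed

end

section \<open>Runs as free realizations\<close>

context machine
begin

definition root_path_adj :: "(nat \<Rightarrow> nat) \<Rightarrow> nat \<Rightarrow> (nat \<Rightarrow> nat) \<Rightarrow> nat \<Rightarrow> nat \<Rightarrow> nat \<Rightarrow> bool" where
  "root_path_adj len T st x i j \<longleftrightarrow> x = pa i \<and> j = 0 \<or> x = pb i \<and> Suc j = len i \<or> x = lab i (j mod 3) \<or>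
     i = 0 \<and> (x = stl (st j) \<or> x = junk \<and> T < j)"

fun run_adj :: "(nat \<Rightarrow> nat) \<Rightarrow> nat \<Rightarrow> (nat \<Rightarrow> nat) \<Rightarrow> (nat \<Rightarrow> nat \<Rightarrow> nat) \<Rightarrow> vert \<Rightarrow> vert \<Rightarrow> bool" where
  "run_adj len T st val (Rt x) (Rt y) = radj x y"
| "run_adj len T st val (Rt x) (Pt i j) = root_path_adj len T st x i j"
| "run_adj len T st val (Pt i j) (Rt x) = root_path_adj len T st x i j"
| "run_adj len T st val (Pt i j) (Pt i' j') \<longleftrightarrow> i = i' \<and> (j' = Suc j \<or> j = Suc j') \<or>
     i = 0 \<and> 0 < i' \<and> val j (i' - 1) = j' \<or> i' = 0 \<and> 0 < i \<and> val j' (i - 1) = j"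

lemma lab_ne: "i \<le> k \<Longrightarrow> r < 3 \<Longrightarrow> lab i r \<noteq> stl s \<and> lab i r \<noteq> junk \<and> lab i r \<noteq> pa i' \<and> lab i r \<noteq> pb i'"
  and stl_ne: "s < m \<Longrightarrow> stl s \<noteq> junk \<and> stl s \<noteq> pa i' \<and> stl s \<noteq> pb i'"
  and junk_ne: "junk \<noteq> pa i' \<and> junk \<noteq> pb i'"
  and stl_eq: "stl s = stl s' \<longleftrightarrow> s = s'"
  by (auto simp: lab_def stl_def junk_def pa_def pb_def nD_def)

text \<open>Three vertices on every line let all position labels occur, as \<open>A_spoke\<close>
  demands; the remaining conditions are read off from \<open>run_adj\<close>, the labels being
  distinct roots.\<close>

lemma good_run_adj:
  assumes run: "is_run T st val v" and T: "Suc T < len 0" and st: "\<And>t. t < len 0 \<Longrightarrow> st t < m"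
    and val: "\<And>t i. t < len 0 \<Longrightarrow> i < k \<Longrightarrow> Suc (val t i) < len (Suc i)" and len3: "\<And>i. i \<le> k \<Longrightarrow> 3 \<le> len i"
  shows "good k m s0 h R len (run_adj len T st val) T st val v"
proof -
  let ?A = "run_adj len T st val"
  have lab: "?A (Rt (lab i r)) (Pt i j) \<longleftrightarrow> r = j mod 3" if i: "i \<le> k" and r: "r < 3" for i j r
    using lab_ne[OF i r, of "st j" i] lab_inj[of i r i "j mod 3"] r by (auto simp: root_path_adj_def)
  show ?thesis
  proof (intro good.intro layout.intro layout_axioms.intro good_axioms.intro machine_axioms)
    show "?A w u" if "?A u w" for u w
      using that by (cases u; cases w) (auto simp: radj_sym)
    show "\<not> ?A u u" for u by (cases u) (auto simp: radj_def)
    show "?A (Rt x) (Rt y) \<longleftrightarrow> radj x y" for x y by simp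
    show "?A (Pt i j) (Pt i j') \<longleftrightarrow> j' = Suc j \<or> j = Suc j'" for i j j' by auto
    show "\<not> ?A (Pt i j) (Pt i' j')" if "0 < i" "0 < i'" "i \<noteq> i'" for i i' j j' using that by simp
    show "?A (Rt (pa i)) (Pt i 0)" for i by (simp add: root_path_adj_def)
    show "?A (Rt (pb i)) (Pt i (len i - 1))" if "i \<le> k" for i using len3[OF that] by (simp add: root_path_adj_def)
    show "x = pa i \<and> j = 0 \<or> x = pb i \<and> Suc j = len i \<or> spk x i"
      if "j < len i" "?A (Rt x) (Pt i j)" for x i j
    proof -
      have "j mod 3 < 3" by simp
      then have "spk (lab i (j mod 3)) i" by (rule spk_lab)
      moreover have "spk (stl (st j)) 0" if "i = 0" using spk_stl st \<open>j < len i\<close> that by blast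
      ultimately show ?thesis using that spk_junk by (auto simp: root_path_adj_def)
    qed
    show "0 < len i" if "i \<le> k" for i using len3[OF that] by simp
    show "\<exists>j<len i. ?A (Rt (lab i r)) (Pt i j)" if "i \<le> k" "r < 3" for i r
      using lab[OF that, of r] len3[OF that(1)] that(2) by (intro exI[of _ r]) simp
    show "is_run T st val v" "Suc T < len 0" by (fact run, fact T)
    show "st t < m" if "t < len 0" for t using st that .
    show "?A (Rt (lab i r)) (Pt i j) \<longleftrightarrow> r = j mod 3" if "i \<le> k" "r < 3" for i j r using lab that .
    show "?A (Rt (stl s)) (Pt 0 t) \<longleftrightarrow> st t = s" if "s < m" for t s
      using lab_ne[of 0 "t mod 3" s 0] stl_ne[OF that, of 0] stl_eq[of s "st t"]
      by (auto simp: root_path_adj_def)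
    show "?A (Rt junk) (Pt 0 t) \<longleftrightarrow> T < t" if "t < len 0" for t
      using lab_ne[of 0 "t mod 3" 0 0] junk_ne[of 0] stl_ne[OF st[OF that], of 0]
      by (auto simp: root_path_adj_def)
    show "?A (Pt 0 t) (Pt (Suc i) j) \<longleftrightarrow> val t i = j" for t i j by simp
    show "Suc (val t i) < len (Suc i)" if "t < len 0" "i < k" for t i using val that .
  qed
qed

definition vert_code :: "vert \<Rightarrow> nat" where
  "vert_code u = (case u of Rt x \<Rightarrow> prod_encode (0, prod_encode (x, 0)) | Pt i j \<Rightarrow> prod_encode (1, prod_encode (i, j)))"

lemma inj_vert_code: "inj vert_code"
  by (rule injI) (auto simp: vert_code_def split: vert.splits)

lemma emb_exists: "\<exists>W EG. emb vert_code len A W EG"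
  unfolding emb_def using inj_on_subset[OF inj_vert_code] by blast

text \<open>After halting, the time line passes through all states and through all values, so that all
  spokes and rungs are realized.\<close>

theorem realization_of_run:
  assumes acc: "accepts v" and v: "if b then v = n else n < v"
  obtains W EG len A T st val where "realization (Hpg n b) W EG" "emb vert_code len A W EG"
    "good k m s0 h R len A T st val v"
proof -
  obtain T st0 val0 where run0: "is_run T st0 val0 v" using acc unfolding accepts_def by blast
  have m0: "0 < m" using s0_less by simp
  \<comment> \<open>Exceeds \<open>m\<close>, \<open>n\<close>, the input and all values of the
    given run.\<close>
  define B where "B = Suc (m + n + v + (\<Sum>t\<le>T. \<Sum>i<k. val0 t i))"
  have valB: "val0 t i < B" if "t \<le> T" "i < k" for t i
  proof -
    have "val0 t i \<le> (\<Sum>i<k. val0 t i)" using that by (intro member_le_sum) auto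
    also have "\<dots> \<le> (\<Sum>t\<le>T. \<Sum>i<k. val0 t i)" using that by (intro member_le_sum) auto
    finally show ?thesis by (simp add: B_def)
  qed
  have Bge: "m \<le> B" "n < B" "v < B" by (auto simp: B_def)
  \<comment> \<open>The tail consists of \<open>B + 4\<close> times, on which every counter shows
    the time elapsed since \<open>Suc T\<close>, thus 0 to \<open>B + 3\<close>. This stays below
    the last position \<open>B + 4\<close> of a value line. The state also follows the elapsed time,
    until all \<open>m\<close> states have occurred.\<close>
  define len where "len = (\<lambda>i::nat. if i = 0 then T + B + 5 else B + 5)"
  define st where "st = (\<lambda>t. if t \<le> T then st0 t else if t - Suc T < m then t - Suc T else 0)"
  define val where "val = (\<lambda>t i. if t \<le> T then val0 t i else t - Suc T)"
  have run: "is_run T st val v"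
    using run0 unfolding is_run_def by (auto simp: st_def val_def)
  have stless: "st t < m" for t
  proof (cases "t \<le> T")
    case True
    have "st0 t < m"
    proof (cases "t = T")
      case True
      then show ?thesis using run0 h_less by (simp add: is_run_def)
    next
      case False
      then have "R (st0 t) (st0 (Suc t)) (\<lambda>i. val0 t i = 0) (\<lambda>i. int (val0 (Suc t) i) - int (val0 t i))"
        using run0 \<open>t \<le> T\<close> by (simp add: is_run_def)
      then show ?thesis using R_states by blast
    qed
    then show ?thesis using True by (simp add: st_def)
  qed (use m0 in \<open>simp add: st_def\<close>)
  have vallen: "Suc (val t i) < len (Suc i)" if "t < len 0" "i < k" for t i
    using that valB[of t i] by (auto simp: val_def len_def)
  let ?A = "run_adj len T st val"
  have good: "good k m s0 h R len ?A T st val v"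
    by (rule good_run_adj[OF run]) (use stless vallen in \<open>auto simp: len_def\<close>)
  interpret G: good k m s0 h R len ?A T st val v by (rule good)
  obtain W EG where emb: "emb vert_code len ?A W EG" using emb_exists by blast
  have k1: "1 \<le> k" "0 < k" using k_pos by auto
  have v0: "val 0 0 = v" "\<And>i. 0 < i \<Longrightarrow> i < k \<Longrightarrow> val 0 i = 0" using run k1 by (auto simp: is_run_def)
  have len0: "0 < len 0" by (simp add: len_def)
  have len1: "len 1 = B + 5" by (simp add: len_def)
  have VA: "?A (Pt 0 t) (Pt i (val t (i - 1)))" if "0 < i" for t i using that by simp
  have junkval: "val (T + 1 + a) i = a" "\<not> T + 1 + a \<le> T" for a i by (auto simp: val_def)
  have Gval: "?A (Pt 0 0) (Pt 1 j) \<longleftrightarrow> v = j" if "j < len 1" for j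
    using G.G_val[OF len0 k1(2), of j] that v0 by simp
  have "realization (Hpg n b) W EG"
  proof (rule G.realizes_Hpg[OF emb])
    show "?A (vert_of x) (vert_of y) \<longleftrightarrow> dirE n b x y \<or> dirE n b y x" if "x \<in> vset n" "y \<in> vset n" for x y
    proof (rule G.explicit_adj[OF _ _ _ _ _ _ _ that])
      show "Suc 0 < len 0" "Suc n < len 1" using Bge by (auto simp: len_def)
      show "?A (Rt (lab 0 r)) (Pt 0 0) \<longleftrightarrow> r = 0" if "r < 3" for r using G.G_lab[of 0 0 r] that len0 by simp
      show "?A (Rt (stl s)) (Pt 0 0) \<longleftrightarrow> s = s0" if "s < m" for s
        using G.G_st[OF len0 that] run by (auto simp: is_run_def)
      show "\<not> ?A (Rt junk) (Pt 0 0)" using G.G_junk[OF len0] by simp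
      show "?A (Rt (lab 1 r)) (Pt 1 j) \<longleftrightarrow> r = j mod 3" if "j \<le> n" "r < 3" for j r
        using G.G_lab[OF k1(1), of j r] that Bge len1 by simp
      show "?A (Pt 0 0) (Pt 1 j) \<longleftrightarrow> b \<and> j = n" if "j \<le> n" for j
        using Gval[of j] that v Bge len1 by (auto split: if_splits)
    qed
    show "offset n i < len i" if "i \<le> k" for i using Bge by (auto simp: offset_def len_def)
    show "\<exists>j. offset n i \<le> j \<and> j < len i \<and> ?A (Rt x) (Pt i j)" if i: "i \<le> k" and x: "spk x i" for x i
    proof -
      consider r where "r < 3" "x = lab i r" | s where "i = 0" "s < m" "x = stl s" | "i = 0" "x = junk"
        using x by (auto simp: spk_def)
      then show ?thesis
      proof cases
        case (1 r)
        \<comment> \<open>The three positions from the offset on contain all residues modulo 3;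
          adding \<open>2 * offset n i\<close> inside makes the total congruent to
          \<open>r\<close>.\<close>
        define j' where "j' = offset n i + (r + 2 * offset n i) mod 3"
        have "j' mod 3 = r" using 1(1) unfolding j'_def by presburger
        moreover have "offset n i \<le> j'" "j' < len i" using Bge by (auto simp: j'_def offset_def len_def)
        ultimately show ?thesis using 1 G.G_lab[OF i, of j' r] by (intro exI[of _ j']) simp
      next
        case (2 s)
        let ?j = "T + 1 + s"
        have "?j < len 0" "st ?j = s" using 2 Bge by (auto simp: len_def st_def)
        then show ?thesis using 2 G.G_st[of ?j s] by (intro exI[of _ ?j]) (auto simp: offset_def)
      next
        case 3
        have "Suc T < len 0" by (simp add: len_def)
        then show ?thesis using 3 G.G_junk[of "Suc T"] by (intro exI[of _ "Suc T"]) (auto simp: offset_def)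
      qed
    qed
    show "\<exists>j. offset n i \<le> j \<and> j < len i \<and> ?A (Pt 0 0) (Pt i j)" if i: "1 \<le> i" "i \<le> k" and b: "i = 1 \<longrightarrow> \<not> b" for i
    proof (cases "i = 1")
      case True
      then have "n < v" using v b by simp
      then show ?thesis using True Gval[of v] Bge len1 by (intro exI[of _ v]) (auto simp: offset_def)
    next
      case False
      then have "val 0 (i - 1) = 0" using v0(2)[of "i - 1"] i by simp
      then show ?thesis using False VA[of i 0] i by (intro exI[of _ 0]) (auto simp: offset_def len_def)
    qed
    show "\<not> ?A (Pt 0 0) (Pt 1 j)" if "b" "n < j" "j < len 1" for j using Gval[OF that(3)] that v by simp
    show "\<exists>t. 1 \<le> t \<and> t < len 0 \<and> ?A (Pt 0 t) (Pt 1 j)" if "j \<le> n" for j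
      using VA[of 1 "T + 1 + j"] junkval(1)[of j 0] that Bge by (intro exI[of _ "T + 1 + j"]) (auto simp: len_def)
    \<comment> \<open>The tail time at which all counters have the value \<open>Suc n\<close>, which
      no longer is an explicit vertex.\<close>
    show "\<exists>t j. 1 \<le> t \<and> t < len 0 \<and> offset n i \<le> j \<and> j < len i \<and> ?A (Pt 0 t) (Pt i j)" if "1 \<le> i" "i \<le> k" for i
      using VA[of i "T + 1 + Suc n"] junkval(1)[of "Suc n" "i - 1"] that Bge
      by (intro exI[of _ "T + 1 + Suc n"] exI[of _ "Suc n"]) (auto simp: len_def offset_def)
  qed
  then show thesis using that emb good by blast
qed

lemma pg_free_good: "good_graph W EG \<Longrightarrow> pg_free forbidden W EG"
  by (auto simp: pg_free_def forbidden_def)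

text \<open>Good graphs are free by the very definition of \<open>forbidden\<close>, so an accepting
  run gives a free realization. Conversely the edge from \<open>tz\<close> to \<open>qv n\<close>
  fixes the input of the run that \<open>accepts_value\<close> extracts.\<close>

theorem free_realization_iff_accepts:
  "has_free_realization forbidden (Hpg n True) \<longleftrightarrow> accepts n"
proof
  assume "has_free_realization forbidden (Hpg n True)"
  then obtain W EG where r: "realization (Hpg n True) W EG" and free: "pg_free forbidden W EG"
    unfolding has_free_realization_def by blast
  obtain f len A where layout: "layout k m s0 h R len A" and emb: "emb f len A W EG"
    and init: "\<forall>j<len 1. A (Pt 0 0) (Pt 1 j) \<longleftrightarrow> j = n"
    using r by (rule layout_of_realization) blast
  interpret L: free_layout k m s0 h R len A f W EG
    by (intro free_layout.intro layout free_layout_axioms.intro emb free)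
  have "0 < len 0" using L.len_pos by simp
  then have "L.value_of 0 0 < len 1" "A (Pt 0 0) (Pt 1 (L.value_of 0 0))"
    using L.value_of[of 0 0] k_pos by auto
  then have "L.value_of 0 0 = n" using init by blast
  then show "accepts n" using L.accepts_value by simp
next
  assume "accepts n"
  then obtain W EG len A T st val where "realization (Hpg n True) W EG" "emb vert_code len A W EG"
    "good k m s0 h R len A T st val n" by (rule realization_of_run[where b = True and n = n]) simp_all
  then show "has_free_realization forbidden (Hpg n True)"
    unfolding has_free_realization_def using pg_free_good unfolding good_graph_def by blast
qed

end

section \<open>Fixing the input by forbidden patterns\<close>

context good
begin

lemma contains_Dpg:
  assumes emb: "emb f len A W EG" and c: "contains_pg W EG (Dpg n b)"
  shows "b \<longleftrightarrow> v = n"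
proof -
  obtain \<psi> where "inj_on \<psi> (vset n) \<and> \<psi> ` vset n \<subseteq> VS len \<and>
     (\<forall>x\<in>vset n. \<forall>y\<in>vset n. {x, y} \<in> pgE n b \<longleftrightarrow> A (\<psi> x) (\<psi> y))"
    using c unfolding contains_plain_iff[OF emb wf_Dpg Dpg_simps(2)] Dpg_simps by blast
  then have inj: "inj_on \<psi> (vset n)" and VS: "\<And>x. x \<in> vset n \<Longrightarrow> \<psi> x \<in> VS len"
    and adj: "\<And>x y. x \<in> vset n \<Longrightarrow> y \<in> vset n \<Longrightarrow> A (\<psi> x) (\<psi> y) \<longleftrightarrow> {x, y} \<in> pgE n b" by auto
  have adj: "A (\<psi> x) (\<psi> y) \<longleftrightarrow> dirE n b x y \<or> dirE n b y x" if "x \<in> vset n" "y \<in> vset n" for x y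
    using adj[OF that] pgE_iff[OF that] by simp
  have inj': "inj_on \<psi> {..<nR}" using inj by (rule inj_on_subset) (auto simp: vset_mem)
  have VS': "\<psi> x \<in> VS len" if "x < nR" for x using VS[OF vset_mem(1)[OF that]] .
  have adj': "A (\<psi> x) (\<psi> y) \<longleftrightarrow> radj x y" if "x < nR" "y < nR" for x y
    using adj[OF vset_mem(1)[OF that(1)] vset_mem(1)[OF that(2)]] that radj_sym by (auto simp: dirE_simps)
  have r1: "\<psi> ` {..<nR} = Rt ` {..<nR}"
    by (rule rigidity(1)[OF inj']) (use VS' adj' in blast)+
  have r2: "\<psi> x = Rt x" if "rigid_root x" for x
    by (rule rigidity(2)[OF inj']) (use VS' adj' that in blast)+
  have nonroot: "\<exists>i j. \<psi> x = Pt i j \<and> i \<le> k \<and> j < len i" if x: "x \<in> vset n" "\<not> x < nR" for x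
  proof (cases "\<psi> x")
    case (Rt y)
    then have "\<psi> x \<in> Rt ` {..<nR}" using VS[OF x(1)] by simp
    then have "\<psi> x \<in> \<psi> ` {..<nR}" by (simp only: r1)
    then obtain z where "z < nR" "\<psi> x = \<psi> z" by blast
    then show ?thesis using inj_onD[OF inj, of x z] x by (auto simp: vset_mem)
  next
    case (Pt i j)
    then show ?thesis using VS[OF x(1)] by simp
  qed
  have k1: "1 \<le> k" using k_pos by simp
  have tzn: "\<not> tz < nR" and qvn: "\<not> qv j < nR" for j using tz_gt by (auto simp: qv_def)
  have pa_path: "i = i' \<and> j = 0" if "A (Rt (pa i')) (Pt i j)" "i' \<le> k" "i \<le> k" "j < len i" for i i' j
  proof -
    have "pa i' = pa i \<and> j = 0 \<or> pa i' = pb i \<and> Suc j = len i \<or> spk (pa i') i"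
      using A_label[OF pa_less[OF that(2)] that(3,4,1)] .
    then show ?thesis using spk_less[of "pa i'" i] that pa_ge[of i'] by (auto simp: pa_def pb_def; presburger)
  qed
  have t: "\<psi> tz = Pt 0 0"
  proof -
    obtain i j where ij: "\<psi> tz = Pt i j" "i \<le> k" "j < len i" using nonroot[OF vset_mem(2) tzn] by blast
    have "A (\<psi> (pa 0)) (\<psi> tz)"
      using adj[OF vset_mem(1) vset_mem(2), of "pa 0"] pa_less[of 0] by (simp add: dirE_simps)
    then have "A (Rt (pa 0)) (Pt i j)" using r2[OF rigid_root_pa[of 0]] ij by simp
    then show ?thesis using pa_path[of 0 i j] ij by simp
  qed
  have q: "\<psi> (qv j) = Pt 1 j \<and> j < len 1" if "j \<le> n" for j
    using that
  proof (induction j rule: less_induct)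
    case (less j)
    obtain i j' where ij: "\<psi> (qv j) = Pt i j'" "i \<le> k" "j' < len i" using nonroot[OF vset_mem(3)[OF less.prems] qvn] by blast
    show ?case
    proof (cases j)
      case 0
      have "A (\<psi> (pa 1)) (\<psi> (qv j))"
        using adj[OF vset_mem(1) vset_mem(3)[OF less.prems], of "pa 1"] pa_less[OF k1] 0 by (simp add: dirE_simps)
      then have "A (Rt (pa 1)) (Pt i j')" using r2[OF rigid_root_pa[OF k1]] ij by simp
      then show ?thesis using pa_path[OF _ k1] ij 0 by auto
    next
      case (Suc j0)
      let ?x = "lab 1 (j mod 3)"
      have sp: "spk ?x 1" by (rule spk_lab) simp
      then have x: "?x < nR" "?x < nD" using spk_less k1 nD_nR by fastforce+
      have "A (\<psi> ?x) (\<psi> (qv j))"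
        using adj[OF vset_mem(1)[OF x(1)] vset_mem(3)[OF less.prems]] x by (simp add: dirE_simps)
      then have "A (Rt ?x) (Pt i j')" using r2[OF rigid_root_spk[OF sp k1]] ij by simp
      then have "spk ?x i" using A_label[OF x(1) ij(2,3)] x(2) pa_ge[of i] pb_ge[of i] by auto
      then have i: "i = 1" using spk_inj sp ij k1 by blast
      have IH: "\<psi> (qv j0) = Pt 1 j0" "j0 < len 1" using less.IH[of j0] less.prems Suc by auto
      have "A (\<psi> (qv j0)) (\<psi> (qv j))"
        using adj[OF vset_mem(3) vset_mem(3), of j0 j] less.prems Suc by (simp add: dirE_simps)
      then have "j' = Suc j0 \<or> j0 = Suc j'" using IH ij i A_path[OF k1 IH(2), of j'] by simp
      moreover have "j0 \<noteq> Suc j'"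
      proof
        assume e: "j0 = Suc j'"
        then have "\<psi> (qv j') = \<psi> (qv j)" using less.IH[of j'] less.prems Suc ij i by simp
        then have "qv j' = qv j" using inj_onD[OF inj, of "qv j'" "qv j"] vset_mem(3) less.prems Suc e by simp
        then show False using e Suc by (simp add: qv_def)
      qed
      ultimately show ?thesis using ij i Suc by simp
    qed
  qed
  have "A (\<psi> tz) (\<psi> (qv n)) \<longleftrightarrow> b"
    using adj[OF vset_mem(2) vset_mem(3), of n] by (simp add: dirE_simps)
  moreover have "A (Pt 0 0) (Pt 1 n) \<longleftrightarrow> val 0 0 = n"
    using G_val[of 0 0 n] len_pos[of 0] k_pos q[of n] by simp
  moreover have "val 0 0 = v" using run k_pos by (simp add: is_run_def)
  ultimately show ?thesis using t q[of n] by simp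
qed

end

context free_layout
begin

lemma contains_initial:
  assumes l1: "Suc n < len 1" and b: "\<And>j. j \<le> n \<Longrightarrow> value_of 0 0 = j \<longleftrightarrow> b \<and> j = n"
  shows "contains_pg W EG (Dpg n b)"
proof -
  have k1: "1 \<le> k" using k_pos by simp
  have l0: "0 < len 0" using len_pos by simp
  have "A (vert_of x) (vert_of y) \<longleftrightarrow> dirE n b x y \<or> dirE n b y x" if xy: "x \<in> vset n" "y \<in> vset n" for x y
  proof (rule explicit_adj[OF initial_time(3) l1 _ _ initial_time(2) _ _ xy])
    show "A (Rt (lab 0 r)) (Pt 0 0) \<longleftrightarrow> r = 0" if "r < 3" for r using index_label[of 0 0 r] that l0 by simp
    show "A (Rt (stl s)) (Pt 0 0) \<longleftrightarrow> s = s0" if "s < m" for s using state_label[OF l0 that] initial_time(1) by simp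
    show "A (Rt (lab 1 r)) (Pt 1 j) \<longleftrightarrow> r = j mod 3" if "j \<le> n" "r < 3" for j r
      using index_label[OF k1, of j r] that l1 by simp
    show "A (Pt 0 0) (Pt 1 j) \<longleftrightarrow> b \<and> j = n" if "j \<le> n" for j
      using value_unique(1)[OF l0 k_pos, of j] b[OF that] that l1 by auto
  qed
  then have "\<forall>x\<in>vset n. \<forall>y\<in>vset n. {x, y} \<in> pgE n b \<longleftrightarrow> A (vert_of x) (vert_of y)"
    using pgE_iff by simp
  moreover have "vert_of ` vset n \<subseteq> VS len" using vert_of_VS[of len n] l0 l1 by auto
  ultimately show ?thesis
    unfolding contains_plain_iff[OF emb wf_Dpg Dpg_simps(2)] Dpg_simps using inj_on_vert_of by blast
qed

end

context machine
begin

text \<open>Excludes the initial values up to \<open>n\<close> and those above \<open>Suc n\<close>,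
  so that a fixed pathograph to be realized is left with the input \<open>Suc n\<close>.\<close>

definition family :: "nat \<Rightarrow> pathograph set" where
  "family n = forbidden \<union> {Dpg j True | j. j \<le> n} \<union> {Dpg (Suc n) False}"

lemma finite_family: "finite (family n)"
  unfolding family_def using finite_forbidden by simp

lemma wf_family: "F \<in> family n \<Longrightarrow> wf_pathograph F"
  unfolding family_def using wf_Dpg by (auto simp: forbidden_def)

text \<open>The pathograph \<open>Hpg 0 False\<close> restricts the input only by excluding 0; this
  is the reason for the shift to \<open>Suc n\<close>.\<close>

theorem family_free_realization_iff_accepts:
  "has_free_realization (family n) (Hpg 0 False) \<longleftrightarrow> accepts (Suc n)"
proof
  assume "has_free_realization (family n) (Hpg 0 False)"
  then obtain W EG where r: "realization (Hpg 0 False) W EG" and free: "pg_free (family n) W EG"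
    unfolding has_free_realization_def by blast
  obtain f len A where layout: "layout k m s0 h R len A" and emb: "emb f len A W EG"
    using r by (rule layout_of_realization) blast
  have free': "pg_free forbidden W EG" using free by (auto simp: pg_free_def family_def)
  interpret L: free_layout k m s0 h R len A f W EG
    by (intro free_layout.intro layout free_layout_axioms.intro emb free')
  have l0: "0 < len 0" using L.len_pos by simp
  have l1: "0 < len 1" using L.len_pos k_pos by simp
  have vl: "Suc (L.value_of 0 0) < len 1" using L.value_unique(2)[OF l0 k_pos, of 0] l1 by simp
  have "L.value_of 0 0 = Suc n"
  proof (rule ccontr)
    assume ne: "L.value_of 0 0 \<noteq> Suc n"
    show False
    proof (cases "L.value_of 0 0 \<le> n")
      case True
      have "contains_pg W EG (Dpg (L.value_of 0 0) True)" by (rule L.contains_initial[OF vl]) auto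
      moreover have "Dpg (L.value_of 0 0) True \<in> family n" using True by (auto simp: family_def)
      ultimately show ?thesis using free by (auto simp: pg_free_def)
    next
      case False
      have "contains_pg W EG (Dpg (Suc n) False)" by (rule L.contains_initial) (use vl ne False in auto)
      then show ?thesis using free by (auto simp: pg_free_def family_def)
    qed
  qed
  then show "accepts (Suc n)" using L.accepts_value by simp
next
  assume "accepts (Suc n)"
  then obtain W EG len A T st val where r: "realization (Hpg 0 False) W EG" and emb: "emb vert_code len A W EG"
    and good: "good k m s0 h R len A T st val (Suc n)"
    by (rule realization_of_run[where b = False and n = 0]) simp_all
  interpret G: good k m s0 h R len A T st val "Suc n" by (rule good)
  have "\<not> contains_pg W EG (Dpg j True)" if "j \<le> n" for j using G.contains_Dpg[OF emb, of j True] that by auto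
  moreover have "\<not> contains_pg W EG (Dpg (Suc n) False)" using G.contains_Dpg[OF emb, of "Suc n" False] by auto
  moreover have "pg_free forbidden W EG" 
    by (rule pg_free_good) (use emb good in \<open>unfold good_graph_def, blast\<close>)
  ultimately have "pg_free (family n) W EG" by (auto simp: pg_free_def family_def)
  then show "has_free_realization (family n) (Hpg 0 False)" unfolding has_free_realization_def using r by blast
qed

end

subsection \<open>Computability of the reductions\<close>

text \<open>The code of a set is the sum of the powers of two given by its elements, hence a bounded
  sum once membership is decidable below a computable bound.\<close>

lemma total_rec_set_encode:
  assumes B: "total_rec n B" and P: "decidable_pred (Suc n) (\<lambda>ys. P (ys ! 0) (tl ys))"
    and S: "\<And>xs. length xs = n \<Longrightarrow> S xs = {x. x < B xs \<and> P x xs}"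
  shows "total_rec n (\<lambda>xs. set_encode (S xs))"
proof -
  have "total_rec n (\<lambda>xs. \<Sum>x<B xs. of_bool (P x xs) * 2 ^ x)"
    by (intro total_rec_sum[OF B, where g = "\<lambda>x xs. of_bool (P x xs) * 2 ^ x"] total_rec_mult total_rec_of_bool
        total_rec_power total_rec_const total_rec.proj P) simp
  then show ?thesis
  proof (rule total_rec.ext, intro allI impI)
    fix xs :: "nat list" assume "length xs = n"
    then have "set_encode (S xs) = (\<Sum>x | x < B xs \<and> P x xs. 2 ^ x)" using S by (simp add: set_encode_def)
    also have "{x. x < B xs \<and> P x xs} = {x \<in> {..<B xs}. P x xs}" by auto
    also have "(\<Sum>x\<in>{x \<in> {..<B xs}. P x xs}. 2 ^ x) = (\<Sum>x<B xs. if P x xs then 2 ^ x else (0::nat))"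
      by (rule sum.inter_filter) simp
    also have "\<dots> = (\<Sum>x<B xs. of_bool (P x xs) * 2 ^ x)" by (rule sum.cong) auto
    finally show "set_encode (S xs) = (\<Sum>x<B xs. of_bool (P x xs) * 2 ^ x)" .
  qed
qed

lemma total_rec_set_encode_image2:
  assumes B: "total_rec n B" and C: "total_rec n C"
    and P: "decidable_pred (Suc (Suc n)) (\<lambda>ys. P (tl ys ! 0) (ys ! 0) (tl (tl ys)))"
    and g: "total_rec (Suc (Suc n)) (\<lambda>ys. g (tl ys ! 0) (ys ! 0) (tl (tl ys)))"
    and S: "\<And>xs. length xs = n \<Longrightarrow> S xs = {g x y xs | x y. x < B xs \<and> y < C xs \<and> P x y xs}"
  shows "total_rec n (\<lambda>xs. set_encode (S xs))"
proof (rule total_rec_set_encode)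
  \<comment> \<open>A computable strict bound for the elements of the image: no summand exceeds the
    sum.\<close>
  let ?D = "\<lambda>xs. Suc (\<Sum>x<B xs. \<Sum>y<C xs. g x y xs)"
  show "total_rec n ?D"
    by (intro total_rec_Suc total_rec_sum[OF B, where g = "\<lambda>x xs. \<Sum>y<C xs. g x y xs"]
        total_rec_sum[where g = "\<lambda>y xs. g (xs ! 0) y (tl xs)"] total_rec_tl[OF C] g)
  have shift: "total_rec (Suc (Suc (Suc n))) (\<lambda>ys. F (tl ys ! 0) (ys ! 0) (tl (tl (tl ys))))"
    if F: "total_rec (Suc (Suc n)) (\<lambda>ys. F (tl ys ! 0) (ys ! 0) (tl (tl ys)))" for F
  proof -
    let ?gs = "(\<lambda>ys. ys ! 0) # (\<lambda>ys. ys ! 1) # map (\<lambda>i ys. ys ! (i + 3)) [0..<n]"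
    have "total_rec (Suc (Suc (Suc n))) (\<lambda>xs. (\<lambda>ys. F (tl ys ! 0) (ys ! 0) (tl (tl ys))) (map (\<lambda>g. g xs) ?gs))"
      by (rule total_rec.comp[OF F]) (auto intro: total_rec.proj)
    then show ?thesis
    proof (rule total_rec.ext, intro allI impI)
      fix xs :: "nat list" assume l: "length xs = Suc (Suc (Suc n))"
      then have "tl (tl (tl xs)) = map (\<lambda>i. xs ! (i + 3)) [0..<n]"
        by (intro nth_equalityI) (auto simp: nth_tl eval_nat_numeral)
      moreover have "tl xs ! 0 = xs ! 1" using l by (simp add: nth_tl)
      ultimately show "F (tl xs ! 0) (xs ! 0) (tl (tl (tl xs))) = (\<lambda>ys. F (tl ys ! 0) (ys ! 0) (tl (tl ys))) (map (\<lambda>g. g xs) ?gs)"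
        by (simp add: comp_def)
    qed
  qed
  show "decidable_pred (Suc n) (\<lambda>ys. \<exists>x<B (tl ys). \<exists>y<C (tl ys). P x y (tl ys) \<and> ys ! 0 = g x y (tl ys))"
    by (intro decidable_pred_ex[where P = "\<lambda>x ys. \<exists>y<C (tl ys). P x y (tl ys) \<and> ys ! 0 = g x y (tl ys)"]
        decidable_pred_ex[where P = "\<lambda>y ys. P (ys ! 0) y (tl (tl ys)) \<and> tl ys ! 0 = g (ys ! 0) y (tl (tl ys))"]
        total_rec_tl[OF B] total_rec_tl[OF total_rec_tl[OF C]] decidable_pred_conj decidable_pred_eq
        shift[OF g] shift[OF P[unfolded decidable_pred_def], folded decidable_pred_def] total_rec_nth_tl_tl) simp
  fix xs :: "nat list" assume l: "length xs = n"
  have "g x y xs < ?D xs" if "x < B xs" "y < C xs" for x y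
  proof -
    have "g x y xs \<le> (\<Sum>y<C xs. g x y xs)" using that by (intro member_le_sum) auto
    also have "\<dots> \<le> (\<Sum>x<B xs. \<Sum>y<C xs. g x y xs)" using that by (intro member_le_sum) auto
    finally show ?thesis by simp
  qed
  then show "S xs = {z. z < ?D xs \<and> (\<exists>x<B xs. \<exists>y<C xs. P x y xs \<and> z = g x y xs)}"
    unfolding S[OF l] by blast
qed

lemma set_encode_insert2: "a \<noteq> b \<Longrightarrow> set_encode {a, b} = 2 ^ a + 2 ^ b"
  by (simp add: set_encode_insert)

context machine
begin

lemma total_rec_vset: "total_rec 1 (\<lambda>xs. set_encode (vset (xs ! 0)))"
proof (rule total_rec_set_encode)
  show "total_rec 1 (\<lambda>xs. Suc (tz + 1 + xs ! 0))" by (intro total_rec_intros; simp)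
  show "decidable_pred (Suc 1) (\<lambda>ys. ys ! 0 < nR \<or> tz \<le> ys ! 0 \<and> ys ! 0 \<le> tz + 1 + tl ys ! 0)"
    by (intro total_rec_intros; simp)
  show "vset (xs ! 0) = {x. x < Suc (tz + 1 + xs ! 0) \<and> (x < nR \<or> tz \<le> x \<and> x \<le> tz + 1 + xs ! 0)}" for xs
    using tz_gt by (auto simp: vset_def qv_def)
qed

lemma total_rec_pgE: "total_rec 1 (\<lambda>xs. set_encode (set_encode ` pgE (xs ! 0) b))"
proof (rule total_rec_set_encode_image2)
  let ?B = "\<lambda>xs. Suc (tz + 1 + xs ! 0)"
  let ?in = "\<lambda>x n. x < nR \<or> tz \<le> x \<and> x \<le> tz + 1 + n"
  show "total_rec 1 ?B" "total_rec 1 ?B" by (intro total_rec_intros; simp)+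
  show "decidable_pred (Suc (Suc 1)) (\<lambda>ys. ?in (tl ys ! 0) (tl (tl ys) ! 0) \<and> ?in (ys ! 0) (tl (tl ys) ! 0) \<and>
      dirE (tl (tl ys) ! 0) b (tl ys ! 0) (ys ! 0))"
    unfolding dirE_def radj_def lab_def by (intro total_rec_intros; simp)
  show "total_rec (Suc (Suc 1)) (\<lambda>ys. 2 ^ (tl ys ! 0) + 2 ^ (ys ! 0))" by (intro total_rec_intros; simp)
  fix xs :: "nat list"
  let ?n = "xs ! 0"
  have in_vset: "x \<in> vset ?n \<longleftrightarrow> ?in x ?n" for x by (simp add: vset_def qv_def)
  have lt: "x < ?B xs" if "?in x ?n" for x using that tz_gt by auto
  show "set_encode ` pgE ?n b = {2 ^ x + 2 ^ y | x y. x < ?B xs \<and> y < ?B xs \<and> ?in x ?n \<and> ?in y ?n \<and> dirE ?n b x y}"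
  proof (intro set_eqI iffI)
    fix z :: nat assume "z \<in> set_encode ` pgE ?n b"
    then obtain x y where xy: "z = set_encode {x, y}" "x \<in> vset ?n" "y \<in> vset ?n" "dirE ?n b x y"
      by (auto simp: pgE_def)
    then have "x \<noteq> y" using dirE_irrefl by auto
    then have "z = 2 ^ x + 2 ^ y" using xy set_encode_insert2 by simp
    then show "z \<in> {2 ^ x + 2 ^ y | x y. x < ?B xs \<and> y < ?B xs \<and> ?in x ?n \<and> ?in y ?n \<and> dirE ?n b x y}"
      using xy lt unfolding in_vset by blast
  next
    fix z :: nat assume "z \<in> {2 ^ x + 2 ^ y | x y. x < ?B xs \<and> y < ?B xs \<and> ?in x ?n \<and> ?in y ?n \<and> dirE ?n b x y}"
    then obtain x y where xy: "z = 2 ^ x + 2 ^ y" "x \<in> vset ?n" "y \<in> vset ?n" "dirE ?n b x y"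
      unfolding in_vset by blast
    then have "x \<noteq> y" using dirE_irrefl by auto
    then have "z = set_encode {x, y}" using xy set_encode_insert2 by simp
    then show "z \<in> set_encode ` pgE ?n b" using xy unfolding pgE_def by blast
  qed
qed

lemma total_rec_pS: "total_rec 1 (\<lambda>xs. set_encode (prod_encode ` pS (Hpg (xs ! 0) b)))"
proof (rule total_rec_set_encode_image2)
  let ?B = "\<lambda>xs. Suc (tz + 1 + xs ! 0)" and ?C = "\<lambda>xs :: nat list. Suc (nR + k)"
  let ?P = "\<lambda>x u xs. nR \<le> u \<and> u \<le> nR + k \<and> (x < nR \<and> spk x (u - nR) \<or>
       x = tz \<and> nR + 1 \<le> u \<and> (u = nR + 1 \<longrightarrow> \<not> b) \<or> tz < x \<and> x \<le> tz + 1 + xs ! 0 \<and> u = nR)"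
  show "total_rec 1 ?B" "total_rec 1 ?C" by (intro total_rec_intros; simp)+
  show "decidable_pred (Suc (Suc 1)) (\<lambda>ys. ?P (tl ys ! 0) (ys ! 0) (tl (tl ys)))"
    unfolding spk_def lab_def stl_def by (intro total_rec_intros; simp)
  show "total_rec (Suc (Suc 1)) (\<lambda>ys. prod_encode (tl ys ! 0, ys ! 0))" by (intro total_rec_intros; simp)
  fix xs :: "nat list"
  have lt: "x < ?B xs \<and> u < ?C xs" if "?P x u xs" for x u using that tz_gt by auto
  have eq: "pS (Hpg (xs ! 0) b) = {(x, u). ?P x u xs}" by (simp add: qv_def)
  show "prod_encode ` pS (Hpg (xs ! 0) b) = {prod_encode (x, u) | x u. x < ?B xs \<and> u < ?C xs \<and> ?P x u xs}"
  proof (intro set_eqI iffI)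
    fix z assume "z \<in> prod_encode ` pS (Hpg (xs ! 0) b)"
    then obtain x u where xu: "z = prod_encode (x, u)" "?P x u xs" unfolding eq by (elim imageE CollectE case_prodE) blast
    show "z \<in> {prod_encode (x, u) | x u. x < ?B xs \<and> u < ?C xs \<and> ?P x u xs}"
      by (rule CollectI, intro exI[of _ x] exI[of _ u] conjI[OF xu(1)] conjI[OF conjunct1[OF lt[OF xu(2)]]]
          conjI[OF conjunct2[OF lt[OF xu(2)]]] xu(2))
  next
    fix z assume "z \<in> {prod_encode (x, u) | x u. x < ?B xs \<and> u < ?C xs \<and> ?P x u xs}"
    then obtain x u where xu: "z = prod_encode (x, u)" "?P x u xs" by (elim CollectE exE conjE) blast
    then have "(x, u) \<in> pS (Hpg (xs ! 0) b)" unfolding eq by simp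
    then show "z \<in> prod_encode ` pS (Hpg (xs ! 0) b)" using xu(1) by (rule rev_image_eqI)
  qed
qed

lemma total_rec_ppi:
  "total_rec 1 (\<lambda>xs. set_encode ((\<lambda>u. prod_encode (u, set_encode (ppi (Hpg (xs ! 0) b) u))) ` pU (Hpg (xs ! 0) b)))"
proof (rule total_rec_set_encode_image2)
  \<comment> \<open>The image has one genuine parameter, the urpath; the other is a dummy that takes
    only the value 0.\<close>
  let ?B = "\<lambda>xs :: nat list. 1 :: nat" and ?C = "\<lambda>xs :: nat list. Suc (nR + k)"
  let ?s = "\<lambda>u n. if u - nR = 0 then tz else if u - nR = 1 then tz + 1 + n else nD + 2 * (u - nR)"
  let ?g = "\<lambda>(x :: nat) u xs. prod_encode (u, 2 ^ ?s u (xs ! 0) + 2 ^ (nD + 2 * (u - nR) + 1))"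
  show "total_rec 1 ?B" "total_rec 1 ?C" by (intro total_rec_intros; simp)+
  show "decidable_pred (Suc (Suc 1)) (\<lambda>ys. nR \<le> ys ! 0)" by (intro total_rec_intros; simp)
  show "total_rec (Suc (Suc 1)) (\<lambda>ys. ?g (tl ys ! 0) (ys ! 0) (tl (tl ys)))" by (intro total_rec_intros; simp)
  fix xs :: "nat list"
  have eq: "set_encode (ppi (Hpg (xs ! 0) b) u) = 2 ^ ?s u (xs ! 0) + 2 ^ (nD + 2 * (u - nR) + 1)"
    if "nR \<le> u" "u \<le> nR + k" for u
  proof -
    have "u - nR \<le> k" using that by simp
    then have "set_encode {path_start (xs ! 0) (u - nR), pb (u - nR)} = 2 ^ path_start (xs ! 0) (u - nR) + 2 ^ pb (u - nR)"
      using path_start_ne by (intro set_encode_insert2)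
    then show ?thesis by (simp add: path_start_def pb_def pa_def qv_def)
  qed
  show "(\<lambda>u. prod_encode (u, set_encode (ppi (Hpg (xs ! 0) b) u))) ` pU (Hpg (xs ! 0) b) =
      {?g x u xs | x u. x < ?B xs \<and> u < ?C xs \<and> nR \<le> u}" (is "?L = ?R")
  proof (intro set_eqI iffI)
    fix z assume "z \<in> ?L"
    then obtain u where u: "nR \<le> u" "u \<le> nR + k" "z = prod_encode (u, set_encode (ppi (Hpg (xs ! 0) b) u))"
      by (auto simp del: Hpg_simps(6))
    have "z = ?g 0 u xs \<and> (0::nat) < ?B xs \<and> u < ?C xs \<and> nR \<le> u" using u eq[OF u(1,2)] by simp
    then show "z \<in> ?R" by (intro CollectI exI[of _ "0::nat"] exI[of _ u])
  next
    fix z assume "z \<in> ?R"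
    then obtain u where u: "nR \<le> u" "u \<le> nR + k" "z = ?g 0 u xs" by auto
    then have "z = prod_encode (u, set_encode (ppi (Hpg (xs ! 0) b) u))" using eq[OF u(1,2)] by simp
    then show "z \<in> ?L" using u(1,2) by (intro image_eqI[of _ _ u]) auto
  qed
qed

lemma total_rec_Hpg_code: "total_rec 1 (\<lambda>xs. pg_code (Hpg (xs ! 0) b))"
proof -
  have "total_rec 1 (\<lambda>xs. cons_code (set_encode (vset (xs ! 0))) (cons_code (set_encode {u. nR \<le> u \<and> u \<le> nR + k})
     (cons_code (set_encode (set_encode ` pgE (xs ! 0) b)) (cons_code (set_encode (prod_encode ` pS (Hpg (xs ! 0) b)))
     (cons_code (set_encode (set_encode ` {{nR, u} | u. nR + 1 \<le> u \<and> u \<le> nR + k}))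
     (cons_code (set_encode ((\<lambda>u. prod_encode (u, set_encode (ppi (Hpg (xs ! 0) b) u))) ` pU (Hpg (xs ! 0) b))) 0))))))"
    by (intro total_rec_Suc total_rec_prod_encode total_rec_const total_rec_vset total_rec_pgE total_rec_pS total_rec_ppi)
  then show ?thesis unfolding pg_code_def list_encode.simps by (simp only: Hpg_simps(1-3,5))
qed

lemma total_rec_Dpg_code: "total_rec 1 (\<lambda>xs. pg_code (Dpg (xs ! 0) b))"
proof -
  have "total_rec 1 (\<lambda>xs. cons_code (set_encode (vset (xs ! 0))) (cons_code (set_encode {})
     (cons_code (set_encode (set_encode ` pgE (xs ! 0) b)) (cons_code (set_encode {})
     (cons_code (set_encode {}) (cons_code (set_encode {}) 0))))))"
    by (intro total_rec_Suc total_rec_prod_encode total_rec_const total_rec_vset total_rec_pgE)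
  then show ?thesis unfolding pg_code_def list_encode.simps by (simp add: Dpg_def)
qed

lemma total_rec_family_code: "total_rec 1 (\<lambda>xs. family_code (family (xs ! 0)))"
  unfolding family_code_def
proof (rule total_rec_set_encode)
  let ?d = "\<lambda>b j. pg_code (Dpg j b)"
  \<comment> \<open>The set \<open>forbidden\<close> does not depend on the input, so its code is a
    constant.\<close>
  let ?c = "set_encode (pg_code ` forbidden)"
  have d: "total_rec n (\<lambda>xs. ?d b (f xs))" if "total_rec n f" for n f b
    using total_rec_comp1[OF total_rec_Dpg_code that] .
  let ?B = "\<lambda>xs. Suc (\<Sum>z\<in>pg_code ` forbidden. z) + (\<Sum>j<Suc (xs ! 0). ?d True j) + ?d False (Suc (xs ! 0))"
  let ?P = "\<lambda>z xs. z \<in> set_decode ?c \<or> (\<exists>j<Suc (xs ! 0). z = ?d True j) \<or> z = ?d False (Suc (xs ! 0))"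
  show "total_rec 1 ?B"
    by (intro total_rec_add total_rec_const total_rec_sum[where g = "\<lambda>j xs. ?d True j"] d total_rec_Suc total_rec.proj) simp_all
  show "decidable_pred (Suc 1) (\<lambda>ys. ?P (ys ! 0) (tl ys))"
    by (intro decidable_pred_disj decidable_pred_set_decode decidable_pred_ex[where P = "\<lambda>j ys. ys ! 0 = ?d True j"]
        decidable_pred_eq d total_rec_Suc total_rec_const total_rec.proj total_rec_nth_tl) simp_all
  fix xs :: "nat list"
  let ?n = "xs ! 0"
  have fin: "finite (pg_code ` forbidden)" using finite_forbidden by simp
  have dec: "set_decode ?c = pg_code ` forbidden" using fin by simp
  have 1: "z < ?B xs" if "z \<in> pg_code ` forbidden" for z
    using member_le_sum[OF that, of "\<lambda>z. z"] fin by simp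
  have 2: "?d True j < ?B xs" if "j < Suc ?n" for j
  proof -
    have "?d True j \<le> (\<Sum>j<Suc ?n. ?d True j)" using that by (intro member_le_sum) auto
    then show ?thesis by linarith
  qed
  have fam: "pg_code ` family ?n = pg_code ` forbidden \<union> {?d True j | j. j < Suc ?n} \<union> {?d False (Suc ?n)}"
    unfolding family_def by (auto simp: less_Suc_eq_le)
  show "pg_code ` family ?n = {z. z < ?B xs \<and> ?P z xs}"
    unfolding fam dec using 1 2 by auto
qed

end

text \<open>Precomposition with the predecessor moves undecidability to the positive inputs, the
  only ones that the reduction for (b) can express; the reduction for (a) uses the same
  machine.\<close>

lemma undecidable_machine:
  obtains k m s0 h R where "machine k m s0 h R"
    "\<And>f. total_rec 1 f \<Longrightarrow> \<not> (\<forall>n. f [n] \<noteq> 0 \<longleftrightarrow> machine.accepts k s0 h R (Suc n))"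
proof -
  obtain V where V: "total_rec 2 V"
    and undec: "\<And>f. total_rec 1 f \<Longrightarrow> \<not> (\<forall>n. f [n] \<noteq> 0 \<longleftrightarrow> (\<exists>y. V [n, y] = 0))"
    by (rule undecidable_enumerable_set) blast
  let ?V = "\<lambda>xs. V (map (\<lambda>g. g xs) [\<lambda>xs. xs ! 0 - 1, \<lambda>xs. xs ! 1])"
  have "total_rec 2 ?V"
    by (rule total_rec.comp[OF V]) (auto intro!: total_rec_intros)
  then obtain c where c: "\<And>v. (\<exists>t. big c (\<lambda>i. if i = 0 then v else 0) t) \<longleftrightarrow> (\<exists>y. ?V [v, y] = 0)"
    by (rule search_program) blast
  obtain k m s0 h R where M: "machine k m s0 h R"
    "\<And>v. machine.accepts k s0 h R v \<longleftrightarrow> (\<exists>t. big c (\<lambda>i. if i = 0 then v else 0) t)"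
    by (rule machine_of_program[of c]) blast
  have "machine.accepts k s0 h R (Suc n) \<longleftrightarrow> (\<exists>y. V [n, y] = 0)" for n
    using M(2)[of "Suc n"] c[of "Suc n"] by simp
  then show thesis using that[OF M(1)] undec by simp
qed

lemma total_rec_app:
  assumes "total_rec 1 f" "total_rec 1 (\<lambda>xs. g (xs ! 0))"
  shows "total_rec 1 (\<lambda>xs. f [g (xs ! 0)])"
proof -
  have "total_rec 1 (\<lambda>xs. f (map (\<lambda>g. g xs) [\<lambda>xs. g (xs ! 0)]))"
    by (rule total_rec.comp[OF assms(1)]) (use assms(2) in auto)
  then show ?thesis by simp
qed

theorem theorem6:
  shows "(\<exists>\<F>. finite \<F> \<and> (\<forall>F\<in>\<F>. wf_pathograph F) \<and>
            \<not> (\<exists>f. total_rec 1 f \<and>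
                  (\<forall>H. wf_pathograph H \<longrightarrow>
                       (f [pg_code H] \<noteq> 0 \<longleftrightarrow> has_free_realization \<F> H))))
       \<and> (\<exists>H. wf_pathograph H \<and>
            \<not> (\<exists>f. total_rec 1 f \<and>
                  (\<forall>\<F>. finite \<F> \<and> (\<forall>F\<in>\<F>. wf_pathograph F) \<longrightarrow>
                       (f [family_code \<F>] \<noteq> 0 \<longleftrightarrow> has_free_realization \<F> H))))"
proof -
  obtain k m s0 h R where M: "machine k m s0 h R"
    and undec: "\<And>f. total_rec 1 f \<Longrightarrow> \<not> (\<forall>n. f [n] \<noteq> 0 \<longleftrightarrow> machine.accepts k s0 h R (Suc n))"
    by (rule undecidable_machine) blast
  interpret machine k m s0 h R by (rule M)
  have a: "\<not> (\<forall>H. wf_pathograph H \<longrightarrow> (f [pg_code H] \<noteq> 0 \<longleftrightarrow> has_free_realization forbidden H))"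
    if f: "total_rec 1 f" for f
  proof
    assume dec: "\<forall>H. wf_pathograph H \<longrightarrow> (f [pg_code H] \<noteq> 0 \<longleftrightarrow> has_free_realization forbidden H)"
    have "total_rec 1 (\<lambda>xs. pg_code (Hpg (Suc (xs ! 0)) True))"
      by (rule total_rec_comp1[OF total_rec_Hpg_code]) (intro total_rec_intros; simp)
    then have "total_rec 1 (\<lambda>xs. f [pg_code (Hpg (Suc (xs ! 0)) True)])"
      by (rule total_rec_app[OF f])
    moreover have "f [pg_code (Hpg (Suc n) True)] \<noteq> 0 \<longleftrightarrow> accepts (Suc n)" for n
      using dec wf_Hpg free_realization_iff_accepts by blast
    ultimately show False using undec by fastforce
  qed
  have b: "\<not> (\<forall>\<F>. finite \<F> \<and> (\<forall>F\<in>\<F>. wf_pathograph F) \<longrightarrow>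
      (f [family_code \<F>] \<noteq> 0 \<longleftrightarrow> has_free_realization \<F> (Hpg 0 False)))" if f: "total_rec 1 f" for f
  proof
    assume dec: "\<forall>\<F>. finite \<F> \<and> (\<forall>F\<in>\<F>. wf_pathograph F) \<longrightarrow>
      (f [family_code \<F>] \<noteq> 0 \<longleftrightarrow> has_free_realization \<F> (Hpg 0 False))"
    have "total_rec 1 (\<lambda>xs. f [family_code (family (xs ! 0))])"
      by (rule total_rec_app[OF f total_rec_family_code])
    moreover have "f [family_code (family n)] \<noteq> 0 \<longleftrightarrow> accepts (Suc n)" for n
      using dec[rule_format, of "family n"] finite_family[of n] wf_family[of _ n]
        family_free_realization_iff_accepts[of n] by simp
    ultimately show False using undec by fastforce
  qed
  have wf: "\<forall>F\<in>forbidden. wf_pathograph F" by (simp add: forbidden_def)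
  show ?thesis
    using a b finite_forbidden wf wf_Hpg[of 0 False] by blast
qed

end
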